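(* Let $(X_r,\nu_r)$, $r=1,\ldots,d$, be $\sigma$-finite measure spaces, $X=X_1\times\cdots\times X_d$, $\nu=\nu_1\otimes\cdots\otimes\nu_d$. For each $r$ let $L_r$ be a non-negative self-adjoint operator on $L^2(X_r,\nu_r)$ with an orthonormal basis of eigenfunctions $\{e_{k}^r\}_{k\in\mathbb{N}_0}$ corresponding to eigenvalues $0\le\lambda_0^r<\lambda_1^r<\cdots$, and assume that the orthonormal basis $\{e_{k_1}^1\otimes\cdots\otimes e_{k_d}^d\}_{k\in\mathbb{N}_0^d}$ of $L^2(X,\nu)$ is linearly dense in all the spaces $L^q(X,\nu)$, $1<q<\infty$. Fix $p>1$. Assume that for each $r=1,\ldots,d$ there is a sector $S_{\phi_p^r}$, $0<\phi_p^r<\pi/2$, with the following property: if $m_r\colon[0,\infty)\to\mathbb{C}$ is bounded on $[0,\infty)$, continuous on $(0,\infty)$, and $\sup_{t_r>0}\|m_r(t_rL_r)\|_{L^p(X_r,\nu_r)\to L^p(X_r,\nu_r)}<\infty$, then $m_r$ extends to a bounded holomorphic function in $S_{\phi_p^r}$ and $$\|m_r\|_{H^\infty(S_{\phi_p^r})}\le\sup_{t_r>0}\|m_r(t_rL_r)\|_{L^p(X_r,\nu_r)\to L^p(X_r,\nu_r)}.$$ Then every function $m\colon[0,\infty)^d\to\mathbb{C}$ which is bounded on $[0,\infty)^d$, continuous on $(0,\infty)^d$, and such that $$\sup_{t\in(0,\infty)^d}\|m(t_1L_1,\ldots,t_dL_d)\|_{L^p(X,\nu)\to L^p(X,\nu)}<\infty$$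 extends to a bounded holomorphic function of several variables in $\mathbf{S}_{\phi_p}$, $\phi_p=(\phi_p^1,\ldots,\phi_p^d)$, and moreover $$\|m\|_{H^\infty(\mathbf{S}_{\phi_p})}\le\sup_{t\in(0,\infty)^d}\|m(t_1L_1,\ldots,t_dL_d)\|_{L^p(X,\nu)\to L^p(X,\nu)}.$$
   Context: For $\varphi\in(0,\pi/2)$, $S_\varphi=\{z\in\mathbb{C}\setminus\{0\}:|\operatorname{Arg}z|<\varphi\}$, and for $\phi\in(0,\pi/2)^d$, $\mathbf{S}_\phi=S_{\phi_1}\times\cdots\times S_{\phi_d}$. $H^\infty(U)$ is the space of bounded holomorphic functions on $U$ with the supremum norm; "extends" means that the restriction to $(0,\infty)$ (resp. $(0,\infty)^d$) extends. Multipliers: $m_r(t_rL_r)f=\sum_{k\ge0}m_r(t_r\lambda_k^r)\langle f,e_k^r\rangle e_k^r$ on $L^2(X_r,\nu_r)$, and with $e_k=e_{k_1}^1\otimes\cdots\otimes e_{k_d}^d$, $$m(t_1L_1,\ldots,t_dL_d)f=\sum_{k\in\mathbb{N}_0^d}m(t_1\lambda_{k_1}^1,\ldots,t_d\lambda_{k_d}^d)\langle f,e_k\rangle_{L^2(X,\nu)}e_k,\qquad f\in L^2(X,\nu).$$ $L^p$ operator norms are those of the extension from $L^2\cap L^p$ to $L^p$ (infinite if there is no bounded extension). *)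

theory Defs
  imports "HOL-Complex_Analysis.Complex_Analysis"
begin

text \<open>
  Elements of Lebesgue spaces are represented by measurable functions; all notions below are
  invariant under changes on null sets.
\<close>

definition Lp :: "real \<Rightarrow> 'a measure \<Rightarrow> ('a \<Rightarrow> complex) set" where
  "Lp p M = {f \<in> borel_measurable M. integrable M (\<lambda>x. norm (f x) powr p)}"

definition Lp_norm :: "real \<Rightarrow> 'a measure \<Rightarrow> ('a \<Rightarrow> complex) \<Rightarrow> real" where
  "Lp_norm p M f = (LINT x|M. norm (f x) powr p) powr (1 / p)"

definition L2_inner :: "'a measure \<Rightarrow> ('a \<Rightarrow> complex) \<Rightarrow> ('a \<Rightarrow> complex) \<Rightarrow> complex" where
  "L2_inner M f g = (LINT x|M. f x * cnj (g x))"

definition linearly_dense :: "real \<Rightarrow> 'a measure \<Rightarrow> ('k \<Rightarrow> 'a \<Rightarrow> complex) \<Rightarrow> bool" where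
  "linearly_dense q M e \<longleftrightarrow>
     (\<forall>k. e k \<in> Lp q M) \<and>
     (\<forall>f\<in>Lp q M. \<forall>\<epsilon>>0. \<exists>K c. finite K \<and> Lp_norm q M (\<lambda>x. f x - (\<Sum>k\<in>K. c k * e k x)) < \<epsilon>)"

definition orthonormal_basis :: "'a measure \<Rightarrow> ('k \<Rightarrow> 'a \<Rightarrow> complex) \<Rightarrow> bool" where
  "orthonormal_basis M e \<longleftrightarrow>
     (\<forall>k. e k \<in> Lp 2 M) \<and>
     (\<forall>j k. L2_inner M (e j) (e k) = (if j = k then 1 else 0)) \<and>
     linearly_dense 2 M e"

text \<open>
  A possibly unbounded operator \<open>T\<close> with domain \<open>D\<close>; only the values of \<open>T\<close> on \<open>D\<close> matter.
  The last clause says that the graph of the adjoint of \<open>T\<close> coincides, up to null sets,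
  with the graph of \<open>T\<close>, including equality of domains.
\<close>

definition selfadjoint_operator ::
    "'a measure \<Rightarrow> ('a \<Rightarrow> complex) set \<Rightarrow> (('a \<Rightarrow> complex) \<Rightarrow> ('a \<Rightarrow> complex)) \<Rightarrow> bool" where
  "selfadjoint_operator M D T \<longleftrightarrow>
     D \<subseteq> Lp 2 M \<and> T ` D \<subseteq> Lp 2 M \<and>
     (\<forall>f\<in>D. \<forall>g\<in>D. \<forall>a b. (\<lambda>x. a * f x + b * g x) \<in> D \<and>
        (AE x in M. T (\<lambda>x. a * f x + b * g x) x = a * T f x + b * T g x)) \<and>
     (\<forall>f\<in>Lp 2 M. \<forall>\<epsilon>>0. \<exists>g\<in>D. Lp_norm 2 M (\<lambda>x. f x - g x) < \<epsilon>) \<and>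
     (\<forall>g\<in>Lp 2 M. \<forall>h\<in>Lp 2 M.
        (\<forall>f\<in>D. L2_inner M (T f) g = L2_inner M f h) \<longleftrightarrow> (g \<in> D \<and> (AE x in M. T g x = h x)))"

definition nonneg_operator ::
    "'a measure \<Rightarrow> ('a \<Rightarrow> complex) set \<Rightarrow> (('a \<Rightarrow> complex) \<Rightarrow> ('a \<Rightarrow> complex)) \<Rightarrow> bool" where
  "nonneg_operator M D T \<longleftrightarrow> (\<forall>f\<in>D. L2_inner M (T f) f \<in> \<real>\<^sub>\<ge>\<^sub>0)"

text \<open>
  The operator \<open>f \<mapsto> \<Sum>k. c k \<langle>f, e k\<rangle> e k\<close>, the series converging unconditionally in \<open>L\<^sup>2\<close>.
  For an orthonormal system and bounded \<open>c\<close> the sum exists by the Riesz--Fischer theorem and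
  is unique up to null sets, so the choice made by \<open>SOME\<close> is immaterial.
\<close>

definition multiplier ::
    "'a measure \<Rightarrow> ('k \<Rightarrow> 'a \<Rightarrow> complex) \<Rightarrow> ('k \<Rightarrow> complex) \<Rightarrow> ('a \<Rightarrow> complex) \<Rightarrow> ('a \<Rightarrow> complex)" where
  "multiplier M e c f = (SOME g. g \<in> Lp 2 M \<and>
     ((\<lambda>K. Lp_norm 2 M (\<lambda>x. g x - (\<Sum>k\<in>K. c k * L2_inner M f (e k) * e k x))) \<longlongrightarrow> 0)
       (finite_subsets_at_top UNIV))"

text \<open>
  Since \<open>L\<^sup>2 \<inter> L\<^sup>p\<close> is dense in \<open>L\<^sup>p\<close>, the norm of the bounded extension is the least constant
  valid on \<open>L\<^sup>2 \<inter> L\<^sup>p\<close>; the infimum of the empty set is \<open>\<infinity>\<close>.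
\<close>

definition Lp_opnorm ::
    "real \<Rightarrow> 'a measure \<Rightarrow> (('a \<Rightarrow> complex) \<Rightarrow> ('a \<Rightarrow> complex)) \<Rightarrow> ennreal" where
  "Lp_opnorm p M T =
     (INF C\<in>{C::real. 0 \<le> C \<and>
        (\<forall>f\<in>Lp 2 M \<inter> Lp p M. T f \<in> Lp p M \<and> Lp_norm p M (T f) \<le> C * Lp_norm p M f)}. ennreal C)"

definition tensor ::
    "('d::finite \<Rightarrow> nat \<Rightarrow> 'a \<Rightarrow> complex) \<Rightarrow> ('d \<Rightarrow> nat) \<Rightarrow> ('d \<Rightarrow> 'a) \<Rightarrow> complex" where
  "tensor e k x = (\<Prod>r\<in>UNIV. e r (k r) (x r))"

definition sector :: "real \<Rightarrow> complex set" where
  "sector \<phi> = {z. z \<noteq> 0 \<and> \<bar>Arg z\<bar> < \<phi>}"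

definition polysector :: "('d::finite \<Rightarrow> real) \<Rightarrow> (complex ^ 'd) set" where
  "polysector \<phi> = {z. \<forall>r. z $ r \<in> sector (\<phi> r)}"

text \<open>Holomorphy in several variables: Frechet differentiability with complex-linear derivative.\<close>

definition holomorphic_several :: "(complex ^ 'd \<Rightarrow> complex) \<Rightarrow> (complex ^ 'd::finite) set \<Rightarrow> bool" where
  "holomorphic_several F U \<longleftrightarrow>
     (\<forall>z\<in>U. \<exists>F'. (F has_derivative F') (at z within U) \<and> (\<forall>c v. F' (c *s v) = c * F' v))"

definition Hinf_norm :: "'z set \<Rightarrow> ('z \<Rightarrow> complex) \<Rightarrow> ennreal" where
  "Hinf_norm U F = (SUP z\<in>U. ennreal (norm (F z)))"

end

theory Submission
  imports Defs
begin

text \<open>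
  For fixed elements \<open>f \<in> L\<^sup>2 \<inter> L\<^sup>p\<close>, \<open>g \<in> L\<^sup>2 \<inter> L\<^sup>q\<close> (\<open>q\<close> the conjugate exponent) and \<open>t > 0\<close>,
  the number \<open>\<langle>n(tL\<^sub>r)f, g\<rangle>\<close> is an absolutely convergent sum of weighted values of \<open>n\<close>, and by
  duality \<open>\<parallel>n(tL\<^sub>r)\<parallel>\<^sub>p \<le> K\<close> for all \<open>t\<close> means that all these functionals are at most
  \<open>K \<parallel>f\<parallel>\<^sub>p \<parallel>g\<parallel>\<^sub>q\<close>. For \<open>m\<close>, tensor products of such functionals are bounded by
  \<open>C \<Prod>\<^sub>r \<parallel>f\<^sub>r\<parallel>\<^sub>p \<parallel>g\<^sub>r\<parallel>\<^sub>q\<close>. Freezing the functionals in all variables but one gives a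
  multiplier of \<open>L\<^sub>r\<close>, so its holomorphic extension obeys the same bound; this makes it possible
  to extend \<open>m\<close> in one variable after the other while keeping the bound for the remaining ones.
  The new function is holomorphic in the variables extended earlier because its difference
  quotients are Cauchy uniformly in all functionals.

  Since \<open>m\<close> may be discontinuous on the faces \<open>x\<^sub>r = 0\<close> and \<open>0\<close> may be an eigenvalue, the
  argument is run with \<open>f\<^sub>r\<close> replaced by its projection off the kernel of \<open>L\<^sub>r\<close>. This costs a
  constant \<open>K\<close>. Applied to the powers \<open>m\<^sup>N\<close>, whose operator norms are at most \<open>C\<^sup>N\<close>, it gives
  \<open>\<bar>F\<bar>\<^sup>N \<le> K C\<^sup>N\<close> for the extension \<open>F\<close> of \<open>m\<close>, hence \<open>\<bar>F\<bar> \<le> C\<close>.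
\<close>

section \<open>Cauchy estimates and the identity theorem\<close>

text \<open>Once some variables are complex there is no operator left whose norm could be carried
  along. The induction therefore keeps scalar inequalities between iterated pairings and products of
  costs, with the extended variables as parameters. Tests concentrated at one point are among the
  tests; they come from the eigenfunction with index 1, whose eigenvalue is positive. With them any
  variable can be frozen at a positive value, and bounds on functionals become pointwise bounds. The
  extension is unique by the identity theorem, hence linear: a linear combination of multipliers
  that is small on all tests has an equally small extension. Both regularity statements for the new
  function rest on this, since a Cauchy estimate for each functional has a constant proportional to
  its cost. Projecting off the kernel is bounded on \<open>L\<^sup>p\<close> because the
  eigenfunctions lie in \<open>L\<^sup>p\<close> and \<open>L\<^sup>q\<close>: a non-null tensor
  product in \<open>L\<^sup>s\<close> of the product space has its factors in
  \<open>L\<^sup>s\<close>. Its crude norm bound does not depend on the power N, so taking N-th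
  roots removes it.\<close>

lemma Cauchy_bounds_half_ball:
  assumes "v holomorphic_on ball u \<rho>" "\<And>w. w \<in> ball u \<rho> \<Longrightarrow> norm (v w) \<le> B" "0 < \<rho>"
    and "norm (h::complex) \<le> \<rho> / 2"
  shows "norm (v (u + h) - v u) \<le> 4 * B / \<rho> * norm h"
    and "norm (v (u + h) - v u - deriv v u * h) \<le> 32 * B / \<rho>^2 * norm h ^ 2"
proof -
  let ?C = "cball u (\<rho> / 2)"
  \<comment> \<open>Around each point of the half ball a disc of radius \<open>\<rho>/4\<close>
    still lies in the ball, so Cauchy's inequality bounds the n-th derivative by
    \<open>fact n * B / (\<rho>/4)^n\<close>: this is where 4 and 32 come from. Both bounds are
    linear in \<open>B\<close>, which later is a multiple of a cost.\<close>
  have sub: "cball w (\<rho>/4) \<subseteq> ball u \<rho>" if "w \<in> ?C" for w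
  proof
    fix x assume "x \<in> cball w (\<rho>/4)"
    then have "dist w x \<le> \<rho>/4" "dist u w \<le> \<rho>/2" using that by auto
    then have "dist u x \<le> \<rho>/2 + \<rho>/4" using dist_triangle[of u x w] by linarith
    then show "x \<in> ball u \<rho>" using \<open>0 < \<rho>\<close> by auto
  qed
  have bd: "norm ((deriv ^^ n) v w) \<le> fact n * B / (\<rho>/4)^n" if "w \<in> ?C" for w n
  proof (rule Cauchy_inequality)
    show "v holomorphic_on ball w (\<rho>/4)"
      using assms(1) sub[OF that] ball_subset_cball by (meson holomorphic_on_subset order_trans)
    show "continuous_on (cball w (\<rho>/4)) v"
      using assms(1) sub[OF that] by (meson holomorphic_on_subset holomorphic_on_imp_continuous_on)
    show "norm (v x) \<le> B" if "norm (w - x) = \<rho>/4" for x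
      using sub[OF \<open>w \<in> ?C\<close>] that assms(2) by (auto simp: dist_norm subset_iff)
  qed (use \<open>0 < \<rho>\<close> in auto)
  have der: "((deriv ^^ n) v has_field_derivative (deriv ^^ Suc n) v w) (at w within ?C)"
    if "w \<in> ?C" for w n
  proof -
    have "w \<in> ball u \<rho>" using sub[OF that] \<open>0 < \<rho>\<close> by (meson centre_in_cball divide_nonneg_nonneg less_imp_le subsetD zero_le_numeral)
    then have "((deriv ^^ n) v has_field_derivative deriv ((deriv ^^ n) v) w) (at w)"
      using holomorphic_higher_deriv[OF assms(1)] holomorphic_derivI open_ball by blast
    then show ?thesis by (simp add: has_field_derivative_at_within)
  qed
  have uh: "u + h \<in> ?C" "u \<in> ?C" using assms(3,4) by (auto simp: dist_norm)
  have "norm (v (u + h) - v u) \<le> 4 * B / \<rho> * norm (u + h - u)"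
  proof (rule field_differentiable_bound[where f' = "deriv v" and S = ?C])
    show "norm (deriv v z) \<le> 4 * B / \<rho>" if "z \<in> ?C" for z
      using bd[OF that, of 1] by (simp add: field_simps)
    show "(v has_field_derivative deriv v z) (at z within ?C)" if "z \<in> ?C" for z
      using der[OF that, of 0] by simp
  qed (use uh in auto)
  then show "norm (v (u + h) - v u) \<le> 4 * B / \<rho> * norm h" by simp
  have "norm (v (u+h) - (\<Sum>i\<le>1. (deriv ^^ i) v u * (u + h - u)^i / fact i))
      \<le> 32 * B / \<rho>^2 * norm (u + h - u)^(Suc 1) / fact 1"
  proof (rule complex_Taylor[where f="\<lambda>i. (deriv ^^ i) v" and S = ?C and n = 1, simplified funpow_0])
    show "norm ((deriv ^^ Suc 1) v x) \<le> 32 * B / \<rho>^2" if "x \<in> ?C" for x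
      using bd[OF that, of 2] by (simp add: numeral_2_eq_2 field_simps)
    show "((deriv ^^ i) v has_field_derivative (deriv ^^ Suc i) v x) (at x within ?C)" if "x \<in> ?C" for x i
      by (rule der[OF that])
    show "convex ?C" "u \<in> ?C" "u + h \<in> ?C" using uh by (simp_all only: convex_cball)
  qed
  also have "(\<Sum>i\<le>1. (deriv ^^ i) v u * (u + h - u)^i / fact i) = v u + deriv v u * h"
    unfolding One_nat_def sum.atMost_Suc atMost_0 by (simp del: funpow.simps add: funpow_0 funpow_Suc_right)
  finally show "norm (v (u + h) - v u - deriv v u * h) \<le> 32 * B / \<rho>^2 * norm h ^ 2"
    unfolding diff_diff_eq power2_eq_square by simp
qed

lemma holomorphic_infsum:
  fixes f :: "nat \<Rightarrow> complex \<Rightarrow> complex"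
  assumes "open U" "\<And>k. f k holomorphic_on U" "\<And>k u. u \<in> U \<Longrightarrow> norm (f k u) \<le> b k"
    and "b summable_on UNIV"
  shows "(\<lambda>u. \<Sum>\<^sub>\<infinity>k. f k u) holomorphic_on U"
proof -
  have ul: "uniform_limit U (\<lambda>X y. \<Sum>x\<in>X. f x y) (\<lambda>y. \<Sum>\<^sub>\<infinity>x. f x y) (finite_subsets_at_top UNIV)"
    by (rule Weierstrass_m_test_general[OF _ assms(4)]) (rule assms(3))
  have "\<exists>r>0. (\<lambda>u. \<Sum>\<^sub>\<infinity>k. f k u) holomorphic_on ball u r" if u: "u \<in> U" for u
  proof -
    obtain r where r: "r > 0" "cball u r \<subseteq> U" using assms(1) u open_contains_cball by blast
    have "(\<lambda>u. \<Sum>\<^sub>\<infinity>k. f k u) holomorphic_on ball u r"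
    proof (rule holomorphic_uniform_limit)
      show "\<forall>\<^sub>F X in finite_subsets_at_top UNIV. continuous_on (cball u r) (\<lambda>y. \<Sum>x\<in>X. f x y) \<and>
          (\<lambda>y. \<Sum>x\<in>X. f x y) holomorphic_on ball u r"
      proof (intro always_eventually allI conjI)
        fix X show "continuous_on (cball u r) (\<lambda>y. \<Sum>x\<in>X. f x y)"
          using r assms(2) by (intro continuous_on_sum) (meson holomorphic_on_imp_continuous_on holomorphic_on_subset)
        show "(\<lambda>y. \<Sum>x\<in>X. f x y) holomorphic_on ball u r"
          using r assms(2) by (intro holomorphic_on_sum) (meson ball_subset_cball holomorphic_on_subset order_trans)
      qed
      show "uniform_limit (cball u r) (\<lambda>X y. \<Sum>x\<in>X. f x y) (\<lambda>y. \<Sum>\<^sub>\<infinity>x. f x y) (finite_subsets_at_top UNIV)"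
        using ul r(2) by (rule uniform_limit_on_subset)
    qed auto
    then show ?thesis using r by blast
  qed
  then have "(\<lambda>u. \<Sum>\<^sub>\<infinity>k. f k u) field_differentiable at u within U" if "u \<in> U" for u
    using that holomorphic_on_imp_differentiable_at[OF _ open_ball] field_differentiable_at_within
      centre_in_ball by blast
  then show ?thesis by (simp add: holomorphic_on_def)
qed

lemma continuous_on_infsum:
  fixes f :: "nat \<Rightarrow> 'a::topological_space \<Rightarrow> complex"
  assumes "\<And>k. continuous_on U (f k)" "\<And>k u. u \<in> U \<Longrightarrow> norm (f k u) \<le> b k"
    and "b summable_on UNIV"
  shows "continuous_on U (\<lambda>u. \<Sum>\<^sub>\<infinity>k. f k u)"
proof (rule uniform_limit_theorem)
  show "uniform_limit U (\<lambda>X y. \<Sum>x\<in>X. f x y) (\<lambda>y. \<Sum>\<^sub>\<infinity>x. f x y) (finite_subsets_at_top UNIV)"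
    using assms by (intro Weierstrass_m_test_general) auto
qed (use assms(1) in \<open>auto intro!: continuous_on_sum always_eventually\<close>)

lemma norm_infsum_mult_le:
  fixes a :: "nat \<Rightarrow> complex"
  assumes "(\<lambda>k. norm (a k)) summable_on UNIV" "\<And>k. norm (c k) \<le> B"
  shows "(\<lambda>k. a k * c k) summable_on UNIV" "norm (\<Sum>\<^sub>\<infinity>k. a k * c k) \<le> (\<Sum>\<^sub>\<infinity>k. norm (a k)) * B"
proof -
  have le: "norm (a k * c k) \<le> norm (a k) * B" for k
    by (simp add: norm_mult assms(2) mult_left_mono)
  have s: "(\<lambda>k. norm (a k) * B) summable_on UNIV" using assms(1) by (rule summable_on_cmult_left)
  have n: "(\<lambda>k. norm (a k * c k)) summable_on UNIV"
    by (rule Infinite_Sum.abs_summable_on_comparison_test'[OF s]) (rule le)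
  then show "(\<lambda>k. a k * c k) summable_on UNIV" by (rule abs_summable_summable)
  have "norm (\<Sum>\<^sub>\<infinity>k. a k * c k) \<le> (\<Sum>\<^sub>\<infinity>k. norm (a k * c k))" by (rule norm_infsum_bound[OF n])
  also have "\<dots> \<le> (\<Sum>\<^sub>\<infinity>k. norm (a k) * B)" by (rule infsum_mono[OF n s le])
  also have "\<dots> = (\<Sum>\<^sub>\<infinity>k. norm (a k)) * B" by (rule infsum_cmult_left') 
  finally show "norm (\<Sum>\<^sub>\<infinity>k. a k * c k) \<le> (\<Sum>\<^sub>\<infinity>k. norm (a k)) * B" .
qed

text \<open>The ray is a set of complex numbers so that a multiplier on it and its extension to a
  sector have the same type.\<close>

definition pos_reals :: "complex set" where "pos_reals = complex_of_real ` {0<..}"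

text \<open>The ray accumulates at its own point 1, so it is a set of uniqueness for holomorphic
  functions on a connected domain.\<close>

lemma identity_pos_reals:
  assumes "open S" "connected S" "pos_reals \<subseteq> S" "f holomorphic_on S" "g holomorphic_on S"
    and "\<And>x. x \<in> pos_reals \<Longrightarrow> f x = g x" "z \<in> S"
  shows "f z = g z"
proof -
  have lim: "1 islimpt pos_reals"
    unfolding islimpt_approachable
  proof (intro allI impI)
    fix e :: real assume "e > 0"
    then have "complex_of_real (1 + e/2) \<in> pos_reals" unfolding pos_reals_def by (intro imageI) auto
    moreover have "complex_of_real (1 + e/2) \<noteq> 1"
      "dist (complex_of_real (1 + e/2)) 1 < e"
      using \<open>e > 0\<close> by (auto simp: dist_norm)
    ultimately show "\<exists>x'\<in>pos_reals. x' \<noteq> 1 \<and> dist x' 1 < e" by blast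
  qed
  have 1: "1 \<in> S" using assms(3) by (auto simp: pos_reals_def)
  have "(\<lambda>z. f z - g z) holomorphic_on S" using assms by (intro holomorphic_intros)
  from analytic_continuation[OF this assms(1,2,3) 1 lim _ assms(7)] assms(6) show ?thesis by auto
qed

section \<open>Test functionals\<close>

text \<open>
  A test \<open>(a, y, c)\<close> stands for the functional \<open>n \<mapsto> \<Sum>k. a k * n (y k)\<close>; the cost \<open>c\<close> is the
  bound that it satisfies at multipliers \<open>n\<close> of norm at most \<open>1\<close>.
\<close>

type_synonym test = "(nat \<Rightarrow> complex) \<times> (nat \<Rightarrow> complex) \<times> real"

definition weight :: "test \<Rightarrow> nat \<Rightarrow> complex" where "weight \<tau> = fst \<tau>"
definition node :: "test \<Rightarrow> nat \<Rightarrow> complex" where "node \<tau> = fst (snd \<tau>)"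
definition cost :: "test \<Rightarrow> real" where "cost \<tau> = snd (snd \<tau>)"

definition pairing :: "test \<Rightarrow> (complex \<Rightarrow> complex) \<Rightarrow> complex" where
  "pairing \<tau> n = (\<Sum>\<^sub>\<infinity>k. weight \<tau> k * n (node \<tau> k))"

text \<open>The base point \<open>z\<close> supplies the variables outside the list; its entries at
  listed variables are overwritten before \<open>F\<close> is evaluated. Unlisted variables thus
  remain as free parameters.\<close>

primrec pairings :: "'d list \<Rightarrow> ('d \<Rightarrow> test) \<Rightarrow> (('d \<Rightarrow> complex) \<Rightarrow> complex) \<Rightarrow> ('d \<Rightarrow> complex) \<Rightarrow> complex" where
  "pairings [] \<tau> F z = F z"
| "pairings (r # rs) \<tau> F z = pairing (\<tau> r) (\<lambda>x. pairings rs \<tau> F (z(r := x)))"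

definition admissible :: "test \<Rightarrow> bool" where
  "admissible \<tau> \<longleftrightarrow> (\<lambda>k. norm (weight \<tau> k)) summable_on UNIV \<and> (\<forall>k. node \<tau> k \<in> pos_reals) \<and> 0 \<le> cost \<tau>"

text \<open>Only the weights are concentrated at one index; the other nodes stay arbitrary because a
  test built from an operator carries the whole dilated spectrum as nodes.\<close>

definition point_test :: "complex \<Rightarrow> test \<Rightarrow> bool" where
  "point_test x \<tau> \<longleftrightarrow> (\<exists>i. node \<tau> i = x \<and> weight \<tau> = (\<lambda>k. if k = i then 1 else 0))"

lemma pairing_point: "point_test x \<tau> \<Longrightarrow> pairing \<tau> n = n x"
proof -
  assume "point_test x \<tau>"
  then obtain i where i: "node \<tau> i = x" "weight \<tau> = (\<lambda>k. if k = i then 1 else 0)"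
    by (auto simp: point_test_def)
  have "pairing \<tau> n = (\<Sum>\<^sub>\<infinity>k\<in>{i}. n x)"
    unfolding pairing_def i by (rule infsum_cong_neutral) (auto simp: i)
  then show ?thesis by simp
qed

text \<open>The total weight is not controlled by \<open>cost\<close>. This bound serves convergence
  and boundedness only; every estimate uniform in the tests goes through
  \<open>cost\<close>.\<close>

lemma pairing_bound:
  assumes "admissible \<tau>" "\<And>x. x \<in> pos_reals \<Longrightarrow> norm (n x) \<le> B"
  shows "norm (pairing \<tau> n) \<le> (\<Sum>\<^sub>\<infinity>k. norm (weight \<tau> k)) * B"
    and "(\<lambda>k. weight \<tau> k * n (node \<tau> k)) summable_on UNIV"
  using norm_infsum_mult_le[of "weight \<tau>" "\<lambda>k. n (node \<tau> k)" B] assms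
  by (auto simp: admissible_def pairing_def)

lemma pairing_cong:
  assumes "admissible \<tau>" "\<And>x. x \<in> pos_reals \<Longrightarrow> n x = n' x"
  shows "pairing \<tau> n = pairing \<tau> n'"
  unfolding pairing_def using assms by (intro infsum_cong) (auto simp: admissible_def)

lemma pairing_sum:
  assumes "admissible \<tau>" "finite I" "\<And>i. i \<in> I \<Longrightarrow> \<exists>B. \<forall>x\<in>pos_reals. norm (n i x) \<le> B"
  shows "pairing \<tau> (\<lambda>x. \<Sum>i\<in>I. c i * n i x) = (\<Sum>i\<in>I. c i * pairing \<tau> (n i))"
proof -
  have s: "((\<lambda>k. c i * (weight \<tau> k * n i (node \<tau> k))) has_sum c i * pairing \<tau> (n i)) UNIV" if i: "i \<in> I" for i
  proof -
    obtain B where "\<And>x. x \<in> pos_reals \<Longrightarrow> norm (n i x) \<le> B" using assms(3)[OF i] by auto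
    from pairing_bound(2)[OF assms(1) this] show ?thesis
      unfolding pairing_def by (intro has_sum_cmult_right has_sum_infsum)
  qed
  have "((\<lambda>k. \<Sum>i\<in>I. c i * (weight \<tau> k * n i (node \<tau> k))) has_sum (\<Sum>i\<in>I. c i * pairing \<tau> (n i))) UNIV"
    using assms(2) s by (induction I rule: finite_induct) (auto intro!: has_sum_add)
  moreover have "(\<lambda>k. \<Sum>i\<in>I. c i * (weight \<tau> k * n i (node \<tau> k))) =
     (\<lambda>k. weight \<tau> k * (\<Sum>i\<in>I. c i * n i (node \<tau> k)))"
    by (simp add: sum_distrib_left mult.left_commute)
  ultimately show ?thesis unfolding pairing_def by (simp add: infsumI)
qed

lemma pairing_holomorphic:
  assumes "admissible \<tau>" "open U" "\<And>x. x \<in> pos_reals \<Longrightarrow> (\<lambda>u. H u x) holomorphic_on U"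
    and "\<And>u x. u \<in> U \<Longrightarrow> x \<in> pos_reals \<Longrightarrow> norm (H u x) \<le> B"
  shows "(\<lambda>u. pairing \<tau> (H u)) holomorphic_on U"
  unfolding pairing_def
proof (rule holomorphic_infsum[OF assms(2)])
  show "(\<lambda>k. norm (weight \<tau> k) * B) summable_on UNIV"
    using assms(1) by (intro summable_on_cmult_left) (auto simp: admissible_def)
  show "(\<lambda>u. weight \<tau> k * H u (node \<tau> k)) holomorphic_on U" for k
    using assms(1,3) by (intro holomorphic_intros) (auto simp: admissible_def)
  show "norm (weight \<tau> k * H u (node \<tau> k)) \<le> norm (weight \<tau> k) * B" if "u \<in> U" for k u
    using assms(1,4) that unfolding norm_mult by (intro mult_left_mono) (auto simp: admissible_def)
qed

lemma pairing_continuous: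
  assumes "admissible \<tau>" "\<And>x. x \<in> pos_reals \<Longrightarrow> continuous_on U (\<lambda>u. H u x)"
    and "\<And>u x. u \<in> U \<Longrightarrow> x \<in> pos_reals \<Longrightarrow> norm (H u x) \<le> B"
  shows "continuous_on U (\<lambda>u. pairing \<tau> (H u))"
  unfolding pairing_def
proof (rule continuous_on_infsum)
  show "(\<lambda>k. norm (weight \<tau> k) * B) summable_on UNIV"
    using assms(1) by (intro summable_on_cmult_left) (auto simp: admissible_def)
  show "continuous_on U (\<lambda>u. weight \<tau> k * H u (node \<tau> k))" for k
    using assms(1,2) by (intro continuous_intros) (auto simp: admissible_def)
  show "norm (weight \<tau> k * H u (node \<tau> k)) \<le> norm (weight \<tau> k) * B" if "u \<in> U" for k u
    using assms(1,3) that unfolding norm_mult by (intro mult_left_mono) (auto simp: admissible_def)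
qed

lemma pairing_swap:
  assumes "admissible \<tau>" "admissible \<sigma>"
    and "\<And>u x. u \<in> pos_reals \<Longrightarrow> x \<in> pos_reals \<Longrightarrow> norm (H u x) \<le> B"
  shows "pairing \<tau> (\<lambda>u. pairing \<sigma> (H u)) = pairing \<sigma> (\<lambda>x. pairing \<tau> (\<lambda>u. H u x))"
proof -
  let ?f = "\<lambda>(k, l). weight \<tau> k * weight \<sigma> l * H (node \<tau> k) (node \<sigma> l)"
  have w: "(\<lambda>k. norm (weight \<tau> k)) summable_on UNIV" "(\<lambda>k. norm (weight \<sigma> k)) summable_on UNIV"
    using assms by (auto simp: admissible_def)
  have "(\<lambda>(k,l). norm (weight \<tau> k) * norm (weight \<sigma> l)) summable_on UNIV \<times> UNIV"
  proof (rule summable_on_SigmaI)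
    show "((\<lambda>l. case (k, l) of (k,l) \<Rightarrow> norm (weight \<tau> k) * norm (weight \<sigma> l)) has_sum
       (norm (weight \<tau> k) * (\<Sum>\<^sub>\<infinity>l. norm (weight \<sigma> l)))) UNIV" for k
      using w(2) by (auto intro!: has_sum_cmult_right)
  qed (use w(1) in \<open>auto intro: summable_on_cmult_left\<close>)
  then have s: "(\<lambda>(k,l). norm (weight \<tau> k) * norm (weight \<sigma> l) * B) summable_on UNIV \<times> UNIV"
    using summable_on_cmult_left[of "\<lambda>(k,l). norm (weight \<tau> k) * norm (weight \<sigma> l)" _ B]
    by (simp add: case_prod_unfold)
  have "(\<lambda>x. norm (?f x)) summable_on UNIV \<times> UNIV"
  proof (rule Infinite_Sum.abs_summable_on_comparison_test'[OF s])
    show "norm (?f x) \<le> (case x of (k, l) \<Rightarrow> norm (weight \<tau> k) * norm (weight \<sigma> l) * B)" for x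
      using assms unfolding case_prod_unfold norm_mult
      by (intro mult_left_mono) (auto simp: admissible_def)
  qed
  then have sf: "?f summable_on UNIV \<times> UNIV" by (rule abs_summable_summable)
  have c: "c * (\<Sum>\<^sub>\<infinity>l. g l) = (\<Sum>\<^sub>\<infinity>l. c * g l)" for c :: complex and g :: "nat \<Rightarrow> complex"
    by (rule infsum_cmult_right'[symmetric])
  have "pairing \<tau> (\<lambda>u. pairing \<sigma> (H u)) = (\<Sum>\<^sub>\<infinity>k. \<Sum>\<^sub>\<infinity>l. weight \<tau> k * weight \<sigma> l * H (node \<tau> k) (node \<sigma> l))"
    unfolding pairing_def c by (simp add: mult.assoc)
  also have "\<dots> = (\<Sum>\<^sub>\<infinity>l. \<Sum>\<^sub>\<infinity>k. weight \<tau> k * weight \<sigma> l * H (node \<tau> k) (node \<sigma> l))"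
    by (rule infsum_swap_banach) (use sf in simp)
  also have "\<dots> = pairing \<sigma> (\<lambda>x. pairing \<tau> (\<lambda>u. H u x))"
    unfolding pairing_def c by (simp add: ac_simps)
  finally show ?thesis .
qed

text \<open>\<open>E\<close> is a set of points where \<open>F\<close> is controlled. A pairing
  substitutes only points of the ray, so this stability keeps all evaluations of \<open>F\<close>
  inside \<open>E\<close>.\<close>

definition upd_stable :: "('d \<Rightarrow> complex) set \<Rightarrow> 'd \<Rightarrow> complex set \<Rightarrow> bool" where
  "upd_stable E r X \<longleftrightarrow> (\<forall>z\<in>E. \<forall>x\<in>X. z(r := x) \<in> E)"

lemma upd_stableD: "upd_stable E r X \<Longrightarrow> z \<in> E \<Longrightarrow> x \<in> X \<Longrightarrow> z(r := x) \<in> E"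
  by (simp add: upd_stable_def)

lemma pairings_bound:
  assumes "\<forall>r\<in>set rs. admissible (\<tau> r) \<and> upd_stable E r pos_reals"
    and "\<And>z. z \<in> E \<Longrightarrow> norm (F z) \<le> B"
  shows "\<exists>B'. \<forall>z\<in>E. norm (pairings rs \<tau> F z) \<le> B'"
  using assms(1)
proof (induction rs)
  case Nil
  then show ?case using assms(2) by auto
next
  case (Cons r rs)
  then obtain B' where B': "\<And>z. z \<in> E \<Longrightarrow> norm (pairings rs \<tau> F z) \<le> B'"
    by (metis list.set_intros(2))
  have "norm (pairings (r # rs) \<tau> F z) \<le> (\<Sum>\<^sub>\<infinity>k. norm (weight (\<tau> r) k)) * B'" if "z \<in> E" for z
    unfolding pairings.simps
  proof (rule pairing_bound)
    show "norm (pairings rs \<tau> F (z(r := x))) \<le> B'" if "x \<in> pos_reals" for x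
      using B' upd_stableD[OF _ \<open>z \<in> E\<close> that] Cons.prems by (metis list.set_intros(1))
  qed (use Cons.prems in auto)
  then show ?case by blast
qed

text \<open>The parameter \<open>s\<close> is not paired, so its update commutes with every
  substitution, and each pairing is a series in \<open>s\<close> dominated through
  \<open>pairings_bound\<close>.\<close>

lemma pairings_holomorphic:
  assumes "open U" "\<forall>r\<in>set rs. admissible (\<tau> r) \<and> upd_stable E r pos_reals" "s \<notin> set rs"
    and "upd_stable E s U"
    and "\<And>z. z \<in> E \<Longrightarrow> (\<lambda>u. F (z(s := u))) holomorphic_on U"
    and "\<And>z. z \<in> E \<Longrightarrow> norm (F z) \<le> B" "z \<in> E"
  shows "(\<lambda>u. pairings rs \<tau> F (z(s := u))) holomorphic_on U"
  using assms(2,3,7)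
proof (induction rs arbitrary: z)
  case Nil
  show ?case unfolding pairings.simps by (rule assms(5)[OF Nil(3)])
next
  case (Cons r rs)
  have rs: "\<forall>r\<in>set rs. admissible (\<tau> r) \<and> upd_stable E r pos_reals" "s \<notin> set rs"
    and r: "admissible (\<tau> r)" "upd_stable E r pos_reals"
    using Cons.prems by auto
  have "\<exists>B'. \<forall>z\<in>E. norm (pairings rs \<tau> F z) \<le> B'"
    by (rule pairings_bound[OF rs(1) assms(6)])
  then obtain B' where B': "\<And>z. z \<in> E \<Longrightarrow> norm (pairings rs \<tau> F z) \<le> B'" by blast
  have tw: "z(s := u, r := x) = z(r := x, s := u)" for u x
    using Cons.prems(2) by (simp add: fun_upd_twist)
  show ?case
    unfolding pairings.simps
  proof (rule pairing_holomorphic[OF r(1) assms(1)])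
    show "(\<lambda>u. pairings rs \<tau> F (z(s := u, r := x))) holomorphic_on U" if "x \<in> pos_reals" for x
      unfolding tw by (rule Cons.IH[OF rs upd_stableD[OF r(2) Cons.prems(3) that]])
    show "norm (pairings rs \<tau> F (z(s := u, r := x))) \<le> B'" if "u \<in> U" "x \<in> pos_reals" for u x
      by (rule B'[OF upd_stableD[OF r(2) upd_stableD[OF assms(4) Cons.prems(3) that(1)] that(2)]])
  qed
qed

lemma pairings_continuous:
  assumes "\<forall>r\<in>set rs. admissible (\<tau> r) \<and> upd_stable E r pos_reals" "s \<notin> set rs"
    and "upd_stable E s U"
    and "\<And>z. z \<in> E \<Longrightarrow> continuous_on U (\<lambda>u. F (z(s := u)))"
    and "\<And>z. z \<in> E \<Longrightarrow> norm (F z) \<le> B" "z \<in> E"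
  shows "continuous_on U (\<lambda>u. pairings rs \<tau> F (z(s := u)))"
  using assms(1,2,6)
proof (induction rs arbitrary: z)
  case Nil
  show ?case unfolding pairings.simps by (rule assms(4)[OF Nil(3)])
next
  case (Cons r rs)
  have rs: "\<forall>r\<in>set rs. admissible (\<tau> r) \<and> upd_stable E r pos_reals" "s \<notin> set rs"
    and r: "admissible (\<tau> r)" "upd_stable E r pos_reals"
    using Cons.prems by auto
  have "\<exists>B'. \<forall>z\<in>E. norm (pairings rs \<tau> F z) \<le> B'"
    by (rule pairings_bound[OF rs(1) assms(5)])
  then obtain B' where B': "\<And>z. z \<in> E \<Longrightarrow> norm (pairings rs \<tau> F z) \<le> B'" by blast
  have tw: "z(s := u, r := x) = z(r := x, s := u)" for u x
    using Cons.prems(2) by (simp add: fun_upd_twist)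
  show ?case
    unfolding pairings.simps
  proof (rule pairing_continuous[OF r(1)])
    show "continuous_on U (\<lambda>u. pairings rs \<tau> F (z(s := u, r := x)))" if "x \<in> pos_reals" for x
      unfolding tw by (rule Cons.IH[OF rs upd_stableD[OF r(2) Cons.prems(3) that]])
    show "norm (pairings rs \<tau> F (z(s := u, r := x))) \<le> B'" if "u \<in> U" "x \<in> pos_reals" for u x
      by (rule B'[OF upd_stableD[OF r(2) upd_stableD[OF assms(3) Cons.prems(3) that(1)] that(2)]])
  qed
qed

lemma pairings_cong:
  assumes "\<forall>r\<in>set rs. admissible (\<tau> r) \<and> upd_stable E r pos_reals"
    and "\<And>z. z \<in> E \<Longrightarrow> F z = G z" "z \<in> E"
  shows "pairings rs \<tau> F z = pairings rs \<tau> G z"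
  using assms(1,3)
proof (induction rs arbitrary: z)
  case Nil
  then show ?case using assms(2) by auto
next
  case (Cons r rs)
  show ?case unfolding pairings.simps
  proof (rule pairing_cong)
    show "pairings rs \<tau> F (z(r := x)) = pairings rs \<tau> G (z(r := x))" if "x \<in> pos_reals" for x
      using Cons.IH upd_stableD[OF _ Cons.prems(2) that] Cons.prems(1) by (metis list.set_intros)
  qed (use Cons.prems in auto)
qed

text \<open>This is the freezing device: point tests in all variables except \<open>s\<close> turn a
  bound on iterated pairings into a bound on a functional of one variable.\<close>

lemma pairings_point:
  assumes "\<And>r. r \<in> set rs \<Longrightarrow> r \<noteq> s \<Longrightarrow> point_test (z r) (\<tau> r)" "distinct rs"
  shows "pairings rs \<tau> F z = (if s \<in> set rs then pairing (\<tau> s) (\<lambda>x. F (z(s := x))) else F z)"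
  using assms
proof (induction rs arbitrary: z)
  case (Cons r rs)
  have d: "distinct rs" "r \<notin> set rs" using Cons.prems(2) by auto
  show ?case
  proof (cases "r = s")
    case True
    have "pairings rs \<tau> F (z(s := x)) = F (z(s := x))" for x
    proof -
      have "pairings rs \<tau> F (z(s := x)) = (if s \<in> set rs then pairing (\<tau> s) (\<lambda>y. F (z(s := x, s := y))) else F (z(s := x)))"
        by (rule Cons.IH[OF _ d(1)]) (use Cons.prems(1) in simp)
      then show ?thesis using d(2) True by simp
    qed
    then show ?thesis using True by simp
  next
    case False
    have "pairings (r # rs) \<tau> F z = pairings rs \<tau> F z"
      using pairing_point[of "z r" "\<tau> r" "\<lambda>x. pairings rs \<tau> F (z(r := x))"] Cons.prems(1)[of r] False
      by simp
    also have "\<dots> = (if s \<in> set rs then pairing (\<tau> s) (\<lambda>x. F (z(s := x))) else F z)"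
      by (rule Cons.IH[OF _ d(1)]) (rule Cons.prems(1), simp_all)
    finally show ?thesis using False by simp
  qed
qed simp

section \<open>Extension in one variable\<close>

text \<open>Meant for difference quotients. The estimate makes \<open>q\<close> Cauchy along one
  sequence of real steps; letting the second argument run through that sequence then compares every
  other step with the limit.\<close>

lemma convergent_at_0_if_Lipschitz_at_0:
  fixes q :: "complex \<Rightarrow> complex"
  assumes "0 < \<delta>"
    and "\<And>h h'. 0 < norm h \<Longrightarrow> norm h \<le> \<delta> \<Longrightarrow> 0 < norm h' \<Longrightarrow> norm h' \<le> \<delta> \<Longrightarrow>
           norm (q h - q h') \<le> M * (norm h + norm h')"
  shows "\<exists>l. (q \<longlongrightarrow> l) (at 0)"
proof -
  define s where "s n = complex_of_real (\<delta> / (real n + 1))" for n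
  have s3: "norm (s n) = \<delta> / (real n + 1)" for n
    unfolding s_def norm_of_real using assms(1) by simp
  have s: "0 < norm (s n)" "norm (s n) \<le> \<delta>" for n
    unfolding s3 using assms(1) by (auto simp: field_simps)
  have lim: "(\<lambda>n. norm (s n)) \<longlonglongrightarrow> 0" unfolding s3 by real_asymp
  have "0 \<le> M * (norm (s 0) + norm (s 0))"
    using assms(2)[OF s(1,2) s(1,2), of 0 0] by simp
  then have M: "0 \<le> M" using s(1)[of 0] by (simp add: zero_le_mult_iff)
  have "Cauchy (\<lambda>n. q (s n))"
  proof (rule metric_CauchyI)
    fix e :: real assume "0 < e"
    have "(\<lambda>n. M * norm (s n)) \<longlonglongrightarrow> M * 0" by (intro tendsto_intros lim)
    then have "eventually (\<lambda>n. M * norm (s n) < e/2) sequentially"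
      using \<open>0 < e\<close> by (intro order_tendstoD(2)[of _ "M * 0"]) auto
    then obtain N where N: "\<And>n. n \<ge> N \<Longrightarrow> M * norm (s n) < e/2" by (auto simp: eventually_sequentially)
    have "dist (q (s i)) (q (s k)) < e" if "i \<ge> N" "k \<ge> N" for i k
      using assms(2)[OF s(1,2) s(1,2), of i k] N[OF that(1)] N[OF that(2)]
      by (simp add: dist_norm distrib_left)
    then show "\<exists>N. \<forall>i\<ge>N. \<forall>k\<ge>N. dist (q (s i)) (q (s k)) < e" by blast
  qed
  then obtain l where l: "(\<lambda>n. q (s n)) \<longlonglongrightarrow> l"
    using Cauchy_convergent_iff convergent_def by blast
  have bd: "norm (q h - l) \<le> M * norm h" if h: "0 < norm h" "norm h \<le> \<delta>" for h
  proof (rule LIMSEQ_le)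
    show "(\<lambda>n. norm (q h - q (s n))) \<longlonglongrightarrow> norm (q h - l)" by (intro tendsto_intros l)
    have "(\<lambda>n. M * (norm h + norm (s n))) \<longlonglongrightarrow> M * (norm h + 0)" by (intro tendsto_intros lim)
    then show "(\<lambda>n. M * (norm h + norm (s n))) \<longlonglongrightarrow> M * norm h" by simp
    show "\<exists>N. \<forall>n\<ge>N. norm (q h - q (s n)) \<le> M * (norm h + norm (s n))"
      using assms(2)[OF h s(1,2)] by blast
  qed
  have "((\<lambda>h. q h - l) \<longlongrightarrow> 0) (at 0)"
  proof (rule Lim_null_comparison)
    show "eventually (\<lambda>h. norm (q h - l) \<le> M * norm h) (at 0)"
      unfolding eventually_at by (rule exI[of _ \<delta>]) (use assms(1) bd in auto)
    show "((\<lambda>h::complex. M * norm h) \<longlongrightarrow> 0) (at 0)"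
      by (intro tendsto_mult_right_zero tendsto_norm_zero tendsto_ident_at)
  qed
  then show ?thesis using Lim_null by blast
qed

lemma one_pos_reals: "1 \<in> pos_reals"
  unfolding pos_reals_def by (rule image_eqI[of _ _ 1]) auto

text \<open>\<open>ext_W\<close> is the one-variable hypothesis with the operator norm replaced by
  its dual description through tests. The cost \<open>N\<^sub>0 r\<close> of a point test does not
  depend on the point, since moving the point is a matter of dilating the operator.\<close>

locale extension_property =
  fixes S :: "'d \<Rightarrow> complex set" and W :: "'d \<Rightarrow> test set" and N\<^sub>0 :: "'d \<Rightarrow> real"
  assumes open_S: "open (S r)" and connected_S: "connected (S r)" and pos_S: "pos_reals \<subseteq> S r"
    and admissible_W: "\<tau> \<in> W r \<Longrightarrow> admissible \<tau>"
    and point_W: "x \<in> pos_reals \<Longrightarrow> \<exists>\<tau>\<in>W r. point_test x \<tau> \<and> cost \<tau> = N\<^sub>0 r"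
    and ext_W: "continuous_on pos_reals n \<Longrightarrow> bounded (n ` pos_reals) \<Longrightarrow> 0 \<le> K \<Longrightarrow>
      (\<And>\<tau>. \<tau> \<in> W r \<Longrightarrow> norm (pairing \<tau> n) \<le> K * cost \<tau>) \<Longrightarrow>
      \<exists>G. G holomorphic_on S r \<and> (\<forall>x\<in>pos_reals. G x = n x) \<and> (\<forall>z\<in>S r. norm (G z) \<le> K)"
begin

lemma cost_nonneg: "\<tau> \<in> W r \<Longrightarrow> 0 \<le> cost \<tau>"
  using admissible_W by (auto simp: admissible_def)

lemma N\<^sub>0_nonneg: "0 \<le> N\<^sub>0 r"
  using point_W[OF one_pos_reals] cost_nonneg by metis

text \<open>\<open>ext_W\<close> extends the combination itself with bound
  \<open>\<epsilon>\<close>, and the identity theorem shows that this extension is the same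
  combination of the given ones. Smallness on all tests thus passes to every point of
  \<open>S r\<close>.\<close>

lemma extension_combination_bound:
  assumes "finite I" "\<And>i. i \<in> I \<Longrightarrow> continuous_on pos_reals (n i)"
    and bd: "\<And>i x. i \<in> I \<Longrightarrow> x \<in> pos_reals \<Longrightarrow> norm (n i x) \<le> B"
    and G: "\<And>i. i \<in> I \<Longrightarrow> G i holomorphic_on S r"
      "\<And>i x. i \<in> I \<Longrightarrow> x \<in> pos_reals \<Longrightarrow> G i x = n i x"
    and "0 \<le> \<epsilon>" "\<And>\<tau>. \<tau> \<in> W r \<Longrightarrow> norm (\<Sum>i\<in>I. c i * pairing \<tau> (n i)) \<le> \<epsilon> * cost \<tau>"
    and "w \<in> S r"
  shows "norm (\<Sum>i\<in>I. c i * G i w) \<le> \<epsilon>"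
proof -
  let ?n = "\<lambda>x. \<Sum>i\<in>I. c i * n i x"
  have "\<exists>G'. G' holomorphic_on S r \<and> (\<forall>x\<in>pos_reals. G' x = ?n x) \<and> (\<forall>z\<in>S r. norm (G' z) \<le> \<epsilon>)"
  proof (rule ext_W)
    show "continuous_on pos_reals ?n" using assms(2) by (intro continuous_intros)
    show "bounded (?n ` pos_reals)"
      unfolding bounded_iff
    proof (intro exI ballI)
      fix y assume "y \<in> ?n ` pos_reals"
      then obtain x where x: "x \<in> pos_reals" "y = ?n x" by auto
      have "norm y \<le> (\<Sum>i\<in>I. norm (c i) * B)"
        unfolding x(2) by (rule sum_norm_le) (auto simp: norm_mult intro!: mult_left_mono bd x(1))
      then show "norm y \<le> (\<Sum>i\<in>I. norm (c i) * B)" .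
    qed
    show "norm (pairing \<tau> ?n) \<le> \<epsilon> * cost \<tau>" if "\<tau> \<in> W r" for \<tau>
      using assms(7)[OF that] bd by (subst pairing_sum[OF admissible_W[OF that] assms(1)]) blast+
  qed fact
  then obtain G' where G': "G' holomorphic_on S r" "\<And>x. x \<in> pos_reals \<Longrightarrow> G' x = ?n x"
      "\<And>z. z \<in> S r \<Longrightarrow> norm (G' z) \<le> \<epsilon>" by blast
  have "G' w = (\<Sum>i\<in>I. c i * G i w)"
  proof (rule identity_pos_reals[OF open_S connected_S pos_S G'(1) _ _ assms(8)])
    show "(\<lambda>w. \<Sum>i\<in>I. c i * G i w) holomorphic_on S r" using G(1) by (intro holomorphic_intros)
    show "G' x = (\<Sum>i\<in>I. c i * G i x)" if "x \<in> pos_reals" for x using G'(2)[OF that] G(2) that by simp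
  qed
  then show ?thesis using G'(3)[OF assms(8)] by simp
qed

text \<open>Each pairing of \<open>H u\<close> is holomorphic in \<open>u\<close> and bounded by
  \<open>K * cost \<tau>\<close>, so its difference quotients satisfy a Cauchy condition with a rate
  proportional to \<open>cost \<tau>\<close>. The combination bound transfers this rate to the
  difference quotients of \<open>G u w\<close>.\<close>

lemma extension_holomorphic_in_parameter:
  assumes "open U" "0 \<le> K"
    and cont: "\<And>u. u \<in> U \<Longrightarrow> continuous_on pos_reals (H u)"
    and hol: "\<And>x. x \<in> pos_reals \<Longrightarrow> (\<lambda>u. H u x) holomorphic_on U"
    and bd: "\<And>u x. u \<in> U \<Longrightarrow> x \<in> pos_reals \<Longrightarrow> norm (H u x) \<le> B"
    and test: "\<And>u \<tau>. u \<in> U \<Longrightarrow> \<tau> \<in> W r \<Longrightarrow> norm (pairing \<tau> (H u)) \<le> K * cost \<tau>"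
    and G: "\<And>u. u \<in> U \<Longrightarrow> G u holomorphic_on S r"
      "\<And>u x. u \<in> U \<Longrightarrow> x \<in> pos_reals \<Longrightarrow> G u x = H u x"
    and "w \<in> S r"
  shows "(\<lambda>u. G u w) holomorphic_on U"
proof -
  have "(\<lambda>u. G u w) field_differentiable at u" if u: "u \<in> U" for u
  proof -
    obtain \<rho> where \<rho>: "\<rho> > 0" "ball u \<rho> \<subseteq> U" using assms(1) u open_contains_ball by blast
    define q where "q h = (G (u + h) w - G u w) / h" for h
    have "norm (q h - q h') \<le> 32 * K / \<rho>^2 * (norm h + norm h')"
      if h: "0 < norm h" "norm h \<le> \<rho>/2" and h': "0 < norm h'" "norm h' \<le> \<rho>/2" for h h'
    proof -
      \<comment> \<open>The difference of the two quotients for \<open>h\<close> and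
        \<open>h'\<close> is a combination of values at three points; the base point
        \<open>u\<close> collects the weight \<open>1/h' - 1/h\<close>.\<close>
      define p where "p i = (if i = 0 then u + h else if i = 1 then u + h' else u)" for i :: nat
      define c where "c i = (if i = 0 then 1/h else if i = 1 then -1/h' else 1/h' - 1/h)" for i :: nat
      have p: "p i \<in> U" for i using h h' \<rho>(1) u by (auto simp: p_def dist_norm intro!: subsetD[OF \<rho>(2)])
      have "norm (\<Sum>i\<in>{0,1,2}. c i * G (p i) w) \<le> 32 * K / \<rho>^2 * (norm h + norm h')"
      proof (rule extension_combination_bound[where n = "\<lambda>i. H (p i)" and B = B])
        show "0 \<le> 32 * K / \<rho>^2 * (norm h + norm h')" using assms(2) by simp
        fix \<tau> assume \<tau>: "\<tau> \<in> W r"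
        define v where "v y = pairing \<tau> (H y)" for y
        have v: "v holomorphic_on ball u \<rho>"
          unfolding v_def
          by (rule holomorphic_on_subset[OF pairing_holomorphic[OF admissible_W[OF \<tau>] assms(1) hol bd] \<rho>(2)])
        have q: "norm ((v (u + k) - v u) / k - deriv v u) \<le> 32 * K * cost \<tau> / \<rho>^2 * norm k"
          if k: "0 < norm k" "norm k \<le> \<rho>/2" for k
        proof -
          have "norm (v (u + k) - v u - deriv v u * k) \<le> 32 * (K * cost \<tau>) / \<rho>^2 * norm k ^ 2"
            by (rule Cauchy_bounds_half_ball(2)[OF v _ \<rho>(1) k(2)]) (use test[OF subsetD[OF \<rho>(2)] \<tau>] in \<open>simp add: v_def\<close>)
          moreover have "(v (u + k) - v u) / k - deriv v u = (v (u + k) - v u - deriv v u * k) / k"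
            using k by (simp add: field_simps)
          ultimately show ?thesis using k \<rho>(1) by (simp add: norm_divide divide_simps power2_eq_square)
        qed
        have "(\<Sum>i\<in>{0,1,2}. c i * pairing \<tau> (H (p i))) =
            ((v (u + h) - v u) / h - deriv v u) - ((v (u + h') - v u) / h' - deriv v u)"
          by (simp add: c_def p_def v_def diff_divide_distrib algebra_simps)
        then have "norm (\<Sum>i\<in>{0,1,2}. c i * pairing \<tau> (H (p i))) \<le>
            32 * K * cost \<tau> / \<rho>^2 * norm h + 32 * K * cost \<tau> / \<rho>^2 * norm h'"
          using norm_triangle_le_diff[OF add_mono[OF q[OF h] q[OF h']]] by simp
        then show "norm (\<Sum>i\<in>{0,1,2}. c i * pairing \<tau> (H (p i))) \<le> 32 * K / \<rho>^2 * (norm h + norm h') * cost \<tau>"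
          by (simp add: algebra_simps add_divide_distrib)
      qed (use cont bd G assms(9) p in auto)
      moreover have "(\<Sum>i\<in>{0,1,2}. c i * G (p i) w) = q h - q h'"
        by (simp add: c_def p_def q_def diff_divide_distrib algebra_simps)
      ultimately show ?thesis by simp
    qed
    from convergent_at_0_if_Lipschitz_at_0[of "\<rho>/2", OF _ this] \<rho>(1)
    obtain l where "(q \<longlongrightarrow> l) (at 0)" by auto
    then have "((\<lambda>u. G u w) has_field_derivative l) (at u)"
      unfolding DERIV_def q_def .
    then show ?thesis by (auto simp: field_differentiable_def)
  qed
  then show ?thesis by (simp add: holomorphic_on_def field_differentiable_at_within)
qed

text \<open>Continuity of each pairing would give no modulus common to all tests. The double
  pairings provide one: they allow the pairing with \<open>\<tau>\<close> to be extended in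
  \<open>u\<close> to \<open>S s\<close>, and Cauchy's estimate makes it Lipschitz near
  \<open>u\<close> with a constant proportional to \<open>cost \<tau>\<close>.\<close>

lemma extension_continuous_in_parameter:
  assumes "0 \<le> K"
    and cont: "\<And>u. u \<in> pos_reals \<Longrightarrow> continuous_on pos_reals (H u)"
    and cont': "\<And>x. x \<in> pos_reals \<Longrightarrow> continuous_on pos_reals (\<lambda>u. H u x)"
    and bd: "\<And>u x. u \<in> pos_reals \<Longrightarrow> x \<in> pos_reals \<Longrightarrow> norm (H u x) \<le> B"
    and test: "\<And>\<sigma> \<tau>. \<sigma> \<in> W s \<Longrightarrow> \<tau> \<in> W r \<Longrightarrow>
       norm (pairing \<sigma> (\<lambda>u. pairing \<tau> (H u))) \<le> K * cost \<tau> * cost \<sigma>"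
    and G: "\<And>u. u \<in> pos_reals \<Longrightarrow> G u holomorphic_on S r"
      "\<And>u x. u \<in> pos_reals \<Longrightarrow> x \<in> pos_reals \<Longrightarrow> G u x = H u x"
    and "w \<in> S r"
  shows "continuous_on pos_reals (\<lambda>u. G u w)"
  unfolding continuous_on_iff
proof (intro ballI allI impI)
  fix u :: complex and e :: real assume u: "u \<in> pos_reals" and "0 < e"
  obtain \<rho> where \<rho>: "\<rho> > 0" "ball u \<rho> \<subseteq> S s" using open_S u pos_S open_contains_ball by blast
  have lip: "norm (G u' w - G u w) \<le> 4 * K / \<rho> * norm (u' - u)"
    if u': "u' \<in> pos_reals" "norm (u' - u) \<le> \<rho>/2" for u'
  proof -
    define p where "p i = (if i = 0 then u' else u)" for i :: nat
    define c where "c i = (if i = 0 then 1 else - 1 :: complex)" for i :: nat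
    have p: "p i \<in> pos_reals" for i using u u' by (auto simp: p_def)
    have "norm (\<Sum>i\<in>{0,1}. c i * G (p i) w) \<le> 4 * K / \<rho> * norm (u' - u)"
    proof (rule extension_combination_bound[where n = "\<lambda>i. H (p i)" and B = B])
      show "0 \<le> 4 * K / \<rho> * norm (u' - u)" using assms(1) \<rho>(1) by simp
      fix \<tau> assume \<tau>: "\<tau> \<in> W r"
      let ?v = "\<lambda>u. pairing \<tau> (H u)"
      \<comment> \<open>Here the extension property of the other variable \<open>s\<close> is used,
        applied to \<open>u\<close> as the variable of a multiplier.\<close>
      have "\<exists>V. V holomorphic_on S s \<and> (\<forall>x\<in>pos_reals. V x = ?v x) \<and> (\<forall>z\<in>S s. norm (V z) \<le> K * cost \<tau>)"
      proof (rule ext_W)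
        show "continuous_on pos_reals ?v"
          by (rule pairing_continuous[OF admissible_W[OF \<tau>] cont' bd])
        show "bounded (?v ` pos_reals)"
          unfolding bounded_iff
          by (rule exI[of _ "(\<Sum>\<^sub>\<infinity>k. norm (weight \<tau> k)) * B"])
            (auto intro!: pairing_bound(1)[OF admissible_W[OF \<tau>]] bd)
      qed (use test \<tau> assms(1) cost_nonneg[OF \<tau>] in auto)
      then obtain V where V: "V holomorphic_on S s" "\<And>x. x \<in> pos_reals \<Longrightarrow> V x = ?v x"
        "\<And>z. z \<in> S s \<Longrightarrow> norm (V z) \<le> K * cost \<tau>" by blast
      have "norm (V (u + (u' - u)) - V u) \<le> 4 * (K * cost \<tau>) / \<rho> * norm (u' - u)"
        by (rule Cauchy_bounds_half_ball(1)[OF holomorphic_on_subset[OF V(1) \<rho>(2)] _ \<rho>(1) u'(2)])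
          (use \<rho>(2) V(3) in auto)
      then show "norm (\<Sum>i\<in>{0,1}. c i * pairing \<tau> (H (p i))) \<le> 4 * K / \<rho> * norm (u' - u) * cost \<tau>"
        using V(2) u u' by (simp add: c_def p_def algebra_simps)
    qed (use cont bd G assms(8) p in auto)
    then show ?thesis by (simp add: c_def p_def)
  qed
  \<comment> \<open>The added 1 keeps the divisor positive when \<open>K = 0\<close>, and the
    surplus \<open>d\<close> makes the final inequality strict.\<close>
  have pos: "0 < 4 * K / \<rho> + 1" using assms(1) \<rho>(1) by (simp add: add_nonneg_pos)
  then have "0 < e / (4 * K / \<rho> + 1)" "0 < \<rho>/2" using \<rho>(1) \<open>0 < e\<close> by auto
  then obtain d where d: "0 < d" "d < \<rho>/2" "d < e / (4 * K / \<rho> + 1)"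
    using field_lbound_gt_zero by blast
  then have de: "d * (4 * K / \<rho> + 1) \<le> e"
    using pos by (metis pos_le_divide_eq less_imp_le)
  have "dist (G u' w) (G u w) < e" if "u' \<in> pos_reals" "dist u' u < d" for u'
  proof -
    have "norm (G u' w - G u w) \<le> 4 * K / \<rho> * norm (u' - u)" using lip that d by (simp add: dist_norm)
    also have "\<dots> \<le> 4 * K / \<rho> * d"
      using that \<rho>(1) assms(1) by (intro mult_left_mono) (auto simp: dist_norm)
    also have "\<dots> = d * (4 * K / \<rho> + 1) - d" by (simp only: distrib_left mult_1_right mult.commute add_diff_cancel_right')
    also have "\<dots> < e" using d(1) de by linarith
    finally show ?thesis by (simp add: dist_norm)
  qed
  then show "\<exists>d>0. \<forall>x'\<in>pos_reals. dist x' u < d \<longrightarrow> dist (G x' w) (G u w) < e" using d(1) by blast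
qed

section \<open>Induction over the variables\<close>

definition mixed :: "'d list \<Rightarrow> ('d \<Rightarrow> complex) set" where
  "mixed rs = {z. (\<forall>r\<in>set rs. z r \<in> pos_reals) \<and> (\<forall>r. z r \<in> S r)}"

text \<open>In \<open>partial_extension m C rs F\<close> the variables in \<open>rs\<close> are the ones not yet extended.\<close>

definition partial_extension ::
  "(('d \<Rightarrow> complex) \<Rightarrow> complex) \<Rightarrow> real \<Rightarrow> 'd list \<Rightarrow> (('d \<Rightarrow> complex) \<Rightarrow> complex) \<Rightarrow> bool" where
  "partial_extension m C rs F \<longleftrightarrow>
     (\<forall>z\<in>mixed rs. \<forall>s. s \<notin> set rs \<longrightarrow> (\<lambda>u. F (z(s := u))) holomorphic_on S s) \<and>
     (\<forall>z\<in>mixed rs. \<forall>s\<in>set rs. continuous_on pos_reals (\<lambda>u. F (z(s := u)))) \<and>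
     (\<forall>z. (\<forall>r. z r \<in> pos_reals) \<longrightarrow> F z = m z) \<and>
     (\<forall>z\<in>mixed rs. \<forall>\<tau>. (\<forall>r\<in>set rs. \<tau> r \<in> W r) \<longrightarrow>
        norm (pairings rs \<tau> F z) \<le> C * (\<Prod>r\<in>set rs. cost (\<tau> r)))"

lemma mixed_upd:
  assumes "z \<in> mixed rs" "u \<in> (if r \<in> set rs then pos_reals else S r)"
  shows "z(r := u) \<in> mixed rs"
  using assms pos_S by (auto simp: mixed_def split: if_splits)

lemma mixed_Cons: "mixed (j # rs) \<subseteq> mixed rs"
  by (auto simp: mixed_def)

lemma mixed_Cons_upd:
  assumes "z \<in> mixed rs" "x \<in> pos_reals"
  shows "z(j := x) \<in> mixed (j # rs)"
  using assms pos_S by (auto simp: mixed_def)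

text \<open>For fixed other variables, the function of variable \<open>j\<close> is extended by
  \<open>ext_W\<close>, and \<open>F'\<close> evaluates that extension at \<open>z j\<close>. The
  two parameter lemmas give regularity in the other variables. The point costs
  \<open>N\<^sub>0\<close> enter the auxiliary constants \<open>K\<close>, \<open>B\<close> and
  \<open>K'\<close> only; the constant \<open>C\<close> in the test clause is unchanged.\<close>

lemma partial_extension_step:
  assumes F: "partial_extension m C (j # rs) F" and d: "distinct (j # rs)" and C: "0 \<le> C"
  shows "\<exists>F'. partial_extension m C rs F'"
proof -
  have j: "j \<notin> set rs" and drs: "distinct rs" using d by auto
  note Fhol = F[unfolded partial_extension_def, THEN conjunct1, rule_format]
  note Fcont = F[unfolded partial_extension_def, THEN conjunct2, THEN conjunct1, rule_format]
  note Feq = F[unfolded partial_extension_def, THEN conjunct2, THEN conjunct2, THEN conjunct1, rule_format]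
  note Ftest = F[unfolded partial_extension_def, THEN conjunct2, THEN conjunct2, THEN conjunct2, rule_format]
  define pt where "pt r x = (SOME \<tau>. \<tau> \<in> W r \<and> point_test x \<tau> \<and> cost \<tau> = N\<^sub>0 r)" for r x
  have pt: "pt r x \<in> W r" "point_test x (pt r x)" "cost (pt r x) = N\<^sub>0 r" if "x \<in> pos_reals" for r x
    unfolding atomize_conj pt_def
    by (rule someI_ex) (use point_W[OF that, of r] in blast)
  \<comment> \<open>The bound for variable \<open>j\<close> alone when all remaining variables are
    frozen by point tests, each of which costs \<open>N\<^sub>0 r\<close>.\<close>
  define K where "K = C * (\<Prod>r\<in>set rs. N\<^sub>0 r)"
  have K: "0 \<le> K" unfolding K_def using C by (intro mult_nonneg_nonneg prod_nonneg) (auto simp: N\<^sub>0_nonneg)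
  have mixed_j: "z r \<in> pos_reals" if "z \<in> mixed rs" "r \<in> set rs" for z r
    using that by (auto simp: mixed_def)
  have test1: "norm (pairing \<tau> (\<lambda>x. F (z(j := x)))) \<le> K * cost \<tau>"
    if z: "z \<in> mixed rs" and \<tau>: "\<tau> \<in> W j" for z \<tau>
  proof -
    \<comment> \<open>A genuine test in \<open>j\<close>, point tests elsewhere. The value 1 put at
      \<open>j\<close> below is a placeholder on the ray, which the pairing overwrites.\<close>
    define \<tau>' where "\<tau>' r = (if r = j then \<tau> else pt r (z r))" for r
    have "norm (pairings (j # rs) \<tau>' F (z(j := 1))) \<le> C * (\<Prod>r\<in>set (j # rs). cost (\<tau>' r))"
      by (rule Ftest[OF mixed_Cons_upd[OF z one_pos_reals]])
        (use pt mixed_j[OF z] \<tau> in \<open>auto simp: \<tau>'_def\<close>)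
    also have "(\<Prod>r\<in>set (j # rs). cost (\<tau>' r)) = cost \<tau> * (\<Prod>r\<in>set rs. N\<^sub>0 r)"
    proof -
      have "(\<Prod>r\<in>set rs. cost (\<tau>' r)) = (\<Prod>r\<in>set rs. N\<^sub>0 r)"
        using j by (intro prod.cong refl) (use pt mixed_j[OF z] in \<open>auto simp: \<tau>'_def\<close>)
      then show ?thesis using j by (simp add: \<tau>'_def)
    qed
    also have "pairings (j # rs) \<tau>' F (z(j := 1)) = pairing \<tau> (\<lambda>x. F (z(j := x)))"
      using pairings_point[of "j # rs" j "z(j := 1)" \<tau>' F] d pt mixed_j[OF z]
      by (simp add: \<tau>'_def)
    finally show ?thesis by (simp add: K_def mult_ac)
  qed
  define B where "B = K * N\<^sub>0 j"
  have Fbd: "norm (F (z(j := x))) \<le> B" if "z \<in> mixed rs" "x \<in> pos_reals" for z x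
    using test1[OF that(1) pt(1)[OF that(2)]] pairing_point[OF pt(2)[OF that(2)]] pt(3)[OF that(2)]
    by (simp add: B_def)
  have Fbd': "norm (F z) \<le> B" if "z \<in> mixed (j # rs)" for z
    using Fbd[of z "z j"] that mixed_Cons by (auto simp: mixed_def)
  have Fcont_j: "continuous_on pos_reals (\<lambda>x. F (z(j := x)))" if "z \<in> mixed rs" for z
    using Fcont[OF mixed_Cons_upd[OF that one_pos_reals], of j] by simp
  \<comment> \<open>The choice depends on \<open>z\<close> only through \<open>z(j := x)\<close>,
    hence not on \<open>z j\<close>. Points differing in coordinate \<open>j\<close> therefore share
    the very same extension, as \<open>G_upd\<close> records.\<close>
  define G where "G z = (SOME G. G holomorphic_on S j \<and> (\<forall>x\<in>pos_reals. G x = F (z(j := x))) \<and>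
      (\<forall>w\<in>S j. norm (G w) \<le> K))" for z
  have "G z holomorphic_on S j \<and> (\<forall>x\<in>pos_reals. G z x = F (z(j := x))) \<and> (\<forall>w\<in>S j. norm (G z w) \<le> K)"
    if z: "z \<in> mixed rs" for z
  proof -
    have "bounded ((\<lambda>x. F (z(j := x))) ` pos_reals)"
      unfolding bounded_iff using Fbd[OF z] by blast
    from someI_ex[OF ext_W[OF Fcont_j[OF z] this K test1[OF z]]] show ?thesis
      unfolding G_def .
  qed
  then have G: "G z holomorphic_on S j" "\<And>x. x \<in> pos_reals \<Longrightarrow> G z x = F (z(j := x))"
      "\<And>w. w \<in> S j \<Longrightarrow> norm (G z w) \<le> K" if "z \<in> mixed rs" for z
    using that by blast+
  have G_upd: "G (z(j := x)) = G z" for z x by (simp add: G_def)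
  define F' where "F' z = G z (z j)" for z
  have zj: "z j \<in> S j" if "z \<in> mixed rs" for z using that j by (auto simp: mixed_def)
  have F'F: "F' z = F z" if "z \<in> mixed (j # rs)" for z
  proof -
    have "z j \<in> pos_reals" using that by (auto simp: mixed_def)
    then show ?thesis using G(2)[OF subsetD[OF mixed_Cons that]] by (simp add: F'_def)
  qed
  have tw: "z(s := u, j := x) = z(j := x, s := u)" if "s \<noteq> j" for z u s and x :: complex
    using that by (simp add: fun_upd_twist)
  have hol: "(\<lambda>u. F' (z(s := u))) holomorphic_on S s" if z: "z \<in> mixed rs" and s: "s \<notin> set rs" for z s
  proof (cases "s = j")
    case True
    then show ?thesis using G(1)[OF z] by (simp add: F'_def G_upd)
  next
    case False
    have zs: "z(s := u) \<in> mixed rs" if "u \<in> S s" for u using mixed_upd[OF z] s that by simp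
    have "(\<lambda>u. G (z(s := u)) (z j)) holomorphic_on S s"
    proof (rule extension_holomorphic_in_parameter[OF open_S K])
      show "continuous_on pos_reals (\<lambda>x. F (z(s := u, j := x)))" if "u \<in> S s" for u
        by (rule Fcont_j[OF zs[OF that]])
      show "(\<lambda>u. F (z(s := u, j := x))) holomorphic_on S s" if "x \<in> pos_reals" for x
        unfolding tw[OF False] using False s by (intro Fhol mixed_Cons_upd[OF z that]) auto
      show "norm (F (z(s := u, j := x))) \<le> B" if "u \<in> S s" "x \<in> pos_reals" for u x
        by (rule Fbd[OF zs[OF that(1)] that(2)])
      show "norm (pairing \<tau> (\<lambda>x. F (z(s := u, j := x)))) \<le> K * cost \<tau>" if "u \<in> S s" "\<tau> \<in> W j" for u \<tau>
        by (rule test1[OF zs[OF that(1)] that(2)])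
    qed (simp_all only: G(1,2)[OF zs] zj[OF z])
    then show ?thesis using False by (simp add: F'_def)
  qed
  have cont: "continuous_on pos_reals (\<lambda>u. F' (z(s := u)))" if z: "z \<in> mixed rs" and s: "s \<in> set rs" for z s
  proof -
    have sj: "s \<noteq> j" using s j by auto
    have zs: "z(s := u) \<in> mixed rs" if "u \<in> pos_reals" for u using mixed_upd[OF z] s that by simp
    \<comment> \<open>Now \<open>j\<close> and \<open>s\<close> both carry genuine tests, so the
      point costs run over the remaining variables without \<open>s\<close>.\<close>
    define K' where "K' = C * (\<Prod>r\<in>set rs - {s}. N\<^sub>0 r)"
    have K': "0 \<le> K'"
      unfolding K'_def using C by (intro mult_nonneg_nonneg prod_nonneg) (auto simp: N\<^sub>0_nonneg)
    have "continuous_on pos_reals (\<lambda>u. G (z(s := u)) (z j))"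
    proof (rule extension_continuous_in_parameter[OF K'])
      show "continuous_on pos_reals (\<lambda>x. F (z(s := u, j := x)))" if "u \<in> pos_reals" for u
        by (rule Fcont_j[OF zs[OF that]])
      show "continuous_on pos_reals (\<lambda>u. F (z(s := u, j := x)))" if "x \<in> pos_reals" for x
        unfolding tw[OF sj] using s by (intro Fcont mixed_Cons_upd[OF z that]) auto
      show bd: "norm (F (z(s := u, j := x))) \<le> B" if "u \<in> pos_reals" "x \<in> pos_reals" for u x
        by (rule Fbd[OF zs[OF that(1)] that(2)])
      fix \<sigma> \<tau> assume \<sigma>: "\<sigma> \<in> W s" and \<tau>: "\<tau> \<in> W j"
      define \<tau>' where "\<tau>' r = (if r = j then \<tau> else if r = s then \<sigma> else pt r (z r))" for r
      have "norm (pairings (j # rs) \<tau>' F (z(j := 1))) \<le> C * (\<Prod>r\<in>set (j # rs). cost (\<tau>' r))"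
        by (rule Ftest[OF mixed_Cons_upd[OF z one_pos_reals]])
          (use pt mixed_j[OF z] \<tau> \<sigma> in \<open>auto simp: \<tau>'_def\<close>)
      also have "(\<Prod>r\<in>set (j # rs). cost (\<tau>' r)) = cost \<tau> * (cost \<sigma> * (\<Prod>r\<in>set rs - {s}. N\<^sub>0 r))"
      proof -
        have "(\<Prod>r\<in>set rs - {s}. cost (\<tau>' r)) = (\<Prod>r\<in>set rs - {s}. N\<^sub>0 r)"
          using j by (intro prod.cong refl) (use pt mixed_j[OF z] in \<open>auto simp: \<tau>'_def\<close>)
        then show ?thesis using j sj by (simp add: \<tau>'_def prod.remove[OF _ s])
      qed
      also have "pairings (j # rs) \<tau>' F (z(j := 1)) = pairing \<tau> (\<lambda>x. pairings rs \<tau>' F (z(j := x)))"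
        by (simp add: \<tau>'_def)
      also have "\<dots> = pairing \<tau> (\<lambda>x. pairing \<sigma> (\<lambda>u. F (z(s := u, j := x))))"
      proof (rule pairing_cong[OF admissible_W[OF \<tau>]])
        show "pairings rs \<tau>' F (z(j := x)) = pairing \<sigma> (\<lambda>u. F (z(s := u, j := x)))" for x
        proof -
          have "pairings rs \<tau>' F (z(j := x)) =
              (if s \<in> set rs then pairing (\<tau>' s) (\<lambda>u. F (z(j := x, s := u))) else F (z(j := x)))"
            by (rule pairings_point[OF _ drs]) (use j pt mixed_j[OF z] in \<open>auto simp: \<tau>'_def\<close>)
          then show ?thesis using s sj by (simp add: tw[OF sj] \<tau>'_def)
        qed
      qed
      also have "\<dots> = pairing \<sigma> (\<lambda>u. pairing \<tau> (\<lambda>x. F (z(s := u, j := x))))"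
        by (rule pairing_swap[OF admissible_W[OF \<tau>] admissible_W[OF \<sigma>] bd])
      finally show "norm (pairing \<sigma> (\<lambda>u. pairing \<tau> (\<lambda>x. F (z(s := u, j := x))))) \<le> K' * cost \<tau> * cost \<sigma>"
        by (simp add: K'_def mult_ac)
    qed (simp_all only: G(1,2)[OF zs] zj[OF z])
    then show ?thesis using sj by (simp add: F'_def)
  qed
  have test: "norm (pairings rs \<tau> F' z) \<le> C * (\<Prod>r\<in>set rs. cost (\<tau> r))"
    if z: "z \<in> mixed rs" and \<tau>: "\<forall>r\<in>set rs. \<tau> r \<in> W r" for z \<tau>
  proof -
    let ?K = "C * (\<Prod>r\<in>set rs. cost (\<tau> r))" and ?n = "\<lambda>x. pairings rs \<tau> F (z(j := x))"
    have K2: "0 \<le> ?K"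
      using C \<tau> by (intro mult_nonneg_nonneg prod_nonneg) (auto simp: cost_nonneg)
    have admissible_\<tau>: "admissible (\<tau> r)" if "r \<in> set rs" for r
      using \<tau> that admissible_W by blast
    have adm: "\<forall>r\<in>set rs. admissible (\<tau> r) \<and> upd_stable (mixed (j # rs)) r pos_reals"
      by (auto simp: upd_stable_def admissible_\<tau> intro!: mixed_upd)
    have adm': "\<forall>r\<in>set rs. admissible (\<tau> r) \<and> upd_stable (mixed rs) r pos_reals"
      by (auto simp: upd_stable_def admissible_\<tau> intro!: mixed_upd)
    have zx: "z(j := x) \<in> mixed (j # rs)" if "x \<in> pos_reals" for x by (rule mixed_Cons_upd[OF z that])
    \<comment> \<open>With the tests in \<open>rs\<close> fixed, \<open>?n\<close> is a multiplier
      in variable \<open>j\<close>, and testing it with \<open>\<sigma>\<close> is an instance of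
      the old test clause. Hence its extension inherits exactly the constant
      \<open>?K\<close>.\<close>
    have "\<exists>V. V holomorphic_on S j \<and> (\<forall>x\<in>pos_reals. V x = ?n x) \<and> (\<forall>w\<in>S j. norm (V w) \<le> ?K)"
    proof (rule ext_W[OF _ _ K2])
      have "continuous_on pos_reals (\<lambda>x. pairings rs \<tau> F ((z(j := 1))(j := x)))"
      proof (rule pairings_continuous[OF adm j])
        show "upd_stable (mixed (j # rs)) j pos_reals"
          by (auto simp: upd_stable_def intro!: mixed_upd)
        show "continuous_on pos_reals (\<lambda>u. F (z(j := u)))" if "z \<in> mixed (j # rs)" for z
          using Fcont_j that mixed_Cons by blast
      qed (use Fbd' zx[OF one_pos_reals] in auto)
      then show "continuous_on pos_reals ?n" by simp
      have "\<exists>B'. \<forall>z\<in>mixed (j # rs). norm (pairings rs \<tau> F z) \<le> B'"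
        by (rule pairings_bound[OF adm Fbd'])
      then show "bounded (?n ` pos_reals)" unfolding bounded_iff using zx by blast
      fix \<sigma> assume \<sigma>: "\<sigma> \<in> W j"
      let ?\<tau> = "\<tau>(j := \<sigma>)"
      have "norm (pairings (j # rs) ?\<tau> F (z(j := 1))) \<le> C * (\<Prod>r\<in>set (j # rs). cost (?\<tau> r))"
        by (rule Ftest[OF zx[OF one_pos_reals]]) (use \<sigma> \<tau> in auto)
      also have "(\<Prod>r\<in>set (j # rs). cost (?\<tau> r)) = cost \<sigma> * (\<Prod>r\<in>set rs. cost (\<tau> r))"
        using j by (simp, intro disjI2 prod.cong) auto
      also have "pairings (j # rs) ?\<tau> F (z(j := 1)) = pairing \<sigma> ?n"
      proof -
        have "pairings rs' ?\<tau> F y = pairings rs' \<tau> F y" if "j \<notin> set rs'" for rs' y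
          using that by (induction rs' arbitrary: y) auto
        from this[OF j] show ?thesis by simp
      qed
      finally show "norm (pairing \<sigma> ?n) \<le> ?K * cost \<sigma>" by (simp add: mult_ac)
    qed
    then obtain V where V: "V holomorphic_on S j" "\<And>x. x \<in> pos_reals \<Longrightarrow> V x = ?n x"
      "\<And>w. w \<in> S j \<Longrightarrow> norm (V w) \<le> ?K" by blast
    \<comment> \<open>Pairing after extending equals extending after pairing: both sides are
      holomorphic in coordinate \<open>j\<close> and agree on the ray.\<close>
    have "pairings rs \<tau> F' (z(j := z j)) = V (z j)"
    proof (rule identity_pos_reals[OF open_S connected_S pos_S _ V(1) _ zj[OF z]])
      show "(\<lambda>w. pairings rs \<tau> F' (z(j := w))) holomorphic_on S j"
      proof (rule pairings_holomorphic[OF open_S adm' j])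
        show "upd_stable (mixed rs) j (S j)" using j by (auto simp: upd_stable_def intro!: mixed_upd)
        show "norm (F' z) \<le> K" if "z \<in> mixed rs" for z
          unfolding F'_def by (rule G(3)[OF that zj[OF that]])
      qed (use hol j z in auto)
      show "pairings rs \<tau> F' (z(j := x)) = V x" if "x \<in> pos_reals" for x
        unfolding V(2)[OF that] by (rule pairings_cong[OF adm F'F zx[OF that]])
    qed
    then show ?thesis using V(3)[OF zj[OF z]] by simp
  qed
  have "F' z = m z" if "\<forall>r. z r \<in> pos_reals" for z
  proof -
    have "z \<in> mixed (j # rs)" using that pos_S by (auto simp: mixed_def)
    then show ?thesis using F'F Feq that by simp
  qed
  then have "partial_extension m C rs F'"
    unfolding partial_extension_def using hol cont test by blast
  then show ?thesis by blast
qed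

text \<open>For the full list the clauses of \<open>partial_extension\<close> are the assumptions on
  \<open>m\<close>. For the empty list there is nothing to pair and the product of costs is empty,
  so the test clause has become the pointwise bound by \<open>C\<close>.\<close>

theorem multivariate_extension:
  fixes m :: "('d \<Rightarrow> complex) \<Rightarrow> complex"
  assumes rs: "distinct rs" "set rs = UNIV" and "0 \<le> C"
    and cont: "\<And>z s. (\<And>r. z r \<in> pos_reals) \<Longrightarrow> continuous_on pos_reals (\<lambda>u. m (z(s := u)))"
    and test: "\<And>z \<tau>. (\<And>r. z r \<in> pos_reals) \<Longrightarrow> (\<And>r. \<tau> r \<in> W r) \<Longrightarrow>
      norm (pairings rs \<tau> m z) \<le> C * (\<Prod>r\<in>UNIV. cost (\<tau> r))"
  shows "\<exists>F. (\<forall>z s. (\<forall>r. z r \<in> S r) \<longrightarrow> (\<lambda>u. F (z(s := u))) holomorphic_on S s) \<and>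
     (\<forall>z. (\<forall>r. z r \<in> pos_reals) \<longrightarrow> F z = m z) \<and>
     (\<forall>z. (\<forall>r. z r \<in> S r) \<longrightarrow> norm (F z) \<le> C)"
proof -
  have "\<exists>F'. partial_extension m C [] F'" if "partial_extension m C rs F" "distinct rs" for rs F
    using that
  proof (induction rs arbitrary: F)
    case (Cons j rs)
    then show ?case using partial_extension_step[OF Cons.prems assms(3)] by auto
  qed auto
  moreover have "partial_extension m C rs m"
    unfolding partial_extension_def mixed_def using cont test rs by auto
  ultimately obtain F where F: "partial_extension m C [] F" using rs by blast
  have "norm (F z) \<le> C" if "\<forall>r. z r \<in> S r" for z
    using F that by (auto simp: partial_extension_def mixed_def)
  then show ?thesis using F by (auto simp: partial_extension_def mixed_def intro!: exI[of _ F])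
qed

end

section \<open>Functions of several variables\<close>

text \<open>Fubini for the product of absolutely summable weights. The single sum over multi-indices
  is the form in which the operator on the product space appears.\<close>

lemma pairings_eq_infsum:
  fixes F :: "('d \<Rightarrow> complex) \<Rightarrow> complex"
  assumes "distinct rs" "\<And>r. r \<in> set rs \<Longrightarrow> admissible (\<tau> r)" "\<And>y. norm (F y) \<le> B"
  shows "pairings rs \<tau> F z = (\<Sum>\<^sub>\<infinity>\<kappa>\<in>PiE (set rs) (\<lambda>_. UNIV).
     (\<Prod>r\<in>set rs. weight (\<tau> r) (\<kappa> r)) * F (\<lambda>r. if r \<in> set rs then node (\<tau> r) (\<kappa> r) else z r))"
  using assms(1,2)
proof (induction rs arbitrary: z)
  case Nil
  then show ?case by simp
next
  case (Cons j rs)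
  let ?A = "set rs" and ?U = "\<lambda>_. UNIV :: nat set"
  have j: "j \<notin> ?A" using Cons.prems by simp
  define f where "f \<kappa> = (\<Prod>r\<in>insert j ?A. weight (\<tau> r) (\<kappa> r)) *
      F (\<lambda>r. if r \<in> insert j ?A then node (\<tau> r) (\<kappa> r) else z r)" for \<kappa>
  define g where "g = (\<lambda>(k, \<kappa>). \<kappa>(j := k) :: 'd \<Rightarrow> nat)"
  have "Infinite_Set_Sum.abs_summable_on (\<lambda>\<kappa>. \<Prod>r\<in>insert j ?A. weight (\<tau> r) (\<kappa> r)) (PiE (insert j ?A) ?U)"
  proof (rule Infinite_Set_Sum.abs_summable_on_prod_PiE)
    show "Infinite_Set_Sum.abs_summable_on (weight (\<tau> r)) UNIV" if "r \<in> insert j ?A" for r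
      using Cons.prems(2)[of r] that unfolding admissible_def abs_summable_equivalent[symmetric] by simp
  qed auto
  then have s: "(\<lambda>\<kappa>. norm (\<Prod>r\<in>insert j ?A. weight (\<tau> r) (\<kappa> r))) summable_on (PiE (insert j ?A) ?U)"
    unfolding abs_summable_equivalent[symmetric] .
  have "(\<lambda>\<kappa>. norm (f \<kappa>)) summable_on (PiE (insert j ?A) ?U)"
    by (rule Infinite_Sum.abs_summable_on_comparison_test'[OF summable_on_cmult_left[OF s, of B]])
      (simp add: f_def norm_mult mult_left_mono assms(3))
  then have sf: "f summable_on (PiE (insert j ?A) ?U)" by (rule abs_summable_summable)
  have inj: "inj_on g (UNIV \<times> PiE ?A ?U)"
    using inj_combinator[OF j, of ?U] by (simp add: g_def)
  have img: "PiE (insert j ?A) ?U = g ` (UNIV \<times> PiE ?A ?U)"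
    unfolding PiE_insert_eq g_def by simp
  have "f (g (k, \<kappa>)) = weight (\<tau> j) k * ((\<Prod>r\<in>?A. weight (\<tau> r) (\<kappa> r)) *
      F (\<lambda>r. if r \<in> ?A then node (\<tau> r) (\<kappa> r) else (z(j := node (\<tau> j) k)) r))" for k \<kappa>
  proof -
    have "(\<Prod>r\<in>?A. weight (\<tau> r) ((\<kappa>(j := k)) r)) = (\<Prod>r\<in>?A. weight (\<tau> r) (\<kappa> r))"
      using j by (intro prod.cong) auto
    moreover have "(\<lambda>r. if r \<in> insert j ?A then node (\<tau> r) ((\<kappa>(j := k)) r) else z r) =
        (\<lambda>r. if r \<in> ?A then node (\<tau> r) (\<kappa> r) else (z(j := node (\<tau> j) k)) r)"
      using j by auto
    ultimately show ?thesis using j unfolding f_def g_def prod.case by (simp only: prod.insert[OF finite_set j] fun_upd_same mult.assoc)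
  qed
  note fg = this
  have "infsum f (PiE (insert j ?A) ?U) = infsum (\<lambda>x. f (g x)) (UNIV \<times> PiE ?A ?U)"
    unfolding img using infsum_reindex[OF inj, of f] by (simp add: o_def)
  also have "\<dots> = (\<Sum>\<^sub>\<infinity>k. \<Sum>\<^sub>\<infinity>\<kappa>\<in>PiE ?A ?U. f (g (k, \<kappa>)))"
    using sf unfolding img summable_on_reindex[OF inj] by (subst infsum_Sigma_banach) (simp_all add: o_def)
  also have "\<dots> = pairings (j # rs) \<tau> F z"
    unfolding fg infsum_cmult_right' pairings.simps pairing_def using Cons by simp
  finally have "pairings (j # rs) \<tau> F z = infsum f (PiE (insert j ?A) ?U)" by (rule sym)
  then show ?case unfolding f_def list.set .
qed

text \<open>Coordinates leave the ray one at a time; \<open>A\<close> collects those that have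
  already moved into their domains.\<close>

lemma separately_holomorphic_unique:
  fixes F G :: "('d::finite \<Rightarrow> complex) \<Rightarrow> complex"
  assumes S: "\<And>r. open (S r)" "\<And>r. connected (S r)" "\<And>r. pos_reals \<subseteq> S r"
    and F: "\<And>z s. (\<And>r. z r \<in> S r) \<Longrightarrow> (\<lambda>u. F (z(s := u))) holomorphic_on S s"
    and G: "\<And>z s. (\<And>r. z r \<in> S r) \<Longrightarrow> (\<lambda>u. G (z(s := u))) holomorphic_on S s"
    and eq: "\<And>z. (\<And>r. z r \<in> pos_reals) \<Longrightarrow> F z = G z"
    and z: "\<And>r. z r \<in> S r"
  shows "F z = G z"
proof -
  have "\<forall>z. (\<forall>r\<in>A. z r \<in> S r) \<and> (\<forall>r. r \<notin> A \<longrightarrow> z r \<in> pos_reals) \<longrightarrow> F z = G z" if "finite A" for A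
    using that
  proof induction
    case empty
    then show ?case using eq by auto
  next
    case (insert s A)
    show ?case
    proof (intro allI impI)
      fix z assume z: "(\<forall>r\<in>insert s A. z r \<in> S r) \<and> (\<forall>r. r \<notin> insert s A \<longrightarrow> z r \<in> pos_reals)"
      then have zS: "z r \<in> S r" for r using S(3) by blast
      have "F (z(s := z s)) = G (z(s := z s))"
      proof (rule identity_pos_reals[OF S F[OF zS] G[OF zS] _ zS])
        show "F (z(s := x)) = G (z(s := x))" if "x \<in> pos_reals" for x
          by (rule insert.IH[rule_format]) (use insert.hyps z that in simp)
      qed
      then show "F z = G z" by simp
    qed
  qed
  from this[of UNIV] show ?thesis using z by simp
qed

text \<open>The bound on \<open>F\<close> makes the one-variable Cauchy estimates uniform, so
  changing the coordinates one after the other yields an error quadratic in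
  \<open>norm h\<close>.\<close>

lemma Osgood:
  fixes F :: "('d::finite \<Rightarrow> complex) \<Rightarrow> complex"
  assumes S: "\<And>r. open (S r)"
    and hol: "\<And>z s. (\<And>r. z r \<in> S r) \<Longrightarrow> (\<lambda>u. F (z(s := u))) holomorphic_on S s"
    and bd: "\<And>z. (\<And>r. z r \<in> S r) \<Longrightarrow> norm (F z) \<le> B"
  shows "holomorphic_several (\<lambda>v. F (\<lambda>r. v $ r)) {v. \<forall>r. v $ r \<in> S r}"
  unfolding holomorphic_several_def
proof
  fix v :: "complex ^ 'd" assume v: "v \<in> {v. \<forall>r. v $ r \<in> S r}"
  define z where "z r = v $ r" for r
  have zS: "z r \<in> S r" for r using v by (simp add: z_def)
  have B: "0 \<le> B" using bd[OF zS] norm_ge_zero order_trans by blast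
  have "\<exists>\<rho>>0. \<forall>r. ball (z r) \<rho> \<subseteq> S r"
  proof -
    have "\<forall>r. \<exists>e>0. ball (z r) e \<subseteq> S r" using S zS open_contains_ball by blast
    then obtain e where e: "\<And>r. 0 < e r" "\<And>r. ball (z r) (e r) \<subseteq> S r" by metis
    define \<rho> where "\<rho> = Min (range e)"
    have "0 < \<rho>" using e(1) by (auto simp: \<rho>_def)
    moreover have "ball (z r) \<rho> \<subseteq> S r" for r
      using e(2)[of r] by (rule order_trans[rotated]) (auto simp: \<rho>_def)
    ultimately show ?thesis by blast
  qed
  then obtain \<rho> where \<rho>: "0 < \<rho>" "\<And>r. ball (z r) \<rho> \<subseteq> S r" by blast
  define D where "D r = deriv (\<lambda>u. F (z(r := u))) (z r)" for r
  define L where "L h = (\<Sum>r\<in>UNIV. h $ r * D r)" for h :: "complex ^ 'd"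
  define n where "n = real CARD('d)"
  \<comment> \<open>The error per coordinate: the first term bounds a mixed second difference
    (Cauchy's factor 4/\<rho> twice, for up to n shifted coordinates), the second is the Taylor
    remainder in that coordinate.\<close>
  define M where "M = 16 * n * B / \<rho>^2 + 32 * B / \<rho>^2"
  have est: "norm (F (\<lambda>r. (v + h) $ r) - F (\<lambda>r. v $ r) - L h) \<le> n * M * norm h ^ 2"
    if h: "norm h \<le> \<rho>/2" for h
  proof -
    define sh where "sh A y = (\<lambda>r. if r \<in> A then y r + h $ r else y r)" for A and y :: "'d \<Rightarrow> complex"
    have hr: "norm (h $ r) \<le> norm h" "norm (h $ r) \<le> \<rho>/2" for r
      using h Finite_Cartesian_Product.norm_nth_le[of h r] by linarith+
    have zh: "z r + h $ r \<in> S r" for r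
      using hr(2)[of r] \<rho>(1) by (intro subsetD[OF \<rho>(2)]) (auto simp: dist_norm)
    have shS: "sh A y r \<in> S r" if "\<And>r. y r \<in> S r" "\<And>r. r \<in> A \<Longrightarrow> y r = z r" for A y r
      using that zh by (auto simp: sh_def)
    have ball: "u \<in> S r" if "u \<in> ball (z r) \<rho>" for u r using \<rho>(2) that by blast
    \<comment> \<open>Here \<open>y\<close> must agree with \<open>z\<close> only on the shifted
      coordinates, so that another coordinate may still range over a whole ball.\<close>
    have lip: "norm (F (sh A y) - F y) \<le> card A * (4 * B / \<rho>) * norm h"
      if "\<And>r. y r \<in> S r" "\<And>r. r \<in> A \<Longrightarrow> y r = z r" "finite A" for A y
      using that(3,2)
    proof induction
      case empty
      then show ?case by (simp add: sh_def)
    next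
      case (insert a A)
      have ya: "y a = z a" using insert.prems by simp
      have shA: "sh A y r \<in> S r" for r using shS[of y A r] that(1) insert.prems by simp
      have "sh (insert a A) y = (sh A y)(a := y a + h $ a)" "(sh A y)(a := y a) = sh A y"
        using insert.hyps by (auto simp: sh_def)
      moreover have "norm (F ((sh A y)(a := y a + h $ a)) - F ((sh A y)(a := y a))) \<le> 4 * B / \<rho> * norm (h $ a)"
        unfolding ya
      proof (rule Cauchy_bounds_half_ball(1)[OF _ _ \<rho>(1) hr(2)])
        show "(\<lambda>u. F ((sh A y)(a := u))) holomorphic_on ball (z a) \<rho>"
          by (rule holomorphic_on_subset[OF hol[OF shA] \<rho>(2)])
        show "norm (F ((sh A y)(a := u))) \<le> B" if "u \<in> ball (z a) \<rho>" for u
          using ball[OF that] shA by (intro bd) simp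
      qed
      moreover have "4 * B / \<rho> * norm (h $ a) \<le> 4 * B / \<rho> * norm h"
        using hr(1) B \<rho>(1) by (intro mult_left_mono) auto
      ultimately have "norm (F (sh (insert a A) y) - F (sh A y)) \<le> 4 * B / \<rho> * norm h" by simp
      moreover have "norm (F (sh A y) - F y) \<le> card A * (4 * B / \<rho>) * norm h"
        using insert by simp
      ultimately have "norm (F (sh (insert a A) y) - F y) \<le> 4 * B / \<rho> * norm h + card A * (4 * B / \<rho>) * norm h"
        using norm_triangle_ineq[of "F (sh (insert a A) y) - F (sh A y)" "F (sh A y) - F y"] by simp
      then show ?case using insert.hyps by (simp add: distrib_right add_divide_distrib)
    qed
    have "norm (F (sh A z) - F z - (\<Sum>r\<in>A. h $ r * D r)) \<le> card A * M * norm h ^ 2" if "finite A" for A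
      using that
    proof induction
      case empty
      then show ?case by (simp add: sh_def)
    next
      case (insert s A)
      \<comment> \<open>The effect of shifting the coordinates in \<open>A\<close>, as a function of
        coordinate \<open>s\<close>. Its increment is the discrepancy between moving
        \<open>s\<close> after that shift and moving it at \<open>z\<close>; being small on the
        whole ball, \<open>g\<close> has an increment of second order.\<close>
      define g where "g u = F (sh A (z(s := u))) - F (z(s := u))" for u
      have up: "sh A (z(s := u)) = (sh A z)(s := u)" for u using insert.hyps by (auto simp: sh_def)
      have shA: "sh A z r \<in> S r" for r using shS zS by simp
      have g: "norm (g (z s + h $ s) - g (z s)) \<le> 4 * (n * (4 * B / \<rho>) * norm h) / \<rho> * norm (h $ s)"
      proof (rule Cauchy_bounds_half_ball(1)[OF _ _ \<rho>(1) hr(2)])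
        show "g holomorphic_on ball (z s) \<rho>"
          unfolding g_def up
          by (intro holomorphic_intros holomorphic_on_subset[OF hol \<rho>(2)] shA zS)
        show "norm (g u) \<le> n * (4 * B / \<rho>) * norm h" if "u \<in> ball (z s) \<rho>" for u
        proof -
          have "norm (g u) \<le> card A * (4 * B / \<rho>) * norm h"
            unfolding g_def by (rule lip) (use ball[OF that] zS insert.hyps in auto)
          also have "\<dots> \<le> n * (4 * B / \<rho>) * norm h"
            unfolding n_def using B \<rho>(1) card_mono[of UNIV A]
            by (intro mult_right_mono) auto
          finally show ?thesis .
        qed
      qed
      also have "\<dots> = 16 * n * B / \<rho>^2 * (norm h * norm (h $ s))"
        by (simp add: power2_eq_square)
      also have "\<dots> \<le> 16 * n * B / \<rho>^2 * (norm h)^2"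
        unfolding power2_eq_square[of "norm h"] using hr(1)[of s] B by (intro mult_left_mono) (auto simp: n_def)
      finally have g: "norm (g (z s + h $ s) - g (z s)) \<le> 16 * n * B / \<rho>^2 * (norm h)^2" .
      have "norm (F (z(s := z s + h $ s)) - F (z(s := z s)) - D s * h $ s) \<le> 32 * B / \<rho>^2 * norm (h $ s)^2"
        unfolding D_def
      proof (rule Cauchy_bounds_half_ball(2)[OF _ _ \<rho>(1) hr(2)])
        show "norm (F (z(s := w))) \<le> B" if "w \<in> ball (z s) \<rho>" for w
          using ball[OF that] zS by (intro bd) simp
      qed (rule holomorphic_on_subset[OF hol[OF zS] \<rho>(2)])
      also have "\<dots> \<le> 32 * B / \<rho>^2 * norm h ^2"
        using hr(1)[of s] B by (intro mult_left_mono power_mono) auto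
      finally have d: "norm (F (z(s := z s + h $ s)) - F (z(s := z s)) - D s * h $ s) \<le> 32 * B / \<rho>^2 * norm h ^2" .
      have "sh (insert s A) z = sh A (z(s := z s + h $ s))" "sh A (z(s := z s)) = sh A z"
        using insert.hyps by (auto simp: sh_def)
      then have "F (sh (insert s A) z) - F z - (\<Sum>r\<in>insert s A. h $ r * D r) =
          (F (sh A z) - F z - (\<Sum>r\<in>A. h $ r * D r)) + ((g (z s + h $ s) - g (z s))
          + (F (z(s := z s + h $ s)) - F (z(s := z s)) - D s * h $ s))"
        using insert.hyps by (simp add: g_def)
      also have "norm \<dots> \<le> card A * M * norm h ^ 2 + (16 * n * B / \<rho>^2 * (norm h)^2 + 32 * B / \<rho>^2 * norm h ^2)"
        by (intro norm_triangle_mono insert.IH g d)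
      also have "\<dots> = card (insert s A) * M * norm h ^ 2"
        using insert.hyps by (simp add: M_def distrib_right)
      finally show ?case .
    qed
    from this[of UNIV] show ?thesis by (simp add: sh_def z_def[abs_def] L_def n_def)
  qed
  have M: "0 \<le> n * M" using B \<rho>(1) by (auto simp: M_def n_def)
  have "((\<lambda>v. F (\<lambda>r. v $ r)) has_derivative L) (at v)"
    unfolding has_derivative_at_alt
  proof (intro conjI allI impI)
    show "bounded_linear L"
      unfolding L_def
      by (intro bounded_linear_sum bounded_linear_mult_left[THEN bounded_linear_compose] bounded_linear_vec_nth)
    fix e :: real assume e: "0 < e"
    \<comment> \<open>The added 1 avoids division by zero when \<open>M = 0\<close>.\<close>
    define d where "d = min (\<rho>/2) (e / (n * M + 1))"
    have d: "0 < d" using \<rho>(1) e M by (simp add: d_def)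
    have "norm (F (\<lambda>r. y $ r) - F (\<lambda>r. v $ r) - L (y - v)) \<le> e * norm (y - v)" if y: "norm (y - v) < d" for y
    proof -
      have "norm (y - v) \<le> \<rho>/2" "norm (y - v) \<le> e / (n * M + 1)" using y by (auto simp: d_def)
      then have "norm (F (\<lambda>r. y $ r) - F (\<lambda>r. v $ r) - L (y - v)) \<le> n * M * norm (y - v) ^ 2"
        using est[of "y - v"] by simp
      also have "\<dots> = (n * M * norm (y - v)) * norm (y - v)" by (simp add: power2_eq_square)
      also have "n * M * norm (y - v) \<le> (n * M + 1) * norm (y - v)" by (simp add: distrib_right)
      also have "\<dots> \<le> e"
        using \<open>norm (y - v) \<le> e / (n * M + 1)\<close> M by (simp add: field_simps)
      finally show ?thesis by (simp add: mult_right_mono)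
    qed
    then show "\<exists>d>0. \<forall>y. norm (y - v) < d \<longrightarrow>
        norm (F (\<lambda>r. y $ r) - F (\<lambda>r. v $ r) - L (y - v)) \<le> e * norm (y - v)"
      using d by blast
  qed
  then have "((\<lambda>v. F (\<lambda>r. v $ r)) has_derivative L) (at v within {v. \<forall>r. v $ r \<in> S r})"
    by (rule has_derivative_at_withinI)
  moreover have "L (c *s h) = c * L h" for c h
    by (simp add: L_def sum_distrib_left mult.assoc)
  ultimately show "\<exists>F'. ((\<lambda>v. F (\<lambda>r. v $ r)) has_derivative F') (at v within {v. \<forall>r. v $ r \<in> S r}) \<and>
      (\<forall>c h. F' (c *s h) = c * F' h)"
    by blast
qed

section \<open>Lebesgue spaces\<close>

lemma borel_measurable_cnj [measurable]: "cnj \<in> borel_measurable borel"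
  by (intro borel_measurable_continuous_onI continuous_intros)

lemma LpD:
  assumes "f \<in> Lp p M"
  shows "f \<in> borel_measurable M" "integrable M (\<lambda>x. norm (f x) powr p)"
  using assms by (auto simp: Lp_def)

lemma Lp_norm_nonneg: "0 \<le> Lp_norm p M f"
  by (simp add: Lp_norm_def)

lemma Lp_norm_powr: "0 < p \<Longrightarrow> Lp_norm p M f powr p = (LINT x|M. norm (f x) powr p)"
  by (simp add: Lp_norm_def powr_powr integral_nonneg_AE)

lemma Lp_dominated:
  assumes "f \<in> borel_measurable M" "integrable M w" "\<And>x. norm (f x) powr p \<le> w x"
  shows "f \<in> Lp p M"
proof -
  note [measurable] = assms(1)
  have "integrable M (\<lambda>x. norm (f x) powr p)"
    by (rule Bochner_Integration.integrable_bound[OF assms(2)])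
      (measurable, auto intro!: always_eventually order_trans[OF assms(3) abs_ge_self])
  then show ?thesis using assms(1) by (simp add: Lp_def)
qed

lemma powr_le_cancel2:
  fixes a b p :: real
  assumes "a powr p \<le> b powr p" "0 < p" "0 \<le> b"
  shows "a \<le> b"
  using assms powr_less_mono2[of p b a] by (meson not_le)

lemma powr_add_le:
  fixes a b :: real
  assumes "0 \<le> a" "0 \<le> b" "0 < p"
  shows "(a + b) powr p \<le> 2 powr p * (a powr p + b powr p)"
proof -
  have "(a + b) powr p \<le> (2 * max a b) powr p" using assms by (intro powr_mono2) auto
  also have "\<dots> = 2 powr p * max a b powr p" by (rule powr_mult)
  also have "max a b powr p \<le> a powr p + b powr p" by (auto simp: max_def)
  finally show ?thesis by simp
qed

text \<open>One factor 2 comes from the pointwise bound \<open>powr_add_le\<close>, the other from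
  \<open>2 \<le> 2 powr p\<close>. The resulting 4 ends up in \<open>drop_const\<close>, which the
  passage to powers removes.\<close>

lemma Lp_add:
  assumes "1 \<le> p" "f \<in> Lp p M" "g \<in> Lp p M"
  shows "(\<lambda>x. f x + g x) \<in> Lp p M"
    and "Lp_norm p M (\<lambda>x. f x + g x) \<le> 4 * (Lp_norm p M f + Lp_norm p M g)"
proof -
  note [measurable] = LpD(1)[OF assms(2)] LpD(1)[OF assms(3)]
  have p: "0 < p" using assms(1) by simp
  let ?w = "\<lambda>x. 2 powr p * (norm (f x) powr p + norm (g x) powr p)"
  have w: "integrable M ?w"
    using LpD(2)[OF assms(2)] LpD(2)[OF assms(3)] by (intro integrable_mult_right Bochner_Integration.integrable_add)
  have le: "norm (f x + g x) powr p \<le> ?w x" for x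
    by (rule order_trans[OF powr_mono2 powr_add_le]) (use assms(1) in \<open>auto intro: norm_triangle_ineq\<close>)
  show fg: "(\<lambda>x. f x + g x) \<in> Lp p M"
    by (rule Lp_dominated[OF _ w le]) measurable
  let ?A = "Lp_norm p M f" and ?B = "Lp_norm p M g"
  have "Lp_norm p M (\<lambda>x. f x + g x) powr p \<le> (LINT x|M. ?w x)"
    unfolding Lp_norm_powr[OF p] by (intro integral_mono LpD(2)[OF fg] w le)
  also have "\<dots> = 2 powr p * (?A powr p + ?B powr p)"
    using LpD(2)[OF assms(2)] LpD(2)[OF assms(3)] by (simp add: Lp_norm_powr[OF p])
  also have "\<dots> \<le> 2 powr p * ((?A + ?B) powr p + (?A + ?B) powr p)"
    using assms(1) by (intro mult_left_mono add_mono powr_mono2) (auto simp: Lp_norm_nonneg)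
  also have "\<dots> = (2 * (?A + ?B)) powr p * 2"
    unfolding powr_mult by simp
  finally have le2: "Lp_norm p M (\<lambda>x. f x + g x) powr p \<le> (2 * (?A + ?B)) powr p * 2" .
  show "Lp_norm p M (\<lambda>x. f x + g x) \<le> 4 * (?A + ?B)"
  proof -
    have "(2 * (?A + ?B)) powr p * 2 \<le> (2 * (?A + ?B)) powr p * 2 powr p"
      using assms(1) powr_mono[of 1 p 2] by (intro mult_left_mono) auto
    also have "\<dots> = (2 * (?A + ?B) * 2) powr p"
      by (rule powr_mult[symmetric])
    finally have "Lp_norm p M (\<lambda>x. f x + g x) powr p \<le> (4 * (?A + ?B)) powr p"
      using le2 by (simp add: algebra_simps)
    then show ?thesis
      by (rule powr_le_cancel2[OF _ p]) (auto simp: Lp_norm_nonneg)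
  qed
qed

lemma Lp_scale:
  assumes "0 < p" "f \<in> Lp p M"
  shows "(\<lambda>x. c * f x) \<in> Lp p M" "Lp_norm p M (\<lambda>x. c * f x) = norm c * Lp_norm p M f"
proof -
  note [measurable] = LpD(1)[OF assms(2)]
  have eq: "norm (c * f x) powr p = norm c powr p * norm (f x) powr p" for x
    by (simp add: norm_mult powr_mult)
  show "(\<lambda>x. c * f x) \<in> Lp p M"
    using LpD(2)[OF assms(2)] by (simp add: Lp_def norm_mult powr_mult)
  show "Lp_norm p M (\<lambda>x. c * f x) = norm c * Lp_norm p M f"
    unfolding Lp_norm_def eq using assms(1) by (simp add: powr_mult powr_powr)
qed

lemma Lp_diff:
  assumes "1 \<le> p" "f \<in> Lp p M" "g \<in> Lp p M"
  shows "(\<lambda>x. f x - g x) \<in> Lp p M"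
    and "Lp_norm p M (\<lambda>x. f x - g x) \<le> 4 * (Lp_norm p M f + Lp_norm p M g)"
  using Lp_add[OF assms(1,2) Lp_scale(1)[of p g M "-1"]] Lp_scale(2)[of p g M "-1"] assms by auto

lemma Lp_sum:
  assumes "1 \<le> p" "\<And>k. k \<in> K \<Longrightarrow> f k \<in> Lp p M"
  shows "(\<lambda>x. \<Sum>k\<in>K. f k x) \<in> Lp p M"
  using assms(2)
proof (induction K rule: infinite_finite_induct)
  case (insert k K)
  then show ?case using Lp_add(1)[OF assms(1), of "f k" M "\<lambda>x. \<Sum>k\<in>K. f k x"] by simp
qed (use assms(1) in \<open>auto simp: Lp_def\<close>)

lemma Holder:
  assumes "1 < p" "1 < q" "1 / p + 1 / q = 1" "f \<in> Lp p M" "g \<in> Lp q M"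
  shows "integrable M (\<lambda>x. f x * cnj (g x))"
    and "(LINT x|M. norm (f x) * norm (g x)) \<le> Lp_norm p M f * Lp_norm q M g"
    and "norm (L2_inner M f g) \<le> Lp_norm p M f * Lp_norm q M g"
proof -
  note [measurable] = LpD(1)[OF assms(4)] LpD(1)[OF assms(5)]
  note int = LpD(2)[OF assms(4)] LpD(2)[OF assms(5)]
  have i: "integrable M (\<lambda>x. norm (f x) * norm (g x))"
  proof (rule Bochner_Integration.integrable_bound)
    show "integrable M (\<lambda>x. norm (f x) powr p / p + norm (g x) powr q / q)" using int by auto
    show "AE x in M. norm (norm (f x) * norm (g x)) \<le> norm (norm (f x) powr p / p + norm (g x) powr q / q)"
      by (intro always_eventually allI) (simp add: order_trans[OF Youngs_inequality[OF assms(1-3)] abs_ge_self])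
  qed measurable
  show c: "integrable M (\<lambda>x. f x * cnj (g x))"
    by (rule Bochner_Integration.integrable_bound[OF i]) (auto simp: norm_mult)
  let ?A = "Lp_norm p M f" and ?B = "Lp_norm q M g"
  have z: "(LINT x|M. norm (f x) * norm (g x)) = 0" if "?A = 0 \<or> ?B = 0"
  proof -
    have "(LINT x|M. norm (f x) powr p) = 0 \<or> (LINT x|M. norm (g x) powr q) = 0"
      using that Lp_norm_powr[of p M f] Lp_norm_powr[of q M g] assms(1,2) by auto
    then have "AE x in M. norm (f x) * norm (g x) = 0"
      using integral_nonneg_eq_0_iff_AE[OF int(1)] integral_nonneg_eq_0_iff_AE[OF int(2)] by auto
    then show ?thesis using integral_cong_AE[of "\<lambda>x. norm (f x) * norm (g x)" M "\<lambda>_. 0"] by simp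
  qed
  show le: "(LINT x|M. norm (f x) * norm (g x)) \<le> ?A * ?B"
  proof (cases "?A = 0 \<or> ?B = 0")
    case True
    then show ?thesis using z by (auto simp: Lp_norm_nonneg)
  next
    case False
    then have AB: "0 < ?A" "0 < ?B" using Lp_norm_nonneg[of p M f] Lp_norm_nonneg[of q M g] by auto
    have "(LINT x|M. norm (f x) * norm (g x)) / (?A * ?B) = (LINT x|M. (norm (f x) / ?A) * (norm (g x) / ?B))"
      by (simp add: field_simps)
    also have "\<dots> \<le> (LINT x|M. norm (f x) powr p / (?A powr p * p) + norm (g x) powr q / (?B powr q * q))"
    proof (rule integral_mono)
      show "(norm (f x) / ?A) * (norm (g x) / ?B) \<le> norm (f x) powr p / (?A powr p * p) + norm (g x) powr q / (?B powr q * q)" for x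
        using Youngs_inequality[OF assms(1-3), of "norm (f x) / ?A" "norm (g x) / ?B"] AB
        by (simp add: powr_divide)
      show "integrable M (\<lambda>x. (norm (f x) / ?A) * (norm (g x) / ?B))"
        using integrable_divide[OF i, of "?A * ?B"] by simp
    qed (use int in auto)
    also have "\<dots> = (LINT x|M. norm (f x) powr p) / (?A powr p * p) + (LINT x|M. norm (g x) powr q) / (?B powr q * q)"
      using int by simp
    also have "\<dots> = 1 / p + 1 / q"
      using AB assms(1,2) by (simp add: Lp_norm_powr[symmetric])
    finally show ?thesis using AB assms(3) by (simp add: field_simps)
  qed
  have "norm (L2_inner M f g) \<le> (LINT x|M. norm (f x * cnj (g x)))"
    unfolding L2_inner_def by (rule integral_norm_bound)
  then show "norm (L2_inner M f g) \<le> ?A * ?B" using le by (simp add: norm_mult)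
qed

lemma Lp2_iff: "f \<in> Lp 2 M \<longleftrightarrow> f \<in> borel_measurable M \<and> integrable M (\<lambda>x. (norm (f x))\<^sup>2)"
  by (simp add: Lp_def powr_numeral)

lemma Lp2_norm_power2: "(Lp_norm 2 M f)\<^sup>2 = (LINT x|M. (norm (f x))\<^sup>2)"
  using Lp_norm_powr[of 2 M f] by (simp add: powr_numeral Lp_norm_nonneg)

lemma Cauchy_Schwarz_L2:
  assumes "f \<in> Lp 2 M" "g \<in> Lp 2 M"
  shows "integrable M (\<lambda>x. f x * cnj (g x))"
    and "norm (L2_inner M f g) \<le> Lp_norm 2 M f * Lp_norm 2 M g"
  using Holder[of 2 2 f M g] assms by auto

lemma L2_inner_diff_left:
  assumes "f \<in> Lp 2 M" "g \<in> Lp 2 M" "h \<in> Lp 2 M"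
  shows "L2_inner M (\<lambda>x. f x - g x) h = L2_inner M f h - L2_inner M g h"
  using Cauchy_Schwarz_L2(1)[OF assms(1,3)] Cauchy_Schwarz_L2(1)[OF assms(2,3)]
  by (simp add: L2_inner_def left_diff_distrib)

lemma L2_inner_scale_left: "L2_inner M (\<lambda>x. c * f x) h = c * L2_inner M f h"
  by (simp add: L2_inner_def mult.assoc)

lemma L2_inner_commute: "L2_inner M g f = cnj (L2_inner M f g)"
  using Bochner_Integration.integral_cnj[of M "\<lambda>x. f x * cnj (g x)"]
  by (simp add: L2_inner_def mult.commute)

lemma L2_inner_self: "L2_inner M f f = of_real ((Lp_norm 2 M f)\<^sup>2)"
  unfolding L2_inner_def Lp2_norm_power2 integral_complex_of_real[symmetric]
  by (simp add: complex_norm_square[symmetric])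

lemma L2_inner_sum_left:
  assumes "\<And>k. k \<in> K \<Longrightarrow> f k \<in> Lp 2 M" "h \<in> Lp 2 M"
  shows "L2_inner M (\<lambda>x. \<Sum>k\<in>K. f k x) h = (\<Sum>k\<in>K. L2_inner M (f k) h)"
  using Cauchy_Schwarz_L2(1)[OF assms(1) assms(2)]
  by (simp add: L2_inner_def sum_distrib_right)

section \<open>Orthonormal systems and multipliers\<close>

lemma Lp2_nn_integral_le:
  assumes "f \<in> borel_measurable M" "(\<integral>\<^sup>+x. ennreal ((norm (f x))\<^sup>2) \<partial>M) \<le> ennreal c" "0 \<le> c"
  shows "f \<in> Lp 2 M" "(Lp_norm 2 M f)\<^sup>2 \<le> c"
proof -
  note [measurable] = assms(1)
  have "(\<integral>\<^sup>+x. ennreal ((norm (f x))\<^sup>2) \<partial>M) < \<infinity>"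
    using assms(2) by (rule le_less_trans) simp
  then have i: "integrable M (\<lambda>x. (norm (f x))\<^sup>2)"
    by (intro integrableI_bounded) auto
  then show "f \<in> Lp 2 M" using assms(1) by (simp add: Lp2_iff)
  have "ennreal (LINT x|M. (norm (f x))\<^sup>2) \<le> ennreal c"
    using assms(2) nn_integral_eq_integral[OF i] by simp
  then show "(Lp_norm 2 M f)\<^sup>2 \<le> c" using assms(3) by (simp add: Lp2_norm_power2)
qed

locale orthonormal_system =
  fixes M :: "'a measure" and e :: "'k \<Rightarrow> 'a \<Rightarrow> complex"
  assumes e_Lp2: "e k \<in> Lp 2 M"
    and e_inner: "L2_inner M (e j) (e k) = (if j = k then 1 else 0)"
begin

definition comb :: "('k \<Rightarrow> complex) \<Rightarrow> 'k set \<Rightarrow> 'a \<Rightarrow> complex" where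
  "comb b K x = (\<Sum>k\<in>K. b k * e k x)"

lemma comb_Lp2: "comb b K \<in> Lp 2 M"
  unfolding comb_def[abs_def] by (intro Lp_sum Lp_scale e_Lp2) auto

lemma inner_comb_left:
  assumes "h \<in> Lp 2 M"
  shows "L2_inner M (comb b K) h = (\<Sum>k\<in>K. b k * L2_inner M (e k) h)"
  unfolding comb_def[abs_def]
  by (subst L2_inner_sum_left) (auto simp: L2_inner_scale_left assms intro!: Lp_scale e_Lp2)

lemma inner_comb_e: "finite K \<Longrightarrow> L2_inner M (comb b K) (e j) = (if j \<in> K then b j else 0)"
  by (subst inner_comb_left) (auto simp: e_inner e_Lp2 if_distrib cong: if_cong)

lemma norm_comb:
  assumes "finite K"
  shows "(Lp_norm 2 M (comb b K))\<^sup>2 = (\<Sum>k\<in>K. (norm (b k))\<^sup>2)"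
proof -
  have "complex_of_real ((Lp_norm 2 M (comb b K))\<^sup>2) = L2_inner M (comb b K) (comb b K)"
    by (rule L2_inner_self[symmetric])
  also have "\<dots> = (\<Sum>k\<in>K. b k * L2_inner M (e k) (comb b K))"
    by (rule inner_comb_left[OF comb_Lp2])
  also have "\<dots> = (\<Sum>k\<in>K. b k * cnj (b k))"
    using L2_inner_commute[of M _ "comb b K"] assms
    by (intro sum.cong) (auto simp: inner_comb_e)
  also have "\<dots> = complex_of_real (\<Sum>k\<in>K. (norm (b k))\<^sup>2)"
    by (simp add: complex_norm_square[symmetric])
  finally show ?thesis using of_real_eq_iff by blast
qed

text \<open>The sum of squares is both the squared norm of the partial expansion and its inner
  product with \<open>f\<close>, so Cauchy-Schwarz bounds the norm of the expansion by that of
  \<open>f\<close>.\<close>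

lemma Bessel:
  assumes "f \<in> Lp 2 M" "finite K"
  shows "(\<Sum>k\<in>K. (norm (L2_inner M f (e k)))\<^sup>2) \<le> (Lp_norm 2 M f)\<^sup>2"
proof -
  define b where "b k = L2_inner M f (e k)" for k
  let ?S = "\<Sum>k\<in>K. (norm (b k))\<^sup>2" and ?g = "Lp_norm 2 M (comb b K)" and ?f = "Lp_norm 2 M f"
  have "L2_inner M (comb b K) f = (\<Sum>k\<in>K. b k * cnj (b k))"
    unfolding inner_comb_left[OF assms(1)] using L2_inner_commute[of M _ f]
    by (intro sum.cong) (auto simp: b_def)
  also have "\<dots> = complex_of_real ?S"
    by (simp add: complex_norm_square[symmetric])
  finally have "norm (L2_inner M (comb b K) f) = ?S"
    by (simp add: sum_nonneg del: of_real_sum)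
  then have "?g\<^sup>2 \<le> ?g * ?f"
    using Cauchy_Schwarz_L2(2)[OF comb_Lp2 assms(1), of b K] norm_comb[OF assms(2)] by simp
  then have "?g \<le> ?f \<or> ?g = 0"
    using Lp_norm_nonneg[of 2 M "comb b K"] by (auto simp: power2_eq_square mult_le_cancel_left)
  then have "?g \<le> ?f" using Lp_norm_nonneg[of 2 M f] by auto
  then have "?g\<^sup>2 \<le> ?f\<^sup>2" using Lp_norm_nonneg by (intro power_mono) auto
  then show ?thesis using norm_comb[OF assms(2)] by (simp add: b_def)
qed

lemma Bessel_summable:
  assumes "f \<in> Lp 2 M"
  shows "(\<lambda>k. (norm (L2_inner M f (e k)))\<^sup>2) summable_on UNIV"
  using Bessel[OF assms]
  by (intro nonneg_bdd_above_summable_on bdd_aboveI[of _ "(Lp_norm 2 M f)\<^sup>2"]) auto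

text \<open>Bessel for both factors and xy \<le> x^2 + y^2. This is what makes the tests built from
  an operator admissible.\<close>

lemma coefficients_summable:
  assumes "f \<in> Lp 2 M" "g \<in> Lp 2 M"
  shows "(\<lambda>k. norm (L2_inner M f (e k) * L2_inner M (e k) g)) summable_on UNIV"
proof (rule Infinite_Sum.abs_summable_on_comparison_test')
  show "(\<lambda>k. (norm (L2_inner M f (e k)))\<^sup>2 + (norm (L2_inner M g (e k)))\<^sup>2) summable_on UNIV"
    using assms by (intro summable_on_add Bessel_summable)
  show "norm (L2_inner M f (e k) * L2_inner M (e k) g) \<le> (norm (L2_inner M f (e k)))\<^sup>2 + (norm (L2_inner M g (e k)))\<^sup>2" for k
  proof -
    have "x * y \<le> x\<^sup>2 + y\<^sup>2" if "0 \<le> x" "0 \<le> y" for x y :: real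
      using sum_squares_bound[of x y] mult_nonneg_nonneg[OF that] by linarith
    then show ?thesis using L2_inner_commute[of M "e k" g] by (simp add: norm_mult)
  qed
qed

lemma comb_diff:
  assumes "finite A" "finite B"
  shows "comb b A x - comb b B x = comb (\<lambda>k. if k \<in> A then b k else - b k) ((A - B) \<union> (B - A)) x"
proof -
  have "comb b A x = (\<Sum>k\<in>A - B. b k * e k x) + (\<Sum>k\<in>A \<inter> B. b k * e k x)"
    unfolding comb_def using assms by (metis Int_Diff_Un Int_Diff_disjoint add.commute finite_Diff finite_Int sum.union_disjoint)
  moreover have "comb b B x = (\<Sum>k\<in>B - A. b k * e k x) + (\<Sum>k\<in>A \<inter> B. b k * e k x)"
    unfolding comb_def using assms by (metis Int_commute Int_Diff_Un Int_Diff_disjoint add.commute finite_Diff finite_Int sum.union_disjoint)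
  moreover have "comb (\<lambda>k. if k \<in> A then b k else - b k) ((A - B) \<union> (B - A)) x =
      (\<Sum>k\<in>A - B. b k * e k x) + (\<Sum>k\<in>B - A. - (b k * e k x))"
    unfolding comb_def using assms by (subst sum.union_disjoint) (auto intro!: arg_cong2[of _ _ _ _ "(+)"] sum.cong)
  ultimately show ?thesis by (simp add: sum_negf)
qed

lemma norm_comb_diff:
  assumes "finite A" "finite B"
  shows "(\<integral>\<^sup>+x. ennreal ((norm (comb b A x - comb b B x))\<^sup>2) \<partial>M) =
    ennreal (\<Sum>k\<in>(A - B) \<union> (B - A). (norm (b k))\<^sup>2)"
proof -
  let ?c = "\<lambda>k. if k \<in> A then b k else - b k" and ?D = "(A - B) \<union> (B - A)"
  have "(\<integral>\<^sup>+x. ennreal ((norm (comb ?c ?D x))\<^sup>2) \<partial>M) = ennreal (LINT x|M. (norm (comb ?c ?D x))\<^sup>2)"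
    using comb_Lp2[of ?c ?D] by (intro nn_integral_eq_integral) (auto simp: Lp2_iff)
  also have "\<dots> = ennreal (\<Sum>k\<in>?D. (norm (?c k))\<^sup>2)"
    using norm_comb[of ?D ?c] assms by (simp add: Lp2_norm_power2)
  also have "(\<Sum>k\<in>?D. (norm (?c k))\<^sup>2) = (\<Sum>k\<in>?D. (norm (b k))\<^sup>2)"
    by (intro sum.cong) auto
  finally show ?thesis unfolding comb_diff[OF assms] .
qed

text \<open>Nested finite sets \<open>K n\<close> with tails at most (1/4)^n give partial sums that
  converge almost everywhere, and Fatou's lemma turns the pointwise limit into an
  \<open>L\<^sup>2\<close> limit along all finite sets.\<close>

theorem Riesz_Fischer:
  assumes b: "(\<lambda>k. (norm (b k))\<^sup>2) summable_on UNIV"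
  shows "\<exists>g. g \<in> Lp 2 M \<and> ((\<lambda>K. Lp_norm 2 M (\<lambda>x. g x - comb b K x)) \<longlongrightarrow> 0) (finite_subsets_at_top UNIV)"
proof -
  let ?b = "\<lambda>k. (norm (b k))\<^sup>2"
  have tail: "\<exists>K\<^sub>0. finite K\<^sub>0 \<and> (\<forall>K. finite K \<and> K \<inter> K\<^sub>0 = {} \<longrightarrow> sum ?b K \<le> \<epsilon>)" if "0 < \<epsilon>" for \<epsilon>
  proof -
    have "(sum ?b \<longlongrightarrow> infsum ?b UNIV) (finite_subsets_at_top UNIV)"
      using b infsum_tendsto by blast
    then have "eventually (\<lambda>K. infsum ?b UNIV - \<epsilon> < sum ?b K) (finite_subsets_at_top UNIV)"
      using that by (intro order_tendstoD(1)) auto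
    then obtain K\<^sub>0 where K\<^sub>0: "finite K\<^sub>0" "infsum ?b UNIV - \<epsilon> < sum ?b K\<^sub>0"
      by (auto simp: eventually_finite_subsets_at_top)
    have "sum ?b K \<le> \<epsilon>" if "finite K" "K \<inter> K\<^sub>0 = {}" for K
    proof -
      have "sum ?b K + sum ?b K\<^sub>0 = sum ?b (K \<union> K\<^sub>0)"
        using that K\<^sub>0 by (simp add: sum.union_disjoint)
      also have "\<dots> \<le> infsum ?b UNIV" by (rule finite_sum_le_infsum[OF b]) (use that K\<^sub>0 in auto)
      finally show ?thesis using K\<^sub>0 by simp
    qed
    then show ?thesis using K\<^sub>0 by blast
  qed
  have "\<forall>n::nat. \<exists>K\<^sub>0. finite K\<^sub>0 \<and> (\<forall>K. finite K \<and> K \<inter> K\<^sub>0 = {} \<longrightarrow> sum ?b K \<le> (1/4)^n)"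
    by (intro allI tail) auto
  then obtain K\<^sub>0 where K\<^sub>0: "\<And>n. finite (K\<^sub>0 n)"
    "\<And>n K. finite K \<Longrightarrow> K \<inter> K\<^sub>0 n = {} \<Longrightarrow> sum ?b K \<le> (1/4)^n" by metis
  define K where "K n = (\<Union>i\<le>n. K\<^sub>0 i)" for n
  have finK: "finite (K n)" for n using K\<^sub>0(1) by (auto simp: K_def)
  have Kmono: "K n \<subseteq> K m" if "n \<le> m" for n m unfolding K_def using that by (intro UN_mono) auto
  have Ktail: "sum ?b A \<le> (1/4)^n" if "finite A" "A \<inter> K n = {}" for A n
    using that by (intro K\<^sub>0(2)) (auto simp: K_def)
  define s where "s n = comb b (K n)" for n
  have [measurable]: "s n \<in> borel_measurable M" "comb b A \<in> borel_measurable M" for n A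
    using comb_Lp2 LpD(1) unfolding s_def by blast+
  have sdiff: "(\<integral>\<^sup>+x. ennreal ((norm (s m x - comb b A x))\<^sup>2) \<partial>M) \<le> ennreal ((1/4)^n)"
    if "finite A" "K n \<subseteq> A" "n \<le> m" for m n A
    unfolding s_def norm_comb_diff[OF finK that(1)]
    by (intro ennreal_leI Ktail) (use finK that Kmono[OF that(3)] in auto)
  \<comment> \<open>The weight 2^n still leaves integrals of size (1/2)^n. Pointwise, finiteness of
    the weighted series of squares yields absolute convergence of the increments, because t \<le> u
    + t^2/u with u = (1/2)^n.\<close>
  have "(\<integral>\<^sup>+x. (\<Sum>n. ennreal (2^n * (norm (s (Suc n) x - s n x))\<^sup>2)) \<partial>M) =
      (\<Sum>n. \<integral>\<^sup>+x. ennreal (2^n * (norm (s (Suc n) x - s n x))\<^sup>2) \<partial>M)"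
    by (intro nn_integral_suminf) measurable
  also have "\<dots> \<le> (\<Sum>n. ennreal ((1/2)^n))"
  proof (rule suminf_le)
    show "(\<integral>\<^sup>+x. ennreal (2^n * (norm (s (Suc n) x - s n x))\<^sup>2) \<partial>M) \<le> ennreal ((1/2)^n)" for n
    proof -
      have "(\<integral>\<^sup>+x. ennreal (2^n * (norm (s (Suc n) x - s n x))\<^sup>2) \<partial>M) =
          ennreal (2^n) * (\<integral>\<^sup>+x. ennreal ((norm (s (Suc n) x - s n x))\<^sup>2) \<partial>M)"
        by (simp add: ennreal_mult nn_integral_cmult)
      also have "\<dots> \<le> ennreal (2^n) * ennreal ((1/4)^n)"
        using sdiff[of "K n" n "Suc n"] finK by (intro mult_left_mono) (auto simp: s_def)
      also have "\<dots> = ennreal ((1/2)^n)"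
        by (simp add: ennreal_mult[symmetric] power_mult_distrib[symmetric])
      finally show ?thesis .
    qed
  qed auto
  also have "\<dots> < \<infinity>"
    by (subst suminf_ennreal2) (auto intro: summable_geometric)
  finally have "AE x in M. (\<Sum>n. ennreal (2^n * (norm (s (Suc n) x - s n x))\<^sup>2)) \<noteq> \<infinity>"
    by (intro nn_integral_PInf_AE) auto
  then have conv: "AE x in M. convergent (\<lambda>n. s n x)"
  proof (rule AE_mp, intro AE_I2 impI)
    fix x assume x: "(\<Sum>n. ennreal (2^n * (norm (s (Suc n) x - s n x))\<^sup>2)) \<noteq> \<infinity>"
    let ?d = "\<lambda>n. s (Suc n) x - s n x"
    have "summable (\<lambda>n. 2^n * (norm (?d n))\<^sup>2)"
      using x by (intro summable_suminf_not_top) auto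
    then have "summable (\<lambda>n. (1/2)^n + 2^n * (norm (?d n))\<^sup>2)"
      by (intro summable_add summable_geometric) auto
    moreover have "norm (?d n) \<le> (1/2)^n + 2^n * (norm (?d n))\<^sup>2" for n
    proof -
      have ut: "(1/2)^n * 2^n = (1::real)" by (simp add: power_mult_distrib[symmetric])
      show ?thesis
      proof (cases "norm (?d n) \<le> (1/2)^n")
        case True
        then show ?thesis by (simp add: add_increasing2)
      next
        case False
        then have "2^n * ((1/2)^n * norm (?d n)) \<le> 2^n * (norm (?d n) * norm (?d n))"
          by (intro mult_left_mono mult_right_mono) auto
        moreover have "2^n * ((1/2)^n * norm (?d n)) = norm (?d n)"
          using ut by (metis mult.assoc mult.commute mult_1)
        ultimately show ?thesis by (simp add: power2_eq_square add_increasing)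
      qed
    qed
    ultimately have "summable ?d" by (rule summable_comparison_test'[where N = 0])
    then have "(\<lambda>n. \<Sum>i<n. ?d i) \<longlonglongrightarrow> suminf ?d" by (rule summable_LIMSEQ)
    then have "(\<lambda>n. s n x - s 0 x) \<longlonglongrightarrow> suminf ?d" 
      unfolding sum_lessThan_telescope[of "\<lambda>n. s n x"] .
    then have "(\<lambda>n. (s n x - s 0 x) + s 0 x) \<longlonglongrightarrow> suminf ?d + s 0 x" by (intro tendsto_intros)
    then show "convergent (\<lambda>n. s n x)" by (auto simp: convergent_def)
  qed
  define g where "g x = lim (\<lambda>n. s n x)" for x
  have [measurable]: "g \<in> borel_measurable M" unfolding g_def[abs_def] by measurable
  have g: "AE x in M. (\<lambda>n. s n x) \<longlonglongrightarrow> g x"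
    using conv by (simp add: g_def convergent_LIMSEQ_iff)
  \<comment> \<open>Fatou: for m \<ge> n the distance from \<open>s m\<close> to the partial sum
    over \<open>A\<close> is already controlled by the tail beyond \<open>K n\<close>.\<close>
  have le: "(\<integral>\<^sup>+x. ennreal ((norm (g x - comb b A x))\<^sup>2) \<partial>M) \<le> ennreal ((1/4)^n)"
    if A: "finite A" "K n \<subseteq> A" for n A
  proof -
    have "(\<integral>\<^sup>+x. ennreal ((norm (g x - comb b A x))\<^sup>2) \<partial>M) =
        (\<integral>\<^sup>+x. liminf (\<lambda>m. ennreal ((norm (s m x - comb b A x))\<^sup>2)) \<partial>M)"
    proof (rule nn_integral_cong_AE, rule AE_mp[OF g], intro AE_I2 impI)
      fix x assume "(\<lambda>n. s n x) \<longlonglongrightarrow> g x"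
      then have "(\<lambda>m. ennreal ((norm (s m x - comb b A x))\<^sup>2)) \<longlonglongrightarrow> ennreal ((norm (g x - comb b A x))\<^sup>2)"
        by (intro tendsto_intros)
      then show "ennreal ((norm (g x - comb b A x))\<^sup>2) = liminf (\<lambda>m. ennreal ((norm (s m x - comb b A x))\<^sup>2))"
        by (intro lim_imp_Liminf[symmetric]) auto
    qed
    also have "\<dots> \<le> liminf (\<lambda>m. \<integral>\<^sup>+x. ennreal ((norm (s m x - comb b A x))\<^sup>2) \<partial>M)"
      by (intro nn_integral_liminf) measurable
    also have "\<dots> \<le> liminf (\<lambda>m::nat. ennreal ((1/4)^n))"
      by (intro Liminf_mono) (auto simp: eventually_sequentially intro!: exI[of _ n] sdiff[OF A])
    also have "\<dots> = ennreal ((1/4)^n)" by (intro lim_imp_Liminf) auto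
    finally show ?thesis .
  qed
  have L: "(\<lambda>x. g x - comb b A x) \<in> Lp 2 M" "(Lp_norm 2 M (\<lambda>x. g x - comb b A x))\<^sup>2 \<le> (1/4)^n"
    if "finite A" "K n \<subseteq> A" for n A
    by (rule Lp2_nn_integral_le[OF _ le[OF that]]; simp)+
  have "(\<lambda>x. (g x - comb b (K 0) x) + comb b (K 0) x) \<in> Lp 2 M"
    by (intro Lp_add(1) L(1) comb_Lp2) (use finK in auto)
  then have "g \<in> Lp 2 M" by simp
  moreover have "((\<lambda>A. Lp_norm 2 M (\<lambda>x. g x - comb b A x)) \<longlongrightarrow> 0) (finite_subsets_at_top UNIV)"
  proof (rule tendstoI)
    fix \<epsilon> :: real assume "0 < \<epsilon>"
    then obtain n where n: "(1/2)^n < \<epsilon>" using real_arch_pow_inv[of \<epsilon> "1/2"] by auto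
    show "eventually (\<lambda>A. dist (Lp_norm 2 M (\<lambda>x. g x - comb b A x)) 0 < \<epsilon>) (finite_subsets_at_top UNIV)"
      unfolding eventually_finite_subsets_at_top
    proof (intro exI[of _ "K n"] conjI allI impI)
      fix A :: "'k set" assume "finite A \<and> K n \<subseteq> A \<and> A \<subseteq> UNIV"
      then have "(Lp_norm 2 M (\<lambda>x. g x - comb b A x))\<^sup>2 \<le> ((1/2)^n)\<^sup>2"
        using L(2)[of A n] by (simp add: power2_eq_square power_mult_distrib[symmetric])
      then have "Lp_norm 2 M (\<lambda>x. g x - comb b A x) \<le> (1/2)^n" by (rule power2_le_imp_le) simp
      then show "dist (Lp_norm 2 M (\<lambda>x. g x - comb b A x)) 0 < \<epsilon>"
        using n Lp_norm_nonneg[of 2 M "\<lambda>x. g x - comb b A x"] by simp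
    qed (use finK in auto)
  qed
  ultimately show ?thesis by blast
qed

section \<open>Multipliers and their weak form\<close>

lemma multiplier_limit:
  assumes f: "f \<in> Lp 2 M" and c: "\<And>k. norm (c k) \<le> B"
  shows multiplier_Lp2: "multiplier M e c f \<in> Lp 2 M"
    and "((\<lambda>K. Lp_norm 2 M (\<lambda>x. multiplier M e c f x - comb (\<lambda>k. c k * L2_inner M f (e k)) K x)) \<longlongrightarrow> 0)
      (finite_subsets_at_top UNIV)"
proof -
  have "(\<lambda>k. norm ((norm (c k * L2_inner M f (e k)))\<^sup>2)) summable_on UNIV"
  proof (rule Infinite_Sum.abs_summable_on_comparison_test')
    show "(\<lambda>k. B\<^sup>2 * (norm (L2_inner M f (e k)))\<^sup>2) summable_on UNIV"
      by (intro summable_on_cmult_right Bessel_summable f)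
    show "norm ((norm (c k * L2_inner M f (e k)))\<^sup>2) \<le> B\<^sup>2 * (norm (L2_inner M f (e k)))\<^sup>2" for k
      using c[of k] by (auto simp: norm_mult power_mult_distrib intro!: mult_right_mono power_mono)
  qed
  then have "(\<lambda>k. (norm (c k * L2_inner M f (e k)))\<^sup>2) summable_on UNIV" by simp
  from someI_ex[OF Riesz_Fischer[OF this]]
  show "multiplier M e c f \<in> Lp 2 M"
    and "((\<lambda>K. Lp_norm 2 M (\<lambda>x. multiplier M e c f x - comb (\<lambda>k. c k * L2_inner M f (e k)) K x)) \<longlongrightarrow> 0)
      (finite_subsets_at_top UNIV)"
    by (simp_all add: multiplier_def comb_def)
qed

text \<open>Later arguments see a multiplier only through such inner products, on which the choice
  of representative has no influence.\<close>

lemma multiplier_inner: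
  assumes f: "f \<in> Lp 2 M" and c: "\<And>k. norm (c k) \<le> B" and h: "h \<in> Lp 2 M"
  shows "((\<lambda>k. c k * (L2_inner M f (e k) * L2_inner M (e k) h)) has_sum L2_inner M (multiplier M e c f) h) UNIV"
proof -
  define b where "b k = c k * L2_inner M f (e k)" for k
  let ?g = "multiplier M e c f"
  have g: "?g \<in> Lp 2 M" "((\<lambda>K. Lp_norm 2 M (\<lambda>x. ?g x - comb b K x)) \<longlongrightarrow> 0) (finite_subsets_at_top UNIV)"
    using multiplier_limit[OF f c] by (simp_all add: b_def[abs_def])
  have "((\<lambda>k. b k * L2_inner M (e k) h) has_sum L2_inner M ?g h) UNIV"
    unfolding has_sum_def
  proof (rule Lim_transform2[of "\<lambda>_. L2_inner M ?g h"])
    show "((\<lambda>_. L2_inner M ?g h) \<longlongrightarrow> L2_inner M ?g h) (finite_subsets_at_top UNIV)" by simp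
    show "((\<lambda>K. L2_inner M ?g h - (\<Sum>k\<in>K. b k * L2_inner M (e k) h)) \<longlongrightarrow> 0) (finite_subsets_at_top UNIV)"
    proof (rule Lim_null_comparison)
      have "L2_inner M ?g h - (\<Sum>k\<in>K. b k * L2_inner M (e k) h) = L2_inner M (\<lambda>x. ?g x - comb b K x) h" for K
        by (subst L2_inner_diff_left[OF g(1) comb_Lp2 h]) (simp add: inner_comb_left[OF h])
      moreover have "norm (L2_inner M (\<lambda>x. ?g x - comb b K x) h) \<le> Lp_norm 2 M (\<lambda>x. ?g x - comb b K x) * Lp_norm 2 M h" for K
        by (intro Cauchy_Schwarz_L2(2) Lp_diff g(1) comb_Lp2 h) simp
      ultimately show "eventually (\<lambda>K. norm (L2_inner M ?g h - (\<Sum>k\<in>K. b k * L2_inner M (e k) h))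
          \<le> Lp_norm 2 M (\<lambda>x. ?g x - comb b K x) * Lp_norm 2 M h) (finite_subsets_at_top UNIV)"
        by simp
      show "((\<lambda>K. Lp_norm 2 M (\<lambda>x. ?g x - comb b K x) * Lp_norm 2 M h) \<longlongrightarrow> 0) (finite_subsets_at_top UNIV)"
        using tendsto_mult_left_zero[OF g(2)] by simp
    qed
  qed
  then show ?thesis by (simp add: b_def mult.assoc)
qed

lemma multiplier_coefficient:
  assumes f: "f \<in> Lp 2 M" and c: "\<And>k. norm (c k) \<le> B"
  shows "L2_inner M (multiplier M e c f) (e j) = c j * L2_inner M f (e j)"
proof -
  have "((\<lambda>k. c k * (L2_inner M f (e k) * L2_inner M (e k) (e j))) has_sum c j * L2_inner M f (e j)) UNIV
     \<longleftrightarrow> ((\<lambda>k. c k * L2_inner M f (e k)) has_sum c j * L2_inner M f (e j)) {j}"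
    by (rule has_sum_cong_neutral) (auto simp: e_inner)
  then have "((\<lambda>k. c k * (L2_inner M f (e k) * L2_inner M (e k) (e j))) has_sum c j * L2_inner M f (e j)) UNIV"
    by (simp add: has_sum_finiteI)
  from has_sum_unique[OF multiplier_inner[OF f c e_Lp2] this] show ?thesis .
qed

end

section \<open>Duality, operator norms and tensor products\<close>

lemma Lp_nn_integral_le:
  assumes "f \<in> borel_measurable M" "(\<integral>\<^sup>+x. ennreal (norm (f x) powr p) \<partial>M) \<le> ennreal (K powr p)" "0 \<le> K" "0 < p"
  shows "f \<in> Lp p M" "Lp_norm p M f \<le> K"
proof -
  note [measurable] = assms(1)
  have "(\<integral>\<^sup>+x. ennreal (norm (f x) powr p) \<partial>M) < \<infinity>"
    using assms(2) by (rule le_less_trans) simp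
  then have i: "integrable M (\<lambda>x. norm (f x) powr p)"
    by (intro integrableI_bounded) auto
  then show "f \<in> Lp p M" using assms(1) by (simp add: Lp_def)
  have "ennreal (LINT x|M. norm (f x) powr p) \<le> ennreal (K powr p)"
    using assms(2) nn_integral_eq_integral[OF i] by simp
  then have "Lp_norm p M f powr p \<le> K powr p"
    unfolding Lp_norm_powr[OF assms(4)] by simp
  then show "Lp_norm p M f \<le> K" using powr_le_cancel2 assms by blast
qed

text \<open>Test \<open>h\<close> against the extremal function of Holder's inequality,
  \<open>h\<close> times its modulus to the power p - 2, cut off to a set \<open>E n\<close> where
  it is a legitimate test function. Fatou's lemma removes the cut-off.\<close>

lemma Lp_bounded_by_duality:
  assumes pq: "1 < p" "1 < q" "1 / p + 1 / q = 1" and h: "h \<in> Lp 2 M" and "0 \<le> K"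
    and dual: "\<And>g. g \<in> Lp 2 M \<inter> Lp q M \<Longrightarrow> norm (L2_inner M h g) \<le> K * Lp_norm q M g"
  shows "h \<in> Lp p M" "Lp_norm p M h \<le> K"
proof -
  note [measurable] = LpD(1)[OF h]
  have h2: "integrable M (\<lambda>x. (norm (h x))\<^sup>2)" using h by (simp add: Lp2_iff)
  have pq': "(p - 1) * q = p" using pq by (simp add: field_simps)
  \<comment> \<open>On \<open>E n\<close> the upper bound on \<open>norm (h x)\<close> controls all
    its powers, and the lower bound gives \<open>1 \<le> ((n + 1) * norm (h x))\<^sup>2\<close>.
    Hence every nonnegative power is dominated by a multiple of the integrable square.\<close>
  define E where "E n = {x \<in> space M. 1 / (real n + 1) \<le> norm (h x) \<and> norm (h x) \<le> real n}" for n :: nat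
  have E [measurable]: "E n \<in> sets M" for n unfolding E_def by measurable
  have int: "integrable M (\<lambda>x. indicator (E n) x * norm (h x) powr a)" if "0 \<le> a" for a n
  proof (rule Bochner_Integration.integrable_bound)
    show "integrable M (\<lambda>x. (real n powr a * (real n + 1)\<^sup>2) * (norm (h x))\<^sup>2)"
      by (intro integrable_mult_right h2)
    show "AE x in M. norm (indicator (E n) x * norm (h x) powr a) \<le> norm ((real n powr a * (real n + 1)\<^sup>2) * (norm (h x))\<^sup>2)"
    proof (intro always_eventually allI)
      fix x
      show "norm (indicator (E n) x * norm (h x) powr a) \<le> norm ((real n powr a * (real n + 1)\<^sup>2) * (norm (h x))\<^sup>2)"
      proof (cases "x \<in> E n")
        case True
        then have x: "1 \<le> (real n + 1) * norm (h x)" "norm (h x) \<le> real n"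
          by (auto simp: E_def field_simps)
        have "norm (h x) powr a * 1 \<le> real n powr a * ((real n + 1) * norm (h x))\<^sup>2"
          using x that by (intro mult_mono powr_mono2 one_le_power) auto
        then show ?thesis using True by (simp add: power_mult_distrib mult.assoc)
      qed simp
    qed
  qed measurable
  have I: "(\<integral>\<^sup>+x. ennreal (indicator (E n) x * norm (h x) powr p) \<partial>M) \<le> ennreal (K powr p)" for n
  proof -
    define I where "I = (LINT x|M. indicator (E n) x * norm (h x) powr p)"
    define g where "g x = complex_of_real (indicator (E n) x * norm (h x) powr (p - 2)) * h x" for x
    have [measurable]: "g \<in> borel_measurable M" unfolding g_def[abs_def] by measurable
    have ng: "norm (g x) = indicator (E n) x * norm (h x) powr (p - 1)" for x
    proof (cases "x \<in> E n")
      case True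
      then have "0 < norm (h x)" by (auto simp: E_def intro: less_le_trans[rotated])
      then have "norm (h x) powr (p - 2) * norm (h x) = norm (h x) powr (p - 1)"
        using powr_add[of "norm (h x)" "p - 2" 1] by simp
      then show ?thesis using True by (simp add: g_def norm_mult)
    qed (simp add: g_def)
    have ngr: "norm (g x) powr r = indicator (E n) x * norm (h x) powr ((p - 1) * r)" if "0 < r" for x r
      unfolding ng using that by (auto simp: indicator_def powr_powr)
    have g: "g \<in> Lp r M" if "0 < r" for r
      unfolding Lp_def using that pq by (simp add: ngr int)
    have gq: "Lp_norm q M g = I powr (1 / q)"
      unfolding Lp_norm_def I_def using pq pq' by (simp add: ngr)
    have "h x * cnj (g x) = complex_of_real (indicator (E n) x * norm (h x) powr p)" for x
    proof (cases "x \<in> E n")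
      case True
      then have "0 < norm (h x)" by (auto simp: E_def intro: less_le_trans[rotated])
      then have *: "norm (h x) powr p = norm (h x) powr (p - 2) * (norm (h x))\<^sup>2"
        using powr_add[of "norm (h x)" "p - 2" 2] by (simp add: powr_numeral)
      have "h x * cnj (g x) = complex_of_real (norm (h x) powr (p - 2)) * (h x * cnj (h x))"
        using True by (simp add: g_def)
      also have "\<dots> = complex_of_real (norm (h x) powr p)"
        unfolding * complex_norm_square[symmetric] by simp
      finally show ?thesis using True by simp
    qed (simp add: g_def)
    then have "L2_inner M h g = complex_of_real I"
      by (simp only: L2_inner_def I_def integral_complex_of_real)
    moreover have "0 \<le> I" unfolding I_def by (intro integral_nonneg_AE) simp
    \<comment> \<open>The cut-off makes \<open>I\<close> a finite number, so unless it is 0 the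
      power \<open>I powr (1 / q)\<close> can be divided out, leaving
      \<open>I powr (1 / p) \<le> K\<close>.\<close>
    ultimately have le: "I \<le> K * I powr (1 / q)"
      using dual[of g] g pq gq by simp
    have "I \<le> K powr p"
    proof (cases "I = 0")
      case False
      then have I0: "0 < I" using \<open>0 \<le> I\<close> by simp
      have "I powr (1 / p) * I powr (1 / q) = I" using I0 pq(3) by (simp add: powr_add[symmetric])
      then have "I powr (1 / p) * I powr (1 / q) \<le> K * I powr (1 / q)" using le by simp
      then have "I powr (1 / p) \<le> K" using I0 by (simp add: mult_le_cancel_right)
      then have "(I powr (1 / p)) powr p \<le> K powr p" using pq by (intro powr_mono2) auto
      then show ?thesis using I0 pq by (simp add: powr_powr)
    qed simp
    moreover have "(\<integral>\<^sup>+x. ennreal (indicator (E n) x * norm (h x) powr p) \<partial>M) = ennreal I"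
      unfolding I_def using pq by (intro nn_integral_eq_integral int) auto
    ultimately show ?thesis by (simp add: ennreal_leI)
  qed
  have "(\<integral>\<^sup>+x. ennreal (norm (h x) powr p) \<partial>M) =
      (\<integral>\<^sup>+x. liminf (\<lambda>n. ennreal (indicator (E n) x * norm (h x) powr p)) \<partial>M)"
  proof (rule nn_integral_cong)
    fix x assume x: "x \<in> space M"
    have "eventually (\<lambda>n. ennreal (indicator (E n) x * norm (h x) powr p) = ennreal (norm (h x) powr p)) sequentially"
    proof (cases "h x = 0")
      case False
      have "eventually (\<lambda>n. 1 / norm (h x) \<le> real n) sequentially" "eventually (\<lambda>n. norm (h x) \<le> real n) sequentially"
        using filterlim_real_sequentially unfolding filterlim_at_top by blast+
      then show ?thesis
      proof eventually_elim
        case (elim n)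
        then have "1 / (real n + 1) \<le> norm (h x)" using False by (simp add: field_simps add_increasing)
        then have "x \<in> E n" using elim x by (simp add: E_def)
        then show ?case by simp
      qed
    qed simp
    then have "(\<lambda>n. ennreal (indicator (E n) x * norm (h x) powr p)) \<longlonglongrightarrow> ennreal (norm (h x) powr p)"
      by (rule tendsto_eventually)
    then show "ennreal (norm (h x) powr p) = liminf (\<lambda>n. ennreal (indicator (E n) x * norm (h x) powr p))"
      by (intro lim_imp_Liminf[symmetric]) auto
  qed
  also have "\<dots> \<le> liminf (\<lambda>n. \<integral>\<^sup>+x. ennreal (indicator (E n) x * norm (h x) powr p) \<partial>M)"
    by (intro nn_integral_liminf) measurable
  also have "\<dots> \<le> liminf (\<lambda>n::nat. ennreal (K powr p))"
    by (intro Liminf_mono always_eventually allI I)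
  also have "\<dots> = ennreal (K powr p)" by (intro lim_imp_Liminf) auto
  finally show "h \<in> Lp p M" "Lp_norm p M h \<le> K"
    using Lp_nn_integral_le[OF LpD(1)[OF h]] assms(5) pq(1) by auto
qed

lemma Lp_opnorm_leI:
  assumes "0 \<le> C" "\<And>f. f \<in> Lp 2 M \<inter> Lp p M \<Longrightarrow> T f \<in> Lp p M \<and> Lp_norm p M (T f) \<le> C * Lp_norm p M f"
  shows "Lp_opnorm p M T \<le> ennreal C"
  unfolding Lp_opnorm_def by (rule INF_lower) (use assms in blast)

text \<open>The infimum is attained: each \<open>C + \<epsilon>\<close> exceeds an admissible
  constant, and \<epsilon> is then scaled by the norm of \<open>f\<close> plus 1.\<close>

lemma Lp_opnorm_leD:
  assumes "Lp_opnorm p M T \<le> ennreal C" "0 \<le> C" "f \<in> Lp 2 M \<inter> Lp p M"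
  shows "T f \<in> Lp p M" "Lp_norm p M (T f) \<le> C * Lp_norm p M f"
proof -
  have *: "T f \<in> Lp p M \<and> Lp_norm p M (T f) \<le> (C + \<epsilon>) * Lp_norm p M f" if "0 < \<epsilon>" for \<epsilon>
  proof -
    have "Lp_opnorm p M T < ennreal (C + \<epsilon>)"
      using assms(1,2) that by (auto intro: le_less_trans simp: ennreal_lessI)
    then obtain C' where C': "0 \<le> C'" "T f \<in> Lp p M" "Lp_norm p M (T f) \<le> C' * Lp_norm p M f" "ennreal C' < ennreal (C + \<epsilon>)"
      using assms(3) unfolding Lp_opnorm_def INF_less_iff by auto
    then have "C' * Lp_norm p M f \<le> (C + \<epsilon>) * Lp_norm p M f"
      by (intro mult_right_mono) (auto simp: ennreal_less_iff Lp_norm_nonneg)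
    then show ?thesis using C' by linarith
  qed
  show "T f \<in> Lp p M" using *[of 1] by simp
  show "Lp_norm p M (T f) \<le> C * Lp_norm p M f"
  proof (rule field_le_epsilon)
    fix e :: real assume "0 < e"
    have n: "0 \<le> Lp_norm p M f" by (rule Lp_norm_nonneg)
    then have "Lp_norm p M (T f) \<le> (C + e / (Lp_norm p M f + 1)) * Lp_norm p M f"
      using \<open>0 < e\<close> by (intro *[THEN conjunct2]) auto
    also have "\<dots> = C * Lp_norm p M f + e * (Lp_norm p M f / (Lp_norm p M f + 1))"
      by (simp add: distrib_right)
    also have "\<dots> \<le> C * Lp_norm p M f + e * 1"
      using n \<open>0 < e\<close> by (intro add_left_mono mult_left_mono) (auto simp: divide_le_eq)
    finally show "Lp_norm p M (T f) \<le> C * Lp_norm p M f + e" by simp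
  qed
qed

section \<open>Tensor products of functions\<close>

definition tensor_fun :: "('d::finite \<Rightarrow> 'a \<Rightarrow> complex) \<Rightarrow> ('d \<Rightarrow> 'a) \<Rightarrow> complex" where
  "tensor_fun f x = (\<Prod>r\<in>UNIV. f r (x r))"

lemma tensor_eq_tensor_fun: "tensor e k = tensor_fun (\<lambda>r. e r (k r))"
  by (simp add: tensor_def tensor_fun_def fun_eq_iff)

context
  fixes M :: "'d::finite \<Rightarrow> 'a measure"
  assumes sf: "\<And>r. sigma_finite_measure (M r)"
begin

interpretation product_sigma_finite M
  by (simp add: product_sigma_finite_def sf)

lemma tensor_fun_measurable [measurable]:
  assumes "\<And>r. f r \<in> borel_measurable (M r)"
  shows "tensor_fun f \<in> borel_measurable (PiM UNIV M)"
proof -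
  note [measurable] = assms
  show ?thesis unfolding tensor_fun_def[abs_def] by measurable
qed

lemma norm_tensor_fun_powr: "norm (tensor_fun f x) powr q = (\<Prod>r\<in>UNIV. norm (f r (x r)) powr q)"
  unfolding tensor_fun_def prod_norm[symmetric] by (rule prod_powr_distrib)

lemma tensor_fun_Lp:
  assumes "\<And>r. f r \<in> Lp q (M r)"
  shows "tensor_fun f \<in> Lp q (PiM UNIV M)"
    and "Lp_norm q (PiM UNIV M) (tensor_fun f) = (\<Prod>r\<in>UNIV. Lp_norm q (M r) (f r))"
proof -
  note f = LpD[OF assms]
  have "integrable (PiM UNIV M) (\<lambda>x. \<Prod>r\<in>UNIV. norm (f r (x r)) powr q)"
    by (intro product_integrable_prod f) auto
  then show "tensor_fun f \<in> Lp q (PiM UNIV M)"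
    using tensor_fun_measurable f(1) by (simp add: Lp_def norm_tensor_fun_powr)
  have "(LINT x|PiM UNIV M. (\<Prod>r\<in>UNIV. norm (f r (x r)) powr q)) = (\<Prod>r\<in>UNIV. (LINT x|M r. norm (f r x) powr q))"
    by (intro product_integral_prod f) auto
  then show "Lp_norm q (PiM UNIV M) (tensor_fun f) = (\<Prod>r\<in>UNIV. Lp_norm q (M r) (f r))"
    unfolding Lp_norm_def norm_tensor_fun_powr
    by (simp add: prod_powr_distrib integral_nonneg_AE)
qed

lemma tensor_fun_inner:
  assumes "\<And>r. f r \<in> Lp 2 (M r)" "\<And>r. g r \<in> Lp 2 (M r)"
  shows "L2_inner (PiM UNIV M) (tensor_fun f) (tensor_fun g) = (\<Prod>r\<in>UNIV. L2_inner (M r) (f r) (g r))"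
proof -
  have "(LINT x|PiM UNIV M. (\<Prod>r\<in>UNIV. f r (x r) * cnj (g r (x r)))) = (\<Prod>r\<in>UNIV. (LINT x|M r. f r x * cnj (g r x)))"
    by (intro product_integral_prod Cauchy_Schwarz_L2(1) assms) auto
  then show ?thesis by (simp add: L2_inner_def tensor_fun_def prod.distrib)
qed

lemma orthonormal_system_tensor:
  assumes "\<And>r. orthonormal_system (M r) (e r)"
  shows "orthonormal_system (PiM UNIV M) (tensor e)"
proof
  fix j k :: "'d \<Rightarrow> nat"
  have e: "e r i \<in> Lp 2 (M r)" "L2_inner (M r) (e r i) (e r l) = (if i = l then 1 else 0)" for r i l
    using orthonormal_system.e_Lp2[OF assms] orthonormal_system.e_inner[OF assms] by auto
  show "tensor e k \<in> Lp 2 (PiM UNIV M)"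
    unfolding tensor_eq_tensor_fun by (intro tensor_fun_Lp e)
  have "L2_inner (PiM UNIV M) (tensor e j) (tensor e k) = (\<Prod>r\<in>UNIV. if j r = k r then 1 else 0)"
    unfolding tensor_eq_tensor_fun by (subst tensor_fun_inner) (auto simp: e)
  also have "\<dots> = (if j = k then 1 else 0)"
    by (auto simp: fun_eq_iff intro!: prod_zero)
  finally show "L2_inner (PiM UNIV M) (tensor e j) (tensor e k) = (if j = k then 1 else 0)" .
qed

text \<open>By Tonelli the product of the factor integrals is finite. None of them is 0, which
  excludes 0 times infinity, so each is finite. In this way membership of the tensor eigenfunctions
  in the Lebesgue spaces descends to each factor.\<close>

lemma tensor_factor_Lp:
  assumes "\<And>r. f r \<in> borel_measurable (M r)" "tensor_fun f \<in> Lp q (PiM UNIV M)"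
    and nz: "\<And>r. \<not> (AE x in M r. f r x = 0)"
  shows "f r \<in> Lp q (M r)"
proof -
  note [measurable] = assms(1)
  let ?a = "\<lambda>r. \<integral>\<^sup>+x. ennreal (norm (f r x) powr q) \<partial>M r"
  have "(\<Prod>r\<in>UNIV. ?a r) = (\<integral>\<^sup>+x. (\<Prod>r\<in>UNIV. ennreal (norm (f r (x r)) powr q)) \<partial>PiM UNIV M)"
    by (intro product_nn_integral_prod[symmetric]) auto
  also have "\<dots> = (\<integral>\<^sup>+x. ennreal (norm (norm (tensor_fun f x) powr q)) \<partial>PiM UNIV M)"
    by (simp add: norm_tensor_fun_powr prod_ennreal prod_nonneg)
  also have "\<dots> < \<infinity>" using LpD(2)[OF assms(2)] unfolding integrable_iff_bounded by blast
  finally have fin: "(\<Prod>r\<in>UNIV. ?a r) \<noteq> top" by simp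
  have "?a r \<noteq> 0" for r
  proof
    assume "?a r = 0"
    then have "AE x in M r. ennreal (norm (f r x) powr q) = 0"
      by (subst (asm) nn_integral_0_iff_AE) auto
    then have "AE x in M r. f r x = 0" by eventually_elim simp
    then show False using nz by blast
  qed
  then have "?a r < \<infinity>" using fin by (auto simp: ennreal_prod_eq_top less_top)
  then have "integrable (M r) (\<lambda>x. norm (f r x) powr q)" by (intro integrableI_bounded) auto
  then show ?thesis by (simp add: Lp_def)
qed

end

lemma (in orthonormal_system) e_not_null: "\<not> (AE x in M. e k x = 0)"
proof
  assume "AE x in M. e k x = 0"
  then have "L2_inner M (e k) (e k) = (LINT x|M. 0)"
    unfolding L2_inner_def using LpD(1)[OF e_Lp2] by (intro integral_cong_AE) auto
  then show False using e_inner[of k k] by simp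
qed

section \<open>The extension theorem for multipliers\<close>

text \<open>Openness and connectedness of a sector are inherited from the strip, on which
  \<open>exp\<close> is injective with inverse \<open>Ln\<close>.\<close>

lemma sector_eq_exp_image:
  assumes "\<phi> < pi"
  shows "sector \<phi> = exp ` {w. \<bar>Im w\<bar> < \<phi>}"
proof (intro set_eqI iffI)
  fix z assume z: "z \<in> sector \<phi>"
  then have "exp (Ln z) = z" "Im (Ln z) = Arg z" by (auto simp: sector_def Arg_def)
  then show "z \<in> exp ` {w. \<bar>Im w\<bar> < \<phi>}"
    using z by (intro image_eqI[of _ _ "Ln z"]) (auto simp: sector_def)
next
  fix z assume "z \<in> exp ` {w. \<bar>Im w\<bar> < \<phi>}"
  then obtain w where w: "z = exp w" "\<bar>Im w\<bar> < \<phi>" by auto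
  then have "Ln z = w" using assms by (auto intro: Ln_exp)
  then show "z \<in> sector \<phi>" using w by (simp add: sector_def Arg_def)
qed

lemma open_sector:
  assumes "\<phi> < pi"
  shows "open (sector \<phi>)"
proof -
  have "open {w. \<bar>Im w\<bar> < \<phi>}" by (intro open_Collect_less continuous_intros)
  moreover have "inj_on exp {w. \<bar>Im w\<bar> < \<phi>}"
    by (rule inj_on_inverseI[of _ Ln]) (use assms in \<open>auto intro: Ln_exp\<close>)
  ultimately show ?thesis
    unfolding sector_eq_exp_image[OF assms] by (intro open_mapping_thm3) (auto intro: holomorphic_intros)
qed

lemma connected_sector:
  assumes "\<phi> < pi"
  shows "connected (sector \<phi>)"
proof -
  have "{w. \<bar>Im w\<bar> < \<phi>} = Im -` {- \<phi> <..< \<phi>}" by auto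
  moreover have "convex (Im -` {- \<phi> <..< \<phi>})"
    by (intro convex_linear_vimage) (auto simp: bounded_linear_Im bounded_linear.linear)
  ultimately have "connected {w. \<bar>Im w\<bar> < \<phi>}" by (simp add: convex_connected)
  then show ?thesis
    unfolding sector_eq_exp_image[OF assms] by (intro connected_continuous_image continuous_intros)
qed

lemma pos_reals_subset_sector: "0 < \<phi> \<Longrightarrow> pos_reals \<subseteq> sector \<phi>"
  by (auto simp: pos_reals_def sector_def)

text \<open>If x > C > 0, the powers of x/C outgrow \<open>K\<close>. Passing to
  \<open>Suc N\<close> ensures a positive exponent, and C = 0 is settled by the first power.\<close>

lemma le_if_powers_le:
  fixes x C K :: real
  assumes "0 \<le> x" "0 \<le> C" "\<And>N. 1 \<le> N \<Longrightarrow> x ^ N \<le> C ^ N * K"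
  shows "x \<le> C"
proof (rule ccontr)
  assume "\<not> x \<le> C"
  then have xC: "C < x" by simp
  show False
  proof (cases "C = 0")
    case True
    then show False using assms(3)[of 1] xC by simp
  next
    case False
    then have C: "0 < C" using assms(2) by simp
    obtain N where N: "K < (x / C) ^ N" using real_arch_pow[of "x / C" K] xC C by auto
    also have "\<dots> \<le> (x / C) ^ Suc N" using xC C by (intro power_increasing) auto
    also have "\<dots> = x ^ Suc N / C ^ Suc N" by (rule power_divide)
    also have "\<dots> \<le> K" using assms(3)[of "Suc N"] C by (simp add: divide_le_eq mult.commute)
    finally show False by simp
  qed
qed

section \<open>Tests coming from the spectral data\<close>

locale spectral_system =
  fixes M :: "'d::finite \<Rightarrow> 'a measure" and e :: "'d \<Rightarrow> nat \<Rightarrow> 'a \<Rightarrow> complex" and ev :: "'d \<Rightarrow> nat \<Rightarrow> real"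
    and p q :: real
  assumes sigma_finite: "\<And>r. sigma_finite_measure (M r)"
    and orthonormal: "\<And>r. orthonormal_system (M r) (e r)"
    and ev_nonneg: "\<And>r. 0 \<le> ev r 0" and ev_mono: "\<And>r. strict_mono (ev r)"
    and pq: "1 < p" "1 < q" "1 / p + 1 / q = 1"
    and e_Lp: "\<And>r k. e r k \<in> Lp p (M r)" and e_Lq: "\<And>r k. e r k \<in> Lp q (M r)"
begin

lemma ev_pos: "0 < k \<Longrightarrow> 0 < ev r k"
  using ev_nonneg[of r] strict_monoD[OF ev_mono, of 0 k r] by linarith

lemma e_Lp2: "e r k \<in> Lp 2 (M r)"
  and e_inner: "L2_inner (M r) (e r j) (e r k) = (if j = k then 1 else 0)"
  using orthonormal_system.e_Lp2[OF orthonormal] orthonormal_system.e_inner[OF orthonormal] by auto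

text \<open>A multiplier symbol need not be continuous at \<open>0\<close>, so eigenvalue \<open>0\<close> gets weight \<open>0\<close>;
  its node is then irrelevant and set to \<open>1\<close>.\<close>

definition spectral_test :: "'d \<Rightarrow> ('a \<Rightarrow> complex) \<Rightarrow> ('a \<Rightarrow> complex) \<Rightarrow> real \<Rightarrow> test" where
  "spectral_test r f g t =
     (\<lambda>k. if 0 < ev r k then L2_inner (M r) f (e r k) * L2_inner (M r) (e r k) g else 0,
      \<lambda>k. complex_of_real (if 0 < ev r k then t * ev r k else 1),
      Lp_norm p (M r) f * Lp_norm q (M r) g)"

definition spectral_tests :: "'d \<Rightarrow> test set" where
  "spectral_tests r = {spectral_test r f g t | f g t.
     f \<in> Lp 2 (M r) \<inter> Lp p (M r) \<and> g \<in> Lp 2 (M r) \<inter> Lp q (M r) \<and> 0 < t}"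

lemma admissible_spectral_test:
  assumes "\<tau> \<in> spectral_tests r"
  shows "admissible \<tau>"
proof -
  obtain f g t where \<tau>: "\<tau> = spectral_test r f g t" "f \<in> Lp 2 (M r)" "g \<in> Lp 2 (M r)" "0 < t"
    using assms by (auto simp: spectral_tests_def)
  have "(\<lambda>k. norm (weight \<tau> k)) summable_on UNIV"
    by (rule Infinite_Sum.abs_summable_on_comparison_test'
        [OF orthonormal_system.coefficients_summable[OF orthonormal \<tau>(2,3)]])
      (simp add: \<tau>(1) spectral_test_def weight_def)
  moreover have "node \<tau> k \<in> pos_reals" for k
    using \<tau>(4) by (auto simp: \<tau>(1) spectral_test_def node_def pos_reals_def)
  moreover have "0 \<le> cost \<tau>"
    by (auto simp: \<tau>(1) spectral_test_def cost_def Lp_norm_nonneg)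
  ultimately show ?thesis by (simp add: admissible_def)
qed

text \<open>The index is 1, not 0, because strict monotonicity makes \<open>ev r 1\<close> positive
  even if \<open>ev r 0\<close> is 0. The dilation by \<open>\<xi> / ev r 1\<close> moves its node
  to \<open>x\<close>, and the cost does not see the dilation.\<close>

lemma point_spectral_test:
  assumes "x \<in> pos_reals"
  shows "\<exists>\<tau>\<in>spectral_tests r. point_test x \<tau> \<and> cost \<tau> = Lp_norm p (M r) (e r 1) * Lp_norm q (M r) (e r 1)"
proof -
  obtain \<xi> where \<xi>: "x = complex_of_real \<xi>" "0 < \<xi>" using assms by (auto simp: pos_reals_def)
  define \<tau> where "\<tau> = spectral_test r (e r 1) (e r 1) (\<xi> / ev r 1)"
  have ev1: "0 < ev r 1" by (rule ev_pos) simp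
  have "\<tau> \<in> spectral_tests r"
    unfolding spectral_tests_def \<tau>_def
    by (intro CollectI exI conjI, rule refl) (simp_all add: e_Lp2 e_Lp e_Lq \<xi> ev1[unfolded One_nat_def])
  moreover have "node \<tau> 1 = x" using ev1 by (simp add: \<tau>_def spectral_test_def node_def \<xi>)
  moreover have "weight \<tau> = (\<lambda>k. if k = 1 then 1 else 0)"
    using ev1 by (auto simp: \<tau>_def spectral_test_def weight_def e_inner fun_eq_iff)
  ultimately show ?thesis by (auto simp: point_test_def \<tau>_def spectral_test_def cost_def)
qed

lemma pairing_spectral_test:
  assumes "0 < t"
  shows "pairing (spectral_test r f g t) n = (\<Sum>\<^sub>\<infinity>k. (if 0 < t * ev r k then n (complex_of_real (t * ev r k)) else 0) *
     (L2_inner (M r) f (e r k) * L2_inner (M r) (e r k) g))"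
  unfolding pairing_def weight_def node_def spectral_test_def using assms
  by (intro infsum_cong) (auto simp: zero_less_mult_iff)

text \<open>Duality turns bounds on the tests into an operator norm. The symbol is set to 0 at the
  eigenvalue 0, in agreement with the weight 0 that the tests give it.\<close>

lemma multiplier_opnorm_le:
  assumes bd: "\<And>x. x \<in> pos_reals \<Longrightarrow> norm (n x) \<le> B" and "0 \<le> K" "0 < t"
    and test: "\<And>\<tau>. \<tau> \<in> spectral_tests r \<Longrightarrow> norm (pairing \<tau> n) \<le> K * cost \<tau>"
  shows "Lp_opnorm p (M r) (multiplier (M r) (e r)
     (\<lambda>k. if 0 < t * ev r k then n (complex_of_real (t * ev r k)) else 0)) \<le> ennreal K"
proof (rule Lp_opnorm_leI[OF assms(2)])
  let ?c = "\<lambda>k. if 0 < t * ev r k then n (complex_of_real (t * ev r k)) else 0"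
  interpret orthonormal_system "M r" "e r" by (rule orthonormal)
  have "norm (n 1) \<le> B" by (rule bd[OF one_pos_reals])
  then have "0 \<le> B" using norm_ge_zero order_trans by blast
  then have c: "norm (?c k) \<le> B" for k
    using bd[of "complex_of_real (t * ev r k)"] by (auto simp: pos_reals_def image_iff simp del: of_real_mult)
  fix f assume f: "f \<in> Lp 2 (M r) \<inter> Lp p (M r)"
  let ?h = "multiplier (M r) (e r) ?c f"
  have h: "?h \<in> Lp 2 (M r)" by (rule multiplier_Lp2[OF _ c]) (use f in blast)
  have "norm (L2_inner (M r) ?h g) \<le> (K * Lp_norm p (M r) f) * Lp_norm q (M r) g"
    if g: "g \<in> Lp 2 (M r) \<inter> Lp q (M r)" for g
  proof -
    have "L2_inner (M r) ?h g = (\<Sum>\<^sub>\<infinity>k. ?c k * (L2_inner (M r) f (e r k) * L2_inner (M r) (e r k) g))"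
      by (rule infsumI[symmetric], rule multiplier_inner[OF _ c]) (use f g in blast)+
    also have "\<dots> = pairing (spectral_test r f g t) n"
      by (rule pairing_spectral_test[OF assms(3), symmetric])
    also have "norm \<dots> \<le> K * cost (spectral_test r f g t)"
      by (rule test) (use f g assms(3) in \<open>auto simp: spectral_tests_def\<close>)
    finally show ?thesis by (simp add: spectral_test_def cost_def mult.assoc)
  qed
  moreover have "0 \<le> K * Lp_norm p (M r) f" using assms(2) by (simp add: Lp_norm_nonneg)
  ultimately show "?h \<in> Lp p (M r) \<and> Lp_norm p (M r) ?h \<le> K * Lp_norm p (M r) f"
    using Lp_bounded_by_duality[OF pq h] by blast
qed

text \<open>Since the eigenvalues increase strictly from a nonnegative one, the kernel is at most
  the line spanned by \<open>e r 0\<close>, and the projection subtracts a single term.\<close>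

definition drop_kernel :: "'d \<Rightarrow> ('a \<Rightarrow> complex) \<Rightarrow> 'a \<Rightarrow> complex" where
  "drop_kernel r f = (\<lambda>x. f x - (if ev r 0 = 0 then L2_inner (M r) f (e r 0) else 0) * e r 0 x)"

text \<open>Holder bounds the subtracted coefficient by the \<open>L\<^sup>q\<close> norm of
  \<open>e r 0\<close>; the 4 is the constant of \<open>Lp_diff\<close>.\<close>

definition drop_const :: "'d \<Rightarrow> real" where
  "drop_const r = 4 * (1 + Lp_norm q (M r) (e r 0) * Lp_norm p (M r) (e r 0))"

lemma drop_kernel_Lp2: "f \<in> Lp 2 (M r) \<Longrightarrow> drop_kernel r f \<in> Lp 2 (M r)"
  unfolding drop_kernel_def by (intro Lp_diff Lp_scale e_Lp2) auto

text \<open>The case distinction is that of the weights of \<open>spectral_test\<close>: pairing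
  with \<open>drop_kernel r f\<close> reproduces them exactly.\<close>

lemma drop_kernel_inner:
  assumes "f \<in> Lp 2 (M r)"
  shows "L2_inner (M r) (drop_kernel r f) (e r k) = (if 0 < ev r k then L2_inner (M r) f (e r k) else 0)"
proof -
  have "0 < ev r k \<longleftrightarrow> \<not> (k = 0 \<and> ev r 0 = 0)"
    using ev_pos[of k r] ev_nonneg[of r] by (cases "k = 0") auto
  moreover have s: "(\<lambda>x. (if ev r 0 = 0 then L2_inner (M r) f (e r 0) else 0) * e r 0 x) \<in> Lp 2 (M r)"
    by (rule Lp_scale(1)[OF _ e_Lp2]) simp
  ultimately show ?thesis
    unfolding drop_kernel_def L2_inner_diff_left[OF assms s e_Lp2] L2_inner_scale_left e_inner
    by auto
qed

lemma drop_kernel_Lp: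
  assumes "f \<in> Lp p (M r)"
  shows "drop_kernel r f \<in> Lp p (M r)" "Lp_norm p (M r) (drop_kernel r f) \<le> drop_const r * Lp_norm p (M r) f"
proof -
  let ?c = "if ev r 0 = 0 then L2_inner (M r) f (e r 0) else 0"
  have s: "(\<lambda>x. ?c * e r 0 x) \<in> Lp p (M r)" using pq by (intro Lp_scale e_Lp) auto
  show "drop_kernel r f \<in> Lp p (M r)"
    unfolding drop_kernel_def using pq by (intro Lp_diff(1) assms s) auto
  have "norm ?c \<le> Lp_norm p (M r) f * Lp_norm q (M r) (e r 0)"
    using Holder(3)[OF pq assms e_Lq] by (auto simp: Lp_norm_nonneg)
  then have "norm ?c * Lp_norm p (M r) (e r 0) \<le> Lp_norm p (M r) f * Lp_norm q (M r) (e r 0) * Lp_norm p (M r) (e r 0)"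
    by (intro mult_right_mono) (auto simp: Lp_norm_nonneg)
  moreover have "Lp_norm p (M r) (drop_kernel r f) \<le> 4 * (Lp_norm p (M r) f + norm ?c * Lp_norm p (M r) (e r 0))"
    unfolding drop_kernel_def using Lp_diff(2)[OF _ assms s] Lp_scale(2)[of p "e r 0" "M r" ?c] pq e_Lp by simp
  ultimately show "Lp_norm p (M r) (drop_kernel r f) \<le> drop_const r * Lp_norm p (M r) f"
    by (simp add: drop_const_def algebra_simps)
qed

lemma drop_const_nonneg: "0 \<le> drop_const r"
  by (simp add: drop_const_def Lp_norm_nonneg)

text \<open>The multiplier maps the intersection of \<open>L\<^sup>2\<close> and
  \<open>L\<^sup>p\<close> into itself, so it can be iterated there: norms grow at most by
  \<open>C\<close> per step, while coefficients are multiplied by \<open>c k\<close>. Powers of the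
  symbol are thus handled without separate operators.\<close>

lemma tensor_power_pairing_bound:
  assumes f: "\<And>r. f r \<in> Lp 2 (M r) \<inter> Lp p (M r)" and g: "\<And>r. g r \<in> Lp 2 (M r) \<inter> Lp q (M r)"
    and c: "\<And>k. norm (c k) \<le> B" and "0 \<le> C"
    and op: "Lp_opnorm p (PiM UNIV M) (multiplier (PiM UNIV M) (tensor e) c) \<le> ennreal C"
  shows "norm (\<Sum>\<^sub>\<infinity>k. c k ^ Suc N * (\<Prod>r\<in>UNIV. L2_inner (M r) (f r) (e r (k r)) * L2_inner (M r) (e r (k r)) (g r)))
     \<le> C ^ Suc N * (\<Prod>r\<in>UNIV. Lp_norm p (M r) (f r) * Lp_norm q (M r) (g r))"
proof -
  let ?P = "PiM UNIV M" and ?T = "multiplier (PiM UNIV M) (tensor e) c"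
  have e: "e r k \<in> Lp 2 (M r)" for r k by (rule e_Lp2)
  interpret orthonormal_system ?P "tensor e"
    by (rule orthonormal_system_tensor[OF sigma_finite orthonormal])
  have F: "tensor_fun f \<in> Lp 2 ?P" "tensor_fun f \<in> Lp p ?P"
    and G: "tensor_fun g \<in> Lp 2 ?P" "tensor_fun g \<in> Lp q ?P"
    using f g by (auto intro!: tensor_fun_Lp[OF sigma_finite])
  define h where "h i = (?T ^^ i) (tensor_fun f)" for i
  have h: "h i \<in> Lp 2 ?P \<and> h i \<in> Lp p ?P \<and> Lp_norm p ?P (h i) \<le> C ^ i * Lp_norm p ?P (tensor_fun f) \<and>
      (\<forall>k. L2_inner ?P (h i) (tensor e k) = c k ^ i * L2_inner ?P (tensor_fun f) (tensor e k))" for i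
  proof (induction i)
    case 0
    then show ?case using F by (simp add: h_def)
  next
    case (Suc i)
    have "Lp_norm p ?P (?T (h i)) \<le> C * Lp_norm p ?P (h i)"
      using Lp_opnorm_leD(2)[OF op assms(4)] Suc by blast
    also have "\<dots> \<le> C * (C ^ i * Lp_norm p ?P (tensor_fun f))"
      using Suc assms(4) by (intro mult_left_mono) auto
    finally have "Lp_norm p ?P (?T (h i)) \<le> C ^ Suc i * Lp_norm p ?P (tensor_fun f)" by (simp add: mult.assoc)
    moreover have "?T (h i) \<in> Lp p ?P" using Lp_opnorm_leD(1)[OF op assms(4)] Suc by blast
    moreover have "?T (h i) \<in> Lp 2 ?P" using Suc by (intro multiplier_Lp2[OF _ c]) blast
    moreover have "L2_inner ?P (?T (h i)) (tensor e k) = c k ^ Suc i * L2_inner ?P (tensor_fun f) (tensor e k)" for k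
      using Suc by (subst multiplier_coefficient[OF _ c]) auto
    moreover have "h (Suc i) = ?T (h i)" by (simp add: h_def)
    ultimately show ?case by simp
  qed
  \<comment> \<open>The last of the \<open>Suc N\<close> applications is kept as a multiplier,
    because \<open>multiplier_inner\<close> supplies the expansion of the inner product.\<close>
  have "((\<lambda>k. c k * (L2_inner ?P (h N) (tensor e k) * L2_inner ?P (tensor e k) (tensor_fun g))) has_sum
      L2_inner ?P (?T (h N)) (tensor_fun g)) UNIV"
    by (rule multiplier_inner[OF _ c G(1)]) (use h in blast)
  moreover have "c k * (L2_inner ?P (h N) (tensor e k) * L2_inner ?P (tensor e k) (tensor_fun g)) =
      c k ^ Suc N * (\<Prod>r\<in>UNIV. L2_inner (M r) (f r) (e r (k r)) * L2_inner (M r) (e r (k r)) (g r))" for k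
  proof -
    have "L2_inner ?P (tensor_fun f) (tensor e k) = (\<Prod>r\<in>UNIV. L2_inner (M r) (f r) (e r (k r)))"
      "L2_inner ?P (tensor e k) (tensor_fun g) = (\<Prod>r\<in>UNIV. L2_inner (M r) (e r (k r)) (g r))"
      unfolding tensor_eq_tensor_fun using f g e by (auto intro!: tensor_fun_inner[OF sigma_finite])
    then show ?thesis using h[of N] by (simp add: prod.distrib)
  qed
  ultimately have "((\<lambda>k. c k ^ Suc N * (\<Prod>r\<in>UNIV. L2_inner (M r) (f r) (e r (k r)) * L2_inner (M r) (e r (k r)) (g r)))
      has_sum L2_inner ?P (?T (h N)) (tensor_fun g)) UNIV"
    by (simp only:)
  then have "(\<Sum>\<^sub>\<infinity>k. c k ^ Suc N * (\<Prod>r\<in>UNIV. L2_inner (M r) (f r) (e r (k r)) * L2_inner (M r) (e r (k r)) (g r)))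
      = L2_inner ?P (h (Suc N)) (tensor_fun g)"
    by (simp only: infsumI) (simp add: h_def)
  also have "norm \<dots> \<le> Lp_norm p ?P (h (Suc N)) * Lp_norm q ?P (tensor_fun g)"
    using Holder(3)[OF pq _ G(2)] h[of "Suc N"] by blast
  also have "\<dots> \<le> C ^ Suc N * Lp_norm p ?P (tensor_fun f) * Lp_norm q ?P (tensor_fun g)"
    using h[of "Suc N"] by (intro mult_right_mono) (auto simp: Lp_norm_nonneg)
  also have "\<dots> = C ^ Suc N * (\<Prod>r\<in>UNIV. Lp_norm p (M r) (f r) * Lp_norm q (M r) (g r))"
    using f g by (simp add: tensor_fun_Lp(2)[OF sigma_finite] prod.distrib)
  finally show ?thesis .
qed

text \<open>As a sum over multi-indices, the iterated pairing is an inner product of the operator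
  power with the tensors of \<open>drop_kernel r (f r)\<close> and \<open>g r\<close>. Projecting
  the \<open>f r\<close> suffices, since only products of coefficients occur. The value 0 off the
  positive points makes the function bounded everywhere, as \<open>pairings_eq_infsum\<close>
  requires.\<close>

lemma power_tests_bound:
  fixes m :: "real ^ 'd \<Rightarrow> complex"
  assumes bd: "\<And>x. (\<And>r. 0 \<le> x $ r) \<Longrightarrow> norm (m x) \<le> B" and "0 \<le> C"
    and op: "\<And>t. (\<And>r. 0 < t $ r) \<Longrightarrow> Lp_opnorm p (PiM UNIV M)
      (multiplier (PiM UNIV M) (tensor e) (\<lambda>k. m (\<chi> r. t $ r * ev r (k r)))) \<le> ennreal C"
    and \<tau>: "\<And>r. \<tau> r \<in> spectral_tests r" and rs: "distinct rs" "set rs = UNIV"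
  shows "norm (pairings rs \<tau> (\<lambda>y. if \<forall>r. y r \<in> pos_reals then m (\<chi> r. Re (y r)) ^ Suc N else 0) z)
     \<le> C ^ Suc N * (\<Prod>r\<in>UNIV. drop_const r) * (\<Prod>r\<in>UNIV. cost (\<tau> r))"
proof -
  let ?F = "\<lambda>y. if \<forall>r. y r \<in> pos_reals then m (\<chi> r. Re (y r)) ^ Suc N else 0"
  have "\<forall>r. \<exists>f g t. \<tau> r = spectral_test r f g t \<and> f \<in> Lp 2 (M r) \<inter> Lp p (M r) \<and> g \<in> Lp 2 (M r) \<inter> Lp q (M r) \<and> 0 < t"
    using \<tau> unfolding spectral_tests_def by blast
  then obtain f g t where fgt: "\<And>r. \<tau> r = spectral_test r (f r) (g r) (t r)"
      "\<And>r. f r \<in> Lp 2 (M r) \<inter> Lp p (M r)" "\<And>r. g r \<in> Lp 2 (M r) \<inter> Lp q (M r)" "\<And>r. 0 < t r"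
    by metis
  have B: "0 \<le> B" using bd[of 0] norm_ge_zero[of "m 0"] by (simp del: norm_ge_zero)
  define c where "c k = m (\<chi> r. t r * ev r (k r))" for k
  have ev0: "0 \<le> ev r k" for r k
    using ev_pos[of k r] ev_nonneg[of r] by (cases "k = 0") auto
  have c: "norm (c k) \<le> B" for k
    unfolding c_def using fgt(4) ev0 by (intro bd) (simp add: less_imp_le)
  have "norm (?F y) \<le> B ^ Suc N" for y
  proof (cases "\<forall>r. y r \<in> pos_reals")
    case True
    have "0 \<le> Re (y r)" for r using True[rule_format, of r] by (auto simp: pos_reals_def)
    then have "norm (m (\<chi> r. Re (y r))) \<le> B" by (intro bd) simp
    then show ?thesis using True unfolding norm_power by (simp only: simp_thms if_True norm_power power_mono norm_ge_zero)
  next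
    case False
    then show ?thesis by (simp only: if_False if_not_P[OF False] norm_zero zero_le_power B)
  qed
  then have "pairings rs \<tau> ?F z = (\<Sum>\<^sub>\<infinity>\<kappa>\<in>PiE (set rs) (\<lambda>_. UNIV).
     (\<Prod>r\<in>set rs. weight (\<tau> r) (\<kappa> r)) * ?F (\<lambda>r. if r \<in> set rs then node (\<tau> r) (\<kappa> r) else z r))"
    by (rule pairings_eq_infsum[OF rs(1) admissible_spectral_test[OF \<tau>]])
  also have "\<dots> = (\<Sum>\<^sub>\<infinity>\<kappa>. c \<kappa> ^ Suc N *
      (\<Prod>r\<in>UNIV. L2_inner (M r) (drop_kernel r (f r)) (e r (\<kappa> r)) * L2_inner (M r) (e r (\<kappa> r)) (g r)))"
  proof (rule infsum_cong_neutral)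
    fix \<kappa> :: "'d \<Rightarrow> nat"
    have d: "L2_inner (M r) (drop_kernel r (f r)) (e r (\<kappa> r)) * L2_inner (M r) (e r (\<kappa> r)) (g r) = weight (\<tau> r) (\<kappa> r)" for r
      using fgt(2)[of r] by (subst drop_kernel_inner) (auto simp: fgt(1) spectral_test_def weight_def)
    have n: "?F (\<lambda>r. if r \<in> set rs then node (\<tau> r) (\<kappa> r) else z r) = m (\<chi> r. Re (node (\<tau> r) (\<kappa> r))) ^ Suc N"
      using admissible_spectral_test[OF \<tau>] by (simp add: rs(2) admissible_def)
    show "(\<Prod>r\<in>set rs. weight (\<tau> r) (\<kappa> r)) * ?F (\<lambda>r. if r \<in> set rs then node (\<tau> r) (\<kappa> r) else z r) =
       c \<kappa> ^ Suc N * (\<Prod>r\<in>UNIV. L2_inner (M r) (drop_kernel r (f r)) (e r (\<kappa> r)) * L2_inner (M r) (e r (\<kappa> r)) (g r))"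
    \<comment> \<open>If some eigenvalue vanishes, the actual value of \<open>m\<close> on the face
      and the value at the substitute node may differ, but the weight 0 kills both terms.\<close>
    proof (cases "\<forall>r. 0 < ev r (\<kappa> r)")
      case True
      then have "m (\<chi> r. Re (node (\<tau> r) (\<kappa> r))) = c \<kappa>"
        by (simp add: c_def fgt(1) spectral_test_def node_def)
      then show ?thesis unfolding n d by (simp add: rs(2))
    next
      case False
      then obtain r where "\<not> 0 < ev r (\<kappa> r)" by blast
      then have "weight (\<tau> r) (\<kappa> r) = 0" by (simp add: fgt(1) spectral_test_def weight_def)
      then have "(\<Prod>r\<in>UNIV. weight (\<tau> r) (\<kappa> r)) = 0" by (intro prod_zero) auto
      then show ?thesis unfolding d rs(2) by simp
    qed
  qed (auto simp: rs(2))
  also have "norm \<dots> \<le> C ^ Suc N * (\<Prod>r\<in>UNIV. Lp_norm p (M r) (drop_kernel r (f r)) * Lp_norm q (M r) (g r))"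
  proof (rule tensor_power_pairing_bound[OF _ fgt(3) c assms(2)])
    show "drop_kernel r (f r) \<in> Lp 2 (M r) \<inter> Lp p (M r)" for r
      using fgt(2)[of r] drop_kernel_Lp2 drop_kernel_Lp by blast
    show "Lp_opnorm p (PiM UNIV M) (multiplier (PiM UNIV M) (tensor e) c) \<le> ennreal C"
      using op[of "\<chi> r. t r"] fgt(4) unfolding c_def[abs_def] by simp
  qed
  also have "\<dots> \<le> C ^ Suc N * (\<Prod>r\<in>UNIV. drop_const r * cost (\<tau> r))"
  proof (intro mult_left_mono prod_mono conjI)
    fix r
    have "Lp_norm p (M r) (drop_kernel r (f r)) * Lp_norm q (M r) (g r) \<le> (drop_const r * Lp_norm p (M r) (f r)) * Lp_norm q (M r) (g r)"
      using fgt(2)[of r] by (intro mult_right_mono drop_kernel_Lp) (auto simp: Lp_norm_nonneg)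
    then show "Lp_norm p (M r) (drop_kernel r (f r)) * Lp_norm q (M r) (g r) \<le> drop_const r * cost (\<tau> r)"
      by (simp add: fgt(1) spectral_test_def cost_def mult.assoc)
  qed (use assms(2) in \<open>auto simp: Lp_norm_nonneg\<close>)
  finally show ?thesis by (simp add: prod.distrib mult.assoc)
qed

end

theorem theorem4p3p1:
  fixes M :: "'d::finite \<Rightarrow> 'a measure"
    and D :: "'d \<Rightarrow> ('a \<Rightarrow> complex) set"
    and L :: "'d \<Rightarrow> ('a \<Rightarrow> complex) \<Rightarrow> ('a \<Rightarrow> complex)"
    and e :: "'d \<Rightarrow> nat \<Rightarrow> 'a \<Rightarrow> complex"
    and ev :: "'d \<Rightarrow> nat \<Rightarrow> real"
    and p :: real
    and \<phi> :: "'d \<Rightarrow> real"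
    and m :: "real ^ 'd \<Rightarrow> complex"
  assumes "\<And>r. sigma_finite_measure (M r)"
    and "\<And>r. selfadjoint_operator (M r) (D r) (L r)"
    and "\<And>r. nonneg_operator (M r) (D r) (L r)"
    and "\<And>r. orthonormal_basis (M r) (e r)"
    and "\<And>r k. e r k \<in> D r \<and> (AE x in M r. L r (e r k) x = complex_of_real (ev r k) * e r k x)"
    and "\<And>r. 0 \<le> ev r 0"
    and "\<And>r. strict_mono (ev r)"
    and "\<And>q. 1 < q \<Longrightarrow> linearly_dense q (PiM UNIV M) (tensor e)"
    and "1 < p"
    and "\<And>r. 0 < \<phi> r \<and> \<phi> r < pi / 2"
    and "\<And>r (n :: real \<Rightarrow> complex).
           bounded (n ` {0..}) \<Longrightarrow> continuous_on {0<..} n \<Longrightarrow>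
           (SUP t\<in>{0::real<..}. Lp_opnorm p (M r) (multiplier (M r) (e r) (\<lambda>k. n (t * ev r k)))) < \<infinity> \<Longrightarrow>
           \<exists>F. F holomorphic_on sector (\<phi> r) \<and> bounded (F ` sector (\<phi> r)) \<and>
               (\<forall>x>0. F (complex_of_real x) = n x) \<and>
               Hinf_norm (sector (\<phi> r)) F
                 \<le> (SUP t\<in>{0::real<..}. Lp_opnorm p (M r) (multiplier (M r) (e r) (\<lambda>k. n (t * ev r k))))"
    and "bounded (m ` {x. \<forall>r. 0 \<le> x $ r})"
    and "continuous_on {x. \<forall>r. 0 < x $ r} m"
    and "(SUP t\<in>{t :: real ^ 'd. \<forall>r. 0 < t $ r}.
            Lp_opnorm p (PiM UNIV M)
              (multiplier (PiM UNIV M) (tensor e) (\<lambda>k. m (\<chi> r. t $ r * ev r (k r))))) < \<infinity>"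
  shows "\<exists>F. holomorphic_several F (polysector \<phi>) \<and> bounded (F ` polysector \<phi>) \<and>
             (\<forall>x. (\<forall>r. 0 < x $ r) \<longrightarrow> F (\<chi> r. complex_of_real (x $ r)) = m x) \<and>
             Hinf_norm (polysector \<phi>) F
               \<le> (SUP t\<in>{t :: real ^ 'd. \<forall>r. 0 < t $ r}.
                    Lp_opnorm p (PiM UNIV M)
                      (multiplier (PiM UNIV M) (tensor e) (\<lambda>k. m (\<chi> r. t $ r * ev r (k r)))))"
proof -
  define q where "q = p / (p - 1)"
  have pq: "1 < p" "1 < q" "1 / p + 1 / q = 1"
    using assms(9) by (auto simp: q_def field_simps)
  have orth: "orthonormal_system (M r) (e r)" for r
    using assms(4)[of r] by (auto simp: orthonormal_basis_def orthonormal_system_def)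
  have e_meas: "e r k \<in> borel_measurable (M r)" for r k
    by (rule LpD(1)[OF orthonormal_system.e_Lp2[OF orth]])
  \<comment> \<open>Taking the same index in every coordinate gives a tensor eigenfunction with
    \<open>e r k\<close> as a factor; it lies in \<open>Lp s\<close> by the linear density
    hypothesis.\<close>
  have e_Lp: "e r k \<in> Lp s (M r)" if "1 < s" for r k s
  proof (rule tensor_factor_Lp[where f = "\<lambda>r. e r k", OF assms(1) e_meas])
    show "tensor_fun (\<lambda>r. e r k) \<in> Lp s (PiM UNIV M)"
      using assms(8)[OF that] tensor_eq_tensor_fun[of e "\<lambda>_. k"] unfolding linearly_dense_def by metis
    show "\<not> (AE x in M r. e r k x = 0)" for r
      by (rule orthonormal_system.e_not_null[OF orth])
  qed
  interpret spectral_system M e ev p q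
    by (rule spectral_system.intro[OF assms(1) orth assms(6,7) pq e_Lp[OF pq(1)] e_Lp[OF pq(2)]])
  have \<phi>: "0 < \<phi> r" "\<phi> r < pi" for r using assms(10)[of r] pi_gt_zero by (auto intro: less_trans)
  interpret extension_property "\<lambda>r. sector (\<phi> r)" spectral_tests
    "\<lambda>r. Lp_norm p (M r) (e r 1) * Lp_norm q (M r) (e r 1)"
  proof
    fix r
    show "open (sector (\<phi> r))" "connected (sector (\<phi> r))" "pos_reals \<subseteq> sector (\<phi> r)"
      using \<phi> by (auto intro!: open_sector connected_sector pos_reals_subset_sector)
    show "admissible \<tau>" if "\<tau> \<in> spectral_tests r" for \<tau> by (rule admissible_spectral_test[OF that])
    show "\<exists>\<tau>\<in>spectral_tests r. point_test x \<tau> \<and> cost \<tau> = Lp_norm p (M r) (e r 1) * Lp_norm q (M r) (e r 1)"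
      if "x \<in> pos_reals" for x by (rule point_spectral_test[OF that])
    fix n :: "complex \<Rightarrow> complex" and K :: real
    assume cont: "continuous_on pos_reals n" and bd: "bounded (n ` pos_reals)" and K: "0 \<le> K"
      and test: "\<And>\<tau>. \<tau> \<in> spectral_tests r \<Longrightarrow> norm (pairing \<tau> n) \<le> K * cost \<tau>"
    obtain B where B: "\<And>x. x \<in> pos_reals \<Longrightarrow> norm (n x) \<le> B" using bd by (auto simp: bounded_iff)
    \<comment> \<open>The value 0 at the origin matches \<open>multiplier_opnorm_le\<close>; a jump
      there is allowed because the hypothesis asks for continuity on the open half line.\<close>
    define n' where "n' x = (if 0 < x then n (complex_of_real x) else 0)" for x
    have n'B: "norm (n' x) \<le> max B 0" for x
      using B[of "complex_of_real x"] by (auto simp: n'_def pos_reals_def)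
    have le: "(SUP t\<in>{0<..}. Lp_opnorm p (M r) (multiplier (M r) (e r) (\<lambda>k. n' (t * ev r k)))) \<le> ennreal K"
      unfolding n'_def by (intro SUP_least multiplier_opnorm_le[OF B K _ test]) auto
    have "continuous_on {0<..} (\<lambda>x. n (complex_of_real x))"
      by (rule continuous_on_compose2[OF cont]) (auto simp: pos_reals_def intro!: continuous_intros)
    then have "continuous_on {0<..} n'"
      by (rule continuous_on_eq) (simp add: n'_def)
    moreover have "bounded (n' ` {0..})" unfolding bounded_iff using n'B by blast
    moreover have "(SUP t\<in>{0<..}. Lp_opnorm p (M r) (multiplier (M r) (e r) (\<lambda>k. n' (t * ev r k)))) < \<infinity>"
      using le by (rule le_less_trans) simp
    ultimately obtain F where F: "F holomorphic_on sector (\<phi> r)" "\<And>x. 0 < x \<Longrightarrow> F (complex_of_real x) = n' x"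
      "Hinf_norm (sector (\<phi> r)) F \<le> (SUP t\<in>{0<..}. Lp_opnorm p (M r) (multiplier (M r) (e r) (\<lambda>k. n' (t * ev r k))))"
      using assms(11)[of n' r] by blast
    have "norm (F z) \<le> K" if "z \<in> sector (\<phi> r)" for z
    proof -
      have "ennreal (norm (F z)) \<le> Hinf_norm (sector (\<phi> r)) F" unfolding Hinf_norm_def by (rule SUP_upper[OF that])
      also note F(3)
      also note le
      finally show ?thesis using K by simp
    qed
    moreover have "F x = n x" if "x \<in> pos_reals" for x
      using that F(2) by (auto simp: pos_reals_def n'_def)
    ultimately show "\<exists>G. G holomorphic_on sector (\<phi> r) \<and> (\<forall>x\<in>pos_reals. G x = n x) \<and> (\<forall>z\<in>sector (\<phi> r). norm (G z) \<le> K)"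
      using F(1) by blast
  qed
  let ?norm = "\<lambda>t. Lp_opnorm p (PiM UNIV M) (multiplier (PiM UNIV M) (tensor e) (\<lambda>k. m (\<chi> r. t $ r * ev r (k r))))"
  let ?SUP = "SUP t\<in>{t :: real ^ 'd. \<forall>r. 0 < t $ r}. ?norm t"
  define C where "C = enn2real ?SUP"
  have C: "0 \<le> C" "?SUP = ennreal C" using assms(14) by (auto simp: C_def)
  have op: "?norm t \<le> ennreal C" if "\<And>r. 0 < t $ r" for t :: "real ^ 'd"
    unfolding C(2)[symmetric] by (rule SUP_upper) (use that in auto)
  obtain B where B: "\<And>x. (\<And>r. 0 \<le> x $ r) \<Longrightarrow> norm (m x) \<le> B"
    using assms(12) by (auto simp: bounded_iff)
  obtain rs :: "'d list" where rs: "set rs = UNIV" "distinct rs"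
    using finite_distinct_list[of "UNIV :: 'd set"] by auto
  define K where "K = (\<Prod>r\<in>UNIV. drop_const r)"
  have K: "0 \<le> K" unfolding K_def by (intro prod_nonneg) (auto simp: drop_const_nonneg)
  \<comment> \<open>With the exponent \<open>Suc N\<close>, the case N = 0 is \<open>m\<close>
    itself, and its extension \<open>F 0\<close> is the function sought.\<close>
  define m' where "m' N y = (if \<forall>r. y r \<in> pos_reals then m (\<chi> r. Re (y r)) ^ Suc N else 0)" for N :: nat and y
  let ?S = "\<lambda>z. \<forall>r. z r \<in> sector (\<phi> r)"
  have "\<exists>F. (\<forall>z s. ?S z \<longrightarrow> (\<lambda>u. F (z(s := u))) holomorphic_on sector (\<phi> s)) \<and>
     (\<forall>z. (\<forall>r. z r \<in> pos_reals) \<longrightarrow> F z = m' N z) \<and> (\<forall>z. ?S z \<longrightarrow> norm (F z) \<le> C ^ Suc N * K)" for N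
  proof (rule multivariate_extension[OF rs(2,1)])
    show "0 \<le> C ^ Suc N * K" using C K by simp
    show "norm (pairings rs \<tau> (m' N) z) \<le> C ^ Suc N * K * (\<Prod>r\<in>UNIV. cost (\<tau> r))"
      if "\<And>r. \<tau> r \<in> spectral_tests r" for z \<tau>
      unfolding m'_def[abs_def] K_def by (rule power_tests_bound[OF B C(1) op that rs(2,1)])
    show "continuous_on pos_reals (\<lambda>u. m' N (z(s := u)))" if z: "\<And>r. z r \<in> pos_reals" for z s
    proof -
      have "continuous_on pos_reals (\<lambda>u. m (\<chi> r. Re ((z(s := u)) r)) ^ Suc N)"
      proof (rule continuous_on_power, rule continuous_on_compose2[OF assms(13)])
        have "continuous_on pos_reals (\<lambda>u. Re ((z(s := u)) r))" for r
          by (cases "r = s") (auto intro: continuous_intros)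
        then show "continuous_on pos_reals (\<lambda>u. \<chi> r. Re ((z(s := u)) r))"
          by (rule continuous_on_vec_lambda)
        have "0 < Re u" if "u \<in> pos_reals" for u using that by (auto simp: pos_reals_def)
        then show "(\<lambda>u. \<chi> r. Re ((z(s := u)) r)) ` pos_reals \<subseteq> {x. \<forall>r. 0 < x $ r}"
          using z by auto
      qed
      then show ?thesis
        by (rule continuous_on_eq) (use z in \<open>simp add: m'_def\<close>)
    qed
  qed
  then have "\<forall>N. \<exists>F. (\<forall>z s. ?S z \<longrightarrow> (\<lambda>u. F (z(s := u))) holomorphic_on sector (\<phi> s)) \<and>
     (\<forall>z. (\<forall>r. z r \<in> pos_reals) \<longrightarrow> F z = m' N z) \<and> (\<forall>z. ?S z \<longrightarrow> norm (F z) \<le> C ^ Suc N * K)" by blast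
  from choice[OF this] obtain F where F:
    "\<And>N z s. ?S z \<Longrightarrow> (\<lambda>u. F N (z(s := u))) holomorphic_on sector (\<phi> s)"
    "\<And>N z. (\<forall>r. z r \<in> pos_reals) \<Longrightarrow> F N z = m' N z"
    "\<And>N z. ?S z \<Longrightarrow> norm (F N z) \<le> C ^ Suc N * K" by blast
  let ?F = "F 0"
  \<comment> \<open>The extensions for different N were obtained independently; uniqueness
    identifies them with the powers of \<open>F 0\<close>.\<close>
  have F_power: "F N z = ?F z ^ Suc N" if "?S z" for N z
  proof (rule separately_holomorphic_unique[where F = "F N" and G = "\<lambda>z. ?F z ^ Suc N", OF open_S connected_S pos_S])
    show "(\<lambda>u. F N (z(s := u))) holomorphic_on sector (\<phi> s)" if "\<And>r. z r \<in> sector (\<phi> r)" for z s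
      using F(1) that by blast
    show "(\<lambda>u. ?F (z(s := u)) ^ Suc N) holomorphic_on sector (\<phi> s)" if "\<And>r. z r \<in> sector (\<phi> r)" for z s
      using F(1) that by (intro holomorphic_intros) blast
    show "F N z = ?F z ^ Suc N" if "\<And>r. z r \<in> pos_reals" for z
      using F(2) that by (simp add: m'_def)
  qed (use that in blast)
  \<comment> \<open>The bound \<open>C ^ N * K\<close> for all powers at once removes
    \<open>K\<close>, so the kernel correction leaves no trace in the final constant.\<close>
  have FC: "norm (?F z) \<le> C" if z: "?S z" for z
  proof (rule le_if_powers_le[OF norm_ge_zero C(1)])
    fix N :: nat assume "1 \<le> N"
    then obtain N' where "N = Suc N'" by (cases N) auto
    then show "norm (?F z) ^ N \<le> C ^ N * K"
      using F(3)[OF z, of N'] by (simp only: F_power[OF z, of N'] norm_power)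
  qed
  have poly: "polysector \<phi> = {v. \<forall>r. v $ r \<in> sector (\<phi> r)}" by (auto simp: polysector_def)
  let ?G = "\<lambda>v. ?F (\<lambda>r. v $ r)"
  have "holomorphic_several ?G (polysector \<phi>)"
    unfolding poly
    by (rule Osgood[OF open_S]) (use F(1) FC in blast)+
  moreover have GC: "norm (?G v) \<le> C" if "v \<in> polysector \<phi>" for v
    using that FC by (auto simp: poly)
  then have "bounded (?G ` polysector \<phi>)" unfolding bounded_iff by blast
  moreover have "?G (\<chi> r. complex_of_real (x $ r)) = m x" if "\<forall>r. 0 < x $ r" for x :: "real ^ 'd"
  proof -
    have "complex_of_real (x $ r) \<in> pos_reals" for r using that by (auto simp: pos_reals_def)
    then show ?thesis using F(2)[of "\<lambda>r. complex_of_real (x $ r)" 0] by (simp add: m'_def)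
  qed
  moreover have "Hinf_norm (polysector \<phi>) ?G \<le> ?SUP"
    unfolding Hinf_norm_def C(2) by (intro SUP_least ennreal_leI GC)
  ultimately show ?thesis by blast
qed

end
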